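(* For all $\eta>0$, $\mathcal F\in C^2(\mathbb R)\setminus C^3(\mathbb R)$ and the following properties hold. (1) As $x\uparrow2$, $\mathcal F(x)=\frac1{12}(2-x)^3+O\bigl((2-x)^4\bigr)$. (2) The function $\mathcal F''$ is not Hölder continuous at $x_*$ for any Hölder exponent.
   Context: Theta functions ($\operatorname{Im}\tau>0$): $\vartheta(z|\tau)=\sum_{n\in\mathbb Z}e^{2\pi i nz+i\pi n^2\tau}$, $\vartheta_{11}(z|\tau)=i\,e^{i\pi(z+\tau/4)}\vartheta(z+\frac{1+\tau}2|\tau)$; a prime on a theta function is the derivative in $z$. For $\eta>0$: $x_*=-2(1-e^{-\eta})\eta^{-1}$; for $K>\eta/2$, $\mathcal U(K)=2K\,e^{\frac\eta2(\frac{\eta}{2K}-1)}\vartheta_{11}(\frac{\eta}{2K}|\frac{i\pi}{K})/\vartheta_{11}'(0|\frac{i\pi}{K})$. For $x\in(x_*,2)$, $\mathcal K(x)$ is the unique $K\in(\eta/2,\infty)$ with $(1-K\partial_K)\mathcal U(K)=-\frac{\eta x}2$ (the left-hand side is increasing in $K$ with range $(-\eta,1-e^{-\eta})$), and $\mathcal L(x)=-\partial_K\mathcal U(K)|_{K=\mathcal K(x)}$. The function $\mathcal F:\mathbb R\to\mathbb R_{\ge0}$ is $$\mathcal F(x)=\begin{cases}\frac{\eta x^2}{2}+1-e^{-\eta}&x\le x_*,\\\frac{\eta x^2}{2}+1-e^{-\eta}+\eta\int_{x_*}^x\mathcal L(y)\,dy&x_*<x<2,\\0&x\ge2.\end{cases}$$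 *)

theory Defs
  imports "HOL-Analysis.Analysis" "HOL-Library.Landau_Symbols"
begin

definition jtheta :: "complex \<Rightarrow> complex \<Rightarrow> complex" where
  "jtheta z \<tau> =
     (\<Sum>\<^sub>\<infinity>n::int. exp (2 * of_real pi * \<i> * of_int n * z + \<i> * of_real pi * (of_int n)\<^sup>2 * \<tau>))"

definition jtheta11 :: "complex \<Rightarrow> complex \<Rightarrow> complex" where
  "jtheta11 z \<tau> = \<i> * exp (\<i> * of_real pi * (z + \<tau> / 4)) * jtheta (z + (1 + \<tau>) / 2) \<tau>"

definition x_star :: "real \<Rightarrow> real" where
  "x_star \<eta> = - 2 * (1 - exp (- \<eta>)) / \<eta>"

(* For real z and purely imaginary \<tau>, both jtheta11 z \<tau> and its z-derivative are real
   (pair the summands n and -n-1), so Re discards nothing; it only makes calU a real function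
   of the real variable K, which is then differentiated and inverted. *)
definition calU :: "real \<Rightarrow> real \<Rightarrow> real" where
  "calU \<eta> K =
     (let \<tau> = \<i> * of_real pi / of_real K in
      2 * K * exp (\<eta> / 2 * (\<eta> / (2 * K) - 1)) *
      Re (jtheta11 (of_real (\<eta> / (2 * K))) \<tau> / deriv (\<lambda>z. jtheta11 z \<tau>) 0))"

definition calK :: "real \<Rightarrow> real \<Rightarrow> real" where
  "calK \<eta> x = (THE K. K > \<eta> / 2 \<and> calU \<eta> K - K * deriv (calU \<eta>) K = - \<eta> * x / 2)"

definition calL :: "real \<Rightarrow> real \<Rightarrow> real" where
  "calL \<eta> x = - deriv (calU \<eta>) (calK \<eta> x)"

(* calL is unspecified at the endpoint x_star; this does not affect the integral. *)
definition calF :: "real \<Rightarrow> real \<Rightarrow> real" where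
  "calF \<eta> x =
     (if x \<le> x_star \<eta> then \<eta> * x\<^sup>2 / 2 + 1 - exp (- \<eta>)
      else if x < 2 then
        \<eta> * x\<^sup>2 / 2 + 1 - exp (- \<eta>) + \<eta> * integral {x_star \<eta>..x} (calL \<eta>)
      else 0)"

definition C_k :: "nat \<Rightarrow> (real \<Rightarrow> real) \<Rightarrow> bool" where
  "C_k k f \<longleftrightarrow>
     (\<forall>j<k. \<forall>x. (deriv ^^ j) f differentiable (at x)) \<and> continuous_on UNIV ((deriv ^^ k) f)"

definition holder_continuous_at :: "real \<Rightarrow> (real \<Rightarrow> real) \<Rightarrow> real \<Rightarrow> bool" where
  "holder_continuous_at \<alpha> f a \<longleftrightarrow>
     (\<exists>C. \<exists>\<delta>>0. \<forall>x. \<bar>x - a\<bar> < \<delta> \<longrightarrow> \<bar>f x - f a\<bar> \<le> C * \<bar>x - a\<bar> powr \<alpha>)"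

end

(*
  Put w = eta/2 and p = exp(-2K). An entire function f with f(0) = 0, f(u + i pi) = - f(u) and
  f(u + K) = - exp(2u + K) f(u) is determined up to a constant: its quotient by sinh u times the
  exponential of minus a Lambert series is periodic on the strip |Re u| < K, so the maximum principle
  makes it constant. Applied to theta_11 with tau = i pi/K and with tau = iK/pi, this gives at once the
  modular transformation and the triple product; in particular
    U(K) = exp(-w) T_0 / t_1 = (1 - exp(-eta)) exp(-Lambert series),
  where T_j = sum_n (-1)^n m^j exp(2mw - Km^2) with m = n + 1/2, and t_j = T_j at w = 0.

  Concavity of U. U' = 2EU and U'' = 4(E^2 - H)U with E = sum_k a_k and H >= sum_k k a_k, where
  a_k = v^k ((1 - Y^k)/(1 - p^k))^2, Y = exp(-eta), v = p/Y. The a_k satisfy a_j a_k <= a_(j+k), and the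
  Cauchy product gives E^2 < H. Hence K is a smooth decreasing function of x.

  Continuity of F at 2 amounts to the integral of U'^2 over (eta/2, oo) being 1 - exp(-eta). This follows
  from an explicit primitive of U'^2, a quadratic expression in T_0, T_1, T_2. That it is a primitive is a
  quartic identity in the T_j and t_j; splitting the double sums T_i T_j along m + m' and m - m', it
  becomes the Pluecker relation for three vectors in the plane of even and odd Gauss sums.

  On (x_star, 2) then F' = eta x - eta U'(K(x)) and F'' = eta - eta^2 / (2K(x)). As x tends to 2, K tends
  to eta/2, where U = 0, U' = 2, U'' = -4. As x tends to x_star, K tends to infinity while x - x_star is
  O(exp(-K)), so that F'' is only logarithmically continuous there.
*)
theory Submission
  imports Defs "HOL-Complex_Analysis.Complex_Analysis"
begin

section \<open>Theta moments\<close>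

text \<open>Two expressions for U are kept because each shows what the other hides. The Lambert form
  has positive terms, so signs, concavity and decay can be read off, but its series diverges at K =
  w. The moment form is smooth for all K > 0, which makes K = w an interior point: endpoint values
  are exact and only two-sided derivatives occur there, yet its alternating signs conceal
  monotonicity. Dividing by the derivative at 0 removes the prefactor of the modular transformation.
  F is not estimated as an integral of the implicitly defined \<open>calL\<close>. A closed form
  \<open>calF0\<close> in K(x), U' and \<open>calJ\<close> is differentiated and then identified
  with \<open>calF\<close>. The formulas for F, F' and F'' are glued from three pieces, and
  continuity of the glued functions yields differentiability at the two joints. No third derivative
  of F is computed: near 2 a bound on F'' in terms of K takes its place, and at x_star the failure
  of Hoelder continuity excludes it.\<close>

lemma summable_on_exp_minus_abs_int:
  "(\<lambda>n::int. exp (- \<bar>real_of_int n\<bar>)) summable_on UNIV"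
proof -
  have s: "summable (\<lambda>n::nat. exp (- real n))"
    using summable_geometric[of "exp (-1::real)"]
    by (simp flip: exp_of_nat_mult add: mult.commute)
  have s1: "(\<lambda>n::nat. exp (- real n)) summable_on UNIV"
    using s by (intro norm_summable_imp_summable_on) simp
  have b1: "bij_betw int UNIV {0..}"
    by (rule bij_betwI[where g = nat]) auto
  have b2: "bij_betw (\<lambda>n. - int n - 1) UNIV {..<0}"
    by (rule bij_betwI[where g = "\<lambda>n. nat (- n - 1)"]) auto
  have 1: "(\<lambda>n::int. exp (- \<bar>real_of_int n\<bar>)) summable_on {0..}"
    unfolding summable_on_reindex_bij_betw[OF b1, symmetric] using s1 by simp
  have "(\<lambda>n::nat. exp (- real n) * exp (-1)) summable_on UNIV"
    by (intro summable_on_cmult_left s1)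
  moreover have "(\<lambda>n::nat. exp (- \<bar>real_of_int (- int n - 1)\<bar>)) = (\<lambda>n::nat. exp (- real n) * exp (-1))"
    by (auto simp: fun_eq_iff simp flip: exp_add)
  ultimately have 2: "(\<lambda>n::int. exp (- \<bar>real_of_int n\<bar>)) summable_on {..<0}"
    unfolding summable_on_reindex_bij_betw[OF b2, symmetric] by simp
  have "(\<lambda>n::int. exp (- \<bar>real_of_int n\<bar>)) summable_on ({0..} \<union> {..<0})"
    by (intro summable_on_Un_disjoint 1 2) auto
  moreover have "{0..} \<union> {..<0::int} = UNIV" by auto
  ultimately show ?thesis by simp
qed

lemma power_le_fact_exp: "0 \<le> x \<Longrightarrow> x ^ j \<le> fact j * exp (x::real)"
proof -
  assume x: "0 \<le> x"
  have "(\<Sum>n\<in>{j}. x ^ n /\<^sub>R fact n) \<le> (\<Sum>n. x ^ n /\<^sub>R fact n)"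
    using x by (intro sum_le_suminf summable_exp_generic) auto
  then show ?thesis by (simp add: exp_def divide_simps mult.commute)
qed

text \<open>Completing the square with R + 2 in place of R frees two factors exp x: one absorbs the
  power x ^ j, the other is left over as decay in x.\<close>

lemma gauss_moment_le:
  fixes x R K :: real
  assumes "K > 0" "0 \<le> x"
  shows "x ^ j * exp (R * x - K * x\<^sup>2) \<le> fact j * exp ((R + 2)\<^sup>2 / (4 * K)) * exp (- x)"
proof -
  have "R * x - K * x\<^sup>2 + x + x = (R + 2)\<^sup>2 / (4 * K) - K * (x - (R + 2) / (2 * K))\<^sup>2"
    using assms by (simp add: field_simps power2_eq_square)
  also have "\<dots> \<le> (R + 2)\<^sup>2 / (4 * K)" using assms by simp
  finally have *: "x + (R * x - K * x\<^sup>2) \<le> (R + 2)\<^sup>2 / (4 * K) - x" by simp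
  have "x ^ j * exp (R * x - K * x\<^sup>2) \<le> (fact j * exp x) * exp (R * x - K * x\<^sup>2)"
    by (intro mult_right_mono power_le_fact_exp assms) auto
  also have "\<dots> = fact j * exp (x + (R * x - K * x\<^sup>2))" by (simp add: exp_add exp_diff)
  also have "\<dots> \<le> fact j * exp ((R + 2)\<^sup>2 / (4 * K) - x)" using * by simp
  finally show ?thesis by (simp add: exp_diff exp_minus field_simps)
qed

text \<open>One majorant serves all Gaussian series over the integers: s = 1/2 for theta moments, s
  = 0 for the even and odd Gauss sums and for Jacobi's series. The parameter R bounds the linear
  part of the exponent.\<close>

lemma gauss_moment_summable:
  fixes s R K :: real
  assumes "K > 0"
  shows "(\<lambda>n::int. \<bar>of_int n + s\<bar> ^ j * exp (R * \<bar>of_int n + s\<bar> - K * (of_int n + s)\<^sup>2)) summable_on UNIV"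
proof (rule summable_on_comparison_test)
  let ?C = "fact j * exp ((R + 2)\<^sup>2 / (4 * K)) * exp \<bar>s\<bar>"
  show "(\<lambda>n::int. ?C * exp (- \<bar>real_of_int n\<bar>)) summable_on UNIV"
    by (intro summable_on_cmult_right summable_on_exp_minus_abs_int)
  fix n :: int
  have "\<bar>of_int n + s\<bar> ^ j * exp (R * \<bar>of_int n + s\<bar> - K * (of_int n + s)\<^sup>2)
     \<le> fact j * exp ((R + 2)\<^sup>2 / (4 * K)) * exp (- \<bar>of_int n + s\<bar>)"
    using gauss_moment_le[OF assms, of "\<bar>of_int n + s\<bar>" j R] by simp
  also have "exp (- \<bar>of_int n + s\<bar>) \<le> exp \<bar>s\<bar> * exp (- \<bar>real_of_int n\<bar>)"
    by (simp flip: exp_add)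
  finally show "\<bar>of_int n + s\<bar> ^ j * exp (R * \<bar>of_int n + s\<bar> - K * (of_int n + s)\<^sup>2) \<le> ?C * exp (- \<bar>real_of_int n\<bar>)"
    by (simp add: mult.assoc)
qed auto

definition alt_sign :: "int \<Rightarrow> real" where "alt_sign n = (if even n then 1 else -1)"

text \<open>Up to the factor \<i>, the sum for j = 0 is theta_11 at z = w / (i pi) and tau = i K /
  pi. All j are included because derivatives in w and in K raise j by 1 and by 2, so the family is
  closed under differentiation.\<close>

definition theta_term :: "nat \<Rightarrow> real \<Rightarrow> real \<Rightarrow> int \<Rightarrow> real" where
  "theta_term j w K n = alt_sign n * (of_int n + 1/2) ^ j * exp (2 * (of_int n + 1/2) * w - K * (of_int n + 1/2)\<^sup>2)"

definition theta_moment :: "nat \<Rightarrow> real \<Rightarrow> real \<Rightarrow> real" where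
  "theta_moment j w K = (\<Sum>\<^sub>\<infinity>n. theta_term j w K n)"

lemma abs_theta_term_le:
  assumes "\<bar>w\<bar> \<le> R" "K0 \<le> K"
  shows "\<bar>theta_term j w K n\<bar> \<le> \<bar>of_int n + 1/2\<bar> ^ j * exp (2 * R * \<bar>of_int n + 1/2\<bar> - K0 * (of_int n + 1/2)\<^sup>2)"
proof -
  have "2 * (of_int n + 1/2) * w \<le> \<bar>2 * (of_int n + 1/2) * w\<bar>" by simp
  also have "\<dots> = 2 * \<bar>w\<bar> * \<bar>of_int n + 1/2\<bar>" unfolding abs_mult by simp
  also have "\<dots> \<le> 2 * R * \<bar>of_int n + 1/2\<bar>" using assms by (intro mult_right_mono) auto
  finally have 1: "2 * (of_int n + 1/2) * w \<le> 2 * R * \<bar>of_int n + 1/2\<bar>" .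
  have 2: "K0 * (of_int n + 1/2)\<^sup>2 \<le> K * (of_int n + 1/2)\<^sup>2" using assms by (intro mult_right_mono) auto
  have "\<bar>theta_term j w K n\<bar> = \<bar>of_int n + 1/2\<bar> ^ j * exp (2 * (of_int n + 1/2) * w - K * (of_int n + 1/2)\<^sup>2)"
    by (simp add: theta_term_def alt_sign_def abs_mult power_abs)
  also have "\<dots> \<le> \<bar>of_int n + 1/2\<bar> ^ j * exp (2 * R * \<bar>of_int n + 1/2\<bar> - K0 * (of_int n + 1/2)\<^sup>2)"
    using 1 2 by (intro mult_left_mono) auto
  finally show ?thesis .
qed

lemma theta_term_abs_summable: "K > 0 \<Longrightarrow> (\<lambda>n. norm (theta_term j w K n)) summable_on UNIV"
  using abs_theta_term_le[of w "\<bar>w\<bar>" K K j]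
  by (intro summable_on_comparison_test[OF gauss_moment_summable[of K "1/2" j "2 * \<bar>w\<bar>"]]) auto

lemma theta_term_has_sum: "K > 0 \<Longrightarrow> (theta_term j w K has_sum theta_moment j w K) UNIV"
  unfolding theta_moment_def by (rule has_sum_infsum[OF abs_summable_summable[OF theta_term_abs_summable]])

text \<open>An unordered sum does not depend on the enumeration, so along \<open>int_decode\<close>
  it becomes an ordinary series, to which termwise differentiation under a Weierstrass majorant
  applies.\<close>

lemma has_real_derivative_infsum_int:
  fixes f f' :: "real \<Rightarrow> int \<Rightarrow> real"
  assumes S: "open S" "convex S" "x \<in> S"
    and der: "\<And>n x. x \<in> S \<Longrightarrow> ((\<lambda>x. f x n) has_real_derivative f' x n) (at x)"
    and sm: "\<And>x. x \<in> S \<Longrightarrow> f x summable_on UNIV"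
    and bd: "\<And>n x. x \<in> S \<Longrightarrow> \<bar>f' x n\<bar> \<le> M n" and M: "M summable_on UNIV"
  shows "((\<lambda>x. \<Sum>\<^sub>\<infinity>n. f x n) has_real_derivative (\<Sum>\<^sub>\<infinity>n. f' x n)) (at x)"
proof -
  have bij: "bij_betw int_decode UNIV UNIV" by (rule bij_int_decode)
  have sM: "summable (\<lambda>k. M (int_decode k))"
    using M unfolding summable_on_reindex_bij_betw[OF bij, symmetric] by (rule summable_on_imp_summable)
  have sf': "f' x summable_on UNIV" if "x \<in> S" for x
    by (rule abs_summable_summable, rule summable_on_comparison_test[OF M]) (use bd that in auto)
  have eq: "(\<Sum>\<^sub>\<infinity>n. g n) = (\<Sum>k. g (int_decode k))" if "g summable_on UNIV" for g :: "int \<Rightarrow> real"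
  proof -
    have "(g has_sum (\<Sum>\<^sub>\<infinity>n. g n)) UNIV" using that by simp
    then have "((\<lambda>k. g (int_decode k)) has_sum (\<Sum>\<^sub>\<infinity>n. g n)) UNIV"
      by (subst has_sum_reindex_bij_betw[OF bij])
    then show ?thesis using has_sum_imp_sums sums_unique by blast
  qed
  have "((\<lambda>x. \<Sum>k. f x (int_decode k)) has_real_derivative (\<Sum>k. f' x (int_decode k))) (at x)"
  proof (rule has_field_derivative_series'(2)[where S = S and x0 = x])
    show "\<And>n x. x \<in> S \<Longrightarrow> ((\<lambda>x. f x (int_decode n)) has_real_derivative f' x (int_decode n)) (at x within S)"
      using der has_field_derivative_at_within by blast
    show "uniformly_convergent_on S (\<lambda>n x. \<Sum>i<n. f' x (int_decode i))"
      by (rule Weierstrass_m_test'[OF _ sM]) (use bd in auto)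
    show "summable (\<lambda>n. f x (int_decode n))"
      using sm[OF \<open>x \<in> S\<close>] unfolding summable_on_reindex_bij_betw[OF bij, symmetric] by (rule summable_on_imp_summable)
  qed (use S in \<open>auto simp: interior_open\<close>)
  moreover have "eventually (\<lambda>y. (\<Sum>\<^sub>\<infinity>n. f y n) = (\<Sum>k. f y (int_decode k))) (nhds x)"
    using S eq sm by (auto simp: eventually_nhds intro!: exI[of _ S])
  ultimately show ?thesis
    by (subst DERIV_cong_ev[OF refl _ eq[OF sf'[OF \<open>x \<in> S\<close>]]])
qed

lemma theta_term_deriv_K: "((\<lambda>K. theta_term j w K n) has_real_derivative - theta_term (j + 2) w K n) (at K)"
proof -
  let ?m = "real_of_int n + 1/2"
  have "((\<lambda>K. alt_sign n * ?m ^ j * exp (2 * ?m * w - K * ?m\<^sup>2)) has_real_derivative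
     alt_sign n * ?m ^ j * (exp (2 * ?m * w - K * ?m\<^sup>2) * (- ?m\<^sup>2))) (at K)"
    by (rule derivative_eq_intros refl | simp)+
  then show ?thesis by (simp add: theta_term_def power_add power2_eq_square mult_ac)
qed

lemma theta_term_deriv_w: "((\<lambda>w. theta_term j w K n) has_real_derivative 2 * theta_term (Suc j) w K n) (at w)"
proof -
  let ?m = "real_of_int n + 1/2"
  have "((\<lambda>w. alt_sign n * ?m ^ j * exp (2 * ?m * w - K * ?m\<^sup>2)) has_real_derivative
     alt_sign n * ?m ^ j * (exp (2 * ?m * w - K * ?m\<^sup>2) * (2 * ?m))) (at w)"
    by (rule derivative_eq_intros refl | simp)+
  then show ?thesis by (simp add: theta_term_def algebra_simps)
qed

lemma theta_moment_deriv_K: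
  assumes "K > 0"
  shows "((\<lambda>K. theta_moment j w K) has_real_derivative - theta_moment (j + 2) w K) (at K)"
proof -
  have "((\<lambda>K. \<Sum>\<^sub>\<infinity>n. theta_term j w K n) has_real_derivative (\<Sum>\<^sub>\<infinity>n. - theta_term (j + 2) w K n)) (at K)"
  \<comment> \<open>On x > K / 2 the Gaussian weight with parameter K / 2 majorises all
    differentiated terms at once.\<close>
  proof (rule has_real_derivative_infsum_int[where S = "{K/2<..}"])
    fix n :: int and x assume x: "x \<in> {K/2<..}"
    then have "x > 0" using assms by simp
    then show "theta_term j w x summable_on UNIV"
      by (rule abs_summable_summable[OF theta_term_abs_summable])
    show "((\<lambda>x. theta_term j w x n) has_real_derivative - theta_term (j + 2) w x n) (at x)"
      by (rule theta_term_deriv_K)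
    show "\<bar>- theta_term (j + 2) w x n\<bar> \<le> \<bar>of_int n + 1/2\<bar> ^ (j + 2) * exp (2 * \<bar>w\<bar> * \<bar>of_int n + 1/2\<bar> - (K/2) * (of_int n + 1/2)\<^sup>2)"
      unfolding abs_minus_cancel by (rule abs_theta_term_le) (use x in auto)
  next
    show "(\<lambda>n. \<bar>real_of_int n + 1/2\<bar> ^ (j + 2) * exp (2 * \<bar>w\<bar> * \<bar>of_int n + 1/2\<bar> - (K/2) * (of_int n + 1/2)\<^sup>2)) summable_on UNIV"
      by (rule gauss_moment_summable) (use assms in simp)
    show "open {K/2<..}" "convex {K/2<..}" "K \<in> {K/2<..}" using assms by auto
  qed
  then show ?thesis by (simp add: infsum_uminus theta_moment_def)
qed

lemma theta_moment_deriv_w: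
  assumes "K > 0"
  shows "((\<lambda>w. theta_moment j w K) has_real_derivative 2 * theta_moment (Suc j) w K) (at w)"
proof -
  have "((\<lambda>w. \<Sum>\<^sub>\<infinity>n. theta_term j w K n) has_real_derivative (\<Sum>\<^sub>\<infinity>n. 2 * theta_term (Suc j) w K n)) (at w)"
  proof (rule has_real_derivative_infsum_int[where S = "ball w 1"])
    fix n :: int and x assume x: "x \<in> ball w 1"
    show "theta_term j x K summable_on UNIV"
      using assms by (rule abs_summable_summable[OF theta_term_abs_summable])
    show "((\<lambda>x. theta_term j x K n) has_real_derivative 2 * theta_term (Suc j) x K n) (at x)"
      by (rule theta_term_deriv_w)
    have "\<bar>x\<bar> \<le> \<bar>w\<bar> + 1" using x by (auto simp: dist_real_def)
    then have "\<bar>theta_term (Suc j) x K n\<bar> \<le> \<bar>of_int n + 1/2\<bar> ^ (Suc j) * exp (2 * (\<bar>w\<bar> + 1) * \<bar>of_int n + 1/2\<bar> - K * (of_int n + 1/2)\<^sup>2)"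
      by (rule abs_theta_term_le) simp
    then show "\<bar>2 * theta_term (Suc j) x K n\<bar> \<le> 2 * (\<bar>of_int n + 1/2\<bar> ^ (Suc j) * exp (2 * (\<bar>w\<bar> + 1) * \<bar>of_int n + 1/2\<bar> - K * (of_int n + 1/2)\<^sup>2))"
      unfolding abs_mult by simp
  next
    show "(\<lambda>n. 2 * (\<bar>real_of_int n + 1/2\<bar> ^ (Suc j) * exp (2 * (\<bar>w\<bar> + 1) * \<bar>of_int n + 1/2\<bar> - K * (of_int n + 1/2)\<^sup>2))) summable_on UNIV"
      by (intro summable_on_cmult_right gauss_moment_summable assms)
  qed auto
  then show ?thesis by (simp add: infsum_cmult_right' theta_moment_def)
qed

section \<open>A differential identity for theta moments\<close>

lemma has_sum_product:
  fixes f :: "'a \<Rightarrow> real" and g :: "'b \<Rightarrow> real"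
  assumes f: "(\<lambda>x. norm (f x)) summable_on A" "(f has_sum a) A"
    and g: "(\<lambda>x. norm (g x)) summable_on B" "(g has_sum b) B"
  shows "((\<lambda>x. f (fst x) * g (snd x)) has_sum (a * b)) (A \<times> B)"
proof (rule has_sum_SigmaI)
  show "((\<lambda>y. f (fst (x, y)) * g (snd (x, y))) has_sum f x * b) B" for x
    using has_sum_cmult_right[OF g(2)] by simp
  show "((\<lambda>x. f x * b) has_sum a * b) A"
    using has_sum_cmult_left[OF f(2)] by simp
  have "(\<lambda>x. norm (f (fst x) * g (snd x))) summable_on A \<times> B"
  proof (rule summable_on_SigmaI)
    show "((\<lambda>y. norm (f (fst (x, y)) * g (snd (x, y)))) has_sum norm (f x) * (\<Sum>\<^sub>\<infinity>y\<in>B. norm (g y))) B" for x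
      using has_sum_cmult_right[OF has_sum_infsum[OF g(1)], of "norm (f x)"] by (simp add: abs_mult)
    show "(\<lambda>x. norm (f x) * (\<Sum>\<^sub>\<infinity>y\<in>B. norm (g y))) summable_on A"
      by (intro summable_on_cmult_left f(1))
  qed auto
  then show "(\<lambda>x. f (fst x) * g (snd x)) summable_on A \<times> B"
    by (rule abs_summable_summable)
qed

text \<open>The weight K / 2 comes from the parallelogram law x^2 + y^2 = ((x + y)^2 + (x - y)^2) /
  2 for half-integers x and y: the integer a stands for x + y, or for x - y with w = 0.\<close>

definition gauss_term :: "nat \<Rightarrow> real \<Rightarrow> real \<Rightarrow> int \<Rightarrow> real" where
  "gauss_term j w K a = of_int a ^ j * exp (2 * of_int a * w - K * (of_int a)\<^sup>2 / 2)"

lemma gauss_term_abs_summable: "K > 0 \<Longrightarrow> (\<lambda>a. norm (gauss_term j w K a)) summable_on A"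
proof -
  assume K: "K > 0"
  have "2 * real_of_int a * w \<le> 2 * \<bar>w\<bar> * \<bar>real_of_int a\<bar>" for a
    using abs_ge_self[of "2 * real_of_int a * w"] unfolding abs_mult by (simp add: mult_ac)
  then have "(\<lambda>a. norm (gauss_term j w K a)) summable_on UNIV"
    using K by (intro summable_on_comparison_test[OF gauss_moment_summable[of "K / 2" 0 j "2 * \<bar>w\<bar>"]])
      (auto simp: gauss_term_def abs_mult power_abs intro!: mult_left_mono)
  then show ?thesis by (rule summable_on_subset_banach) auto
qed

definition even_ints :: "int set" where "even_ints = {a. even a}"
definition odd_ints :: "int set" where "odd_ints = {a. odd a}"

definition gauss_moment :: "int set \<Rightarrow> nat \<Rightarrow> real \<Rightarrow> real \<Rightarrow> real" where
  "gauss_moment A j w K = (\<Sum>\<^sub>\<infinity>a\<in>A. gauss_term j w K a)"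

lemma gauss_term_has_sum: "K > 0 \<Longrightarrow> (gauss_term j w K has_sum gauss_moment A j w K) A"
  unfolding gauss_moment_def by (rule has_sum_infsum[OF abs_summable_summable[OF gauss_term_abs_summable]])

definition bilinear_term :: "nat \<Rightarrow> nat \<Rightarrow> real \<Rightarrow> real \<Rightarrow> int \<times> int \<Rightarrow> real" where
  "bilinear_term j k w K x = alt_sign (fst x) * alt_sign (snd x) * (of_int (fst x) - of_int (snd x)) ^ k *
     (of_int (fst x) + of_int (snd x) + 1) ^ j *
     exp (2 * (of_int (fst x) + of_int (snd x) + 1) * w - K * ((of_int (fst x) + 1/2)\<^sup>2 + (of_int (snd x) + 1/2)\<^sup>2))"

text \<open>For half-integers x = m + 1/2 and y = n + 1/2 the integers a = x + y and b = x - y have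
  opposite parity, and every such pair occurs once. The sign (-1)^(m + n) equals -(-1)^a, so the
  double sum splits into odd-even minus even-odd products, a 2 by 2 determinant.\<close>

lemma bilinear_term_has_sum:
  assumes K: "K > 0"
  shows "(bilinear_term j k w K has_sum (gauss_moment odd_ints j w K * gauss_moment even_ints k 0 K - gauss_moment even_ints j w K * gauss_moment odd_ints k 0 K)) UNIV"
proof -
  let ?h = "\<lambda>x. - alt_sign (fst x) * (gauss_term j w K (fst x) * gauss_term k 0 K (snd x))"
  let ?g = "\<lambda>x::int \<times> int. (fst x + snd x + 1, fst x - snd x)"
  have p: "((\<lambda>x. gauss_term j w K (fst x) * gauss_term k 0 K (snd x)) has_sum (gauss_moment A j w K * gauss_moment B k 0 K)) (A \<times> B)" for A B
    using K by (intro has_sum_product gauss_term_abs_summable gauss_term_has_sum)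
  have 1: "(?h has_sum (gauss_moment odd_ints j w K * gauss_moment even_ints k 0 K)) (odd_ints \<times> even_ints)"
    using p[of odd_ints even_ints] by (subst has_sum_cong[where g = "\<lambda>x. gauss_term j w K (fst x) * gauss_term k 0 K (snd x)"]) (auto simp: odd_ints_def alt_sign_def)
  have 2: "(?h has_sum (- (gauss_moment even_ints j w K * gauss_moment odd_ints k 0 K))) (even_ints \<times> odd_ints)"
    using p[of even_ints odd_ints] by (subst has_sum_cong[where g = "\<lambda>x. - (gauss_term j w K (fst x) * gauss_term k 0 K (snd x))"])
      (auto simp: even_ints_def alt_sign_def has_sum_uminus)
  have "(?h has_sum (gauss_moment odd_ints j w K * gauss_moment even_ints k 0 K + - (gauss_moment even_ints j w K * gauss_moment odd_ints k 0 K))) (odd_ints \<times> even_ints \<union> even_ints \<times> odd_ints)"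
    by (intro has_sum_Un_disjoint 1 2) (auto simp: even_ints_def odd_ints_def)
  \<comment> \<open>The inverse is m = (a - 1 + b) / 2, n = (a - 1 - b) / 2; the divisions are exact
    because a and b have opposite parity.\<close>
  moreover have bij: "bij_betw ?g UNIV (odd_ints \<times> even_ints \<union> even_ints \<times> odd_ints)"
    by (rule bij_betwI[where g = "\<lambda>x. ((fst x - 1 + snd x) div 2, (fst x - 1 - snd x) div 2)"])
      (auto simp: even_ints_def odd_ints_def elim!: evenE oddE, presburger+)
  ultimately have "((\<lambda>x. ?h (?g x)) has_sum (gauss_moment odd_ints j w K * gauss_moment even_ints k 0 K + - (gauss_moment even_ints j w K * gauss_moment odd_ints k 0 K))) UNIV"
    using has_sum_reindex_bij_betw[OF bij, of ?h] by blast
  moreover have "?h (?g x) = bilinear_term j k w K x" for x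
  proof -
    obtain m n where x: "x = (m, n)" by force
    have s: "- alt_sign (m + n + 1) = alt_sign m * alt_sign n" by (auto simp: alt_sign_def)
    have e: "2 * (of_int m + of_int n + 1) * w - K * (of_int m + of_int n + 1)\<^sup>2 / 2 - K * (of_int m - of_int n)\<^sup>2 / 2
       = 2 * (of_int m + of_int n + 1) * w - K * ((of_int m + 1/2)\<^sup>2 + (of_int n + 1/2)\<^sup>2 :: real)"
      by (simp add: power2_eq_square field_simps)
    have f: "gauss_term j w K (m + n + 1) * gauss_term k 0 K (m - n) = of_int (m - n) ^ k * of_int (m + n + 1) ^ j *
        exp (2 * (of_int m + of_int n + 1) * w - K * (of_int m + of_int n + 1)\<^sup>2 / 2 - K * (of_int m - of_int n)\<^sup>2 / 2)"
      by (simp add: gauss_term_def mult_ac flip: exp_add)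
    show ?thesis
      unfolding x bilinear_term_def fst_conv snd_conv s e[symmetric] f by simp
  qed
  ultimately show ?thesis by simp
qed

lemma theta_term_product_has_sum:
  "K > 0 \<Longrightarrow> ((\<lambda>x. theta_term i w K (fst x) * theta_term l w K (snd x)) has_sum (theta_moment i w K * theta_moment l w K)) UNIV"
  using has_sum_product[OF theta_term_abs_summable theta_term_has_sum theta_term_abs_summable theta_term_has_sum, of K K] by simp

lemma theta_term_product:
  "theta_term i w K m * theta_term l w K n = (of_int m + 1/2) ^ i * (of_int n + 1/2) ^ l * (alt_sign m * alt_sign n *
     exp (2 * (of_int m + of_int n + 1) * w - K * ((of_int m + 1/2)\<^sup>2 + (of_int n + 1/2)\<^sup>2)))"
proof -
  have e: "2 * (of_int m + of_int n + 1) * w - K * ((of_int m + 1/2)\<^sup>2 + (of_int n + 1/2)\<^sup>2) =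
     (2 * (of_int m + 1/2) * w - K * (of_int m + 1/2)\<^sup>2) + (2 * (of_int n + 1/2) * w - K * (of_int n + 1/2)\<^sup>2)"
    by (simp add: algebra_simps)
  show ?thesis unfolding e exp_add theta_term_def by (simp only: mult_ac)
qed

text \<open>Sign and exponential are split off as a common factor c, so that comparison with
  products of theta terms becomes a polynomial identity in x and y.\<close>

lemma bilinear_term_factor:
  fixes m n :: int and K w :: real
  defines "c \<equiv> alt_sign m * alt_sign n * exp (2 * (of_int m + of_int n + 1) * w - K * ((of_int m + 1/2)\<^sup>2 + (of_int n + 1/2)\<^sup>2))"
    and "x \<equiv> of_int m + 1/2 :: real" and "y \<equiv> of_int n + 1/2 :: real"
  shows "bilinear_term j k w K (m, n) = (x - y) ^ k * (x + y) ^ j * c"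
proof -
  have "x + y = of_int m + of_int n + 1" "x - y = of_int m - of_int n" by (auto simp: x_def y_def)
  note xy = this
  show ?thesis unfolding xy bilinear_term_def c_def fst_conv snd_conv by (simp only: mult_ac)
qed

text \<open>The reflection n -> -n - 1 negates n + 1/2 and flips the alternating sign, so for even j
  the summands cancel in pairs.\<close>

lemma theta_moment_even_zero:
  assumes "K > 0" "even j"
  shows "theta_moment j 0 K = 0"
proof -
  have bij: "bij_betw (\<lambda>n::int. - n - 1) UNIV UNIV"
    by (rule bij_betwI[where g = "\<lambda>n. - n - 1"]) auto
  have "((\<lambda>n. theta_term j 0 K (- n - 1)) has_sum theta_moment j 0 K) UNIV"
    using theta_term_has_sum[OF assms(1)] by (subst has_sum_reindex_bij_betw[OF bij])
  moreover have "theta_term j 0 K (- n - 1) = - theta_term j 0 K n" for n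
  proof -
    have e: "of_int (- n - 1) + 1/2 = - (of_int n + 1/2 :: real)" by simp
    define x where "x = real_of_int n + 1/2"
    show ?thesis unfolding theta_term_def e unfolding x_def[symmetric] using assms(2) by (auto simp: alt_sign_def)
  qed
  ultimately have "((\<lambda>n. - theta_term j 0 K n) has_sum theta_moment j 0 K) UNIV" by simp
  moreover have "((\<lambda>n. - theta_term j 0 K n) has_sum - theta_moment j 0 K) UNIV"
    using theta_term_has_sum[OF assms(1)] by (simp add: has_sum_uminus)
  ultimately have "theta_moment j 0 K = - theta_moment j 0 K" by (rule has_sum_unique)
  then show ?thesis by simp
qed

text \<open>Expanding (x - y)^k (x + y)^j, each monomial x^i y^l sums to T i T l. The cases with j =
  0 will be taken at a general w; the last three will be taken at w = 0, where they are the minors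
  of three plane vectors.\<close>

lemma bilinear_term_moments:
  assumes K: "K > 0"
  defines "M \<equiv> \<lambda>j k w. gauss_moment odd_ints j w K * gauss_moment even_ints k 0 K - gauss_moment even_ints j w K * gauss_moment odd_ints k 0 K"
    and "T \<equiv> \<lambda>j w. theta_moment j w K"
  shows "M 0 0 w = (T 0 w)\<^sup>2"
    and "M 0 2 w = 2 * (T 0 w * T 2 w) - 2 * (T 1 w)\<^sup>2"
    and "M 0 4 w = 2 * (T 0 w * T 4 w) - 8 * (T 1 w * T 3 w) + 6 * (T 2 w)\<^sup>2"
    and "M 2 0 w = 2 * (T 0 w * T 2 w) + 2 * (T 1 w)\<^sup>2"
    and "M 4 0 w = 2 * (T 0 w * T 4 w) + 8 * (T 1 w * T 3 w) + 6 * (T 2 w)\<^sup>2"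
    and "M 4 2 w = 2 * (T 0 w * T 6 w) + 4 * (T 1 w * T 5 w) - 2 * (T 2 w * T 4 w) - 4 * (T 3 w)\<^sup>2"
proof -
  note [intro] = has_sum_add has_sum_cmult_right theta_term_product_has_sum[OF K]
  have key: "M j k w = S" if "((\<lambda>x. f (fst x) (snd x)) has_sum S) UNIV" "\<And>m n. f m n = bilinear_term j k w K (m, n)" for j k S f
  proof -
    have "(\<lambda>x. f (fst x) (snd x)) = bilinear_term j k w K" using that(2) by auto
    then show ?thesis
      using that(1) bilinear_term_has_sum[OF K, of j k w] unfolding M_def by (metis has_sum_unique)
  qed
  let ?P = "\<lambda>i l m n. theta_term i w K m * theta_term l w K n"
  have "M 0 0 w = T 0 w * T 0 w"
    unfolding T_def by (rule key[where f = "\<lambda>m n. ?P 0 0 m n"], rule theta_term_product_has_sum[OF K])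
      (simp add: theta_term_product bilinear_term_factor)
  then show "M 0 0 w = (T 0 w)\<^sup>2" by (simp add: power2_eq_square)
  have "M 0 2 w = T 2 w * T 0 w + ((-2) * (T 1 w * T 1 w) + T 0 w * T 2 w)"
    unfolding T_def by (rule key[where f = "\<lambda>m n. ?P 2 0 m n + ((-2) * ?P 1 1 m n + ?P 0 2 m n)"],
      intro has_sum_add has_sum_cmult_right theta_term_product_has_sum[OF K])
      (unfold theta_term_product bilinear_term_factor, algebra)
  then show "M 0 2 w = 2 * (T 0 w * T 2 w) - 2 * (T 1 w)\<^sup>2" by (simp add: power2_eq_square)
  have "M 0 4 w = T 4 w * T 0 w + ((-4) * (T 3 w * T 1 w) + (6 * (T 2 w * T 2 w) + ((-4) * (T 1 w * T 3 w) + T 0 w * T 4 w)))"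
    unfolding T_def by (rule key[where f = "\<lambda>m n. ?P 4 0 m n + ((-4) * ?P 3 1 m n + (6 * ?P 2 2 m n + ((-4) * ?P 1 3 m n + ?P 0 4 m n)))"],
      intro has_sum_add has_sum_cmult_right theta_term_product_has_sum[OF K])
      (unfold theta_term_product bilinear_term_factor, algebra)
  then show "M 0 4 w = 2 * (T 0 w * T 4 w) - 8 * (T 1 w * T 3 w) + 6 * (T 2 w)\<^sup>2" by (simp add: power2_eq_square)
  have "M 2 0 w = T 2 w * T 0 w + (2 * (T 1 w * T 1 w) + T 0 w * T 2 w)"
    unfolding T_def by (rule key[where f = "\<lambda>m n. ?P 2 0 m n + (2 * ?P 1 1 m n + ?P 0 2 m n)"],
      intro has_sum_add has_sum_cmult_right theta_term_product_has_sum[OF K])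
      (unfold theta_term_product bilinear_term_factor, algebra)
  then show "M 2 0 w = 2 * (T 0 w * T 2 w) + 2 * (T 1 w)\<^sup>2" by (simp add: power2_eq_square)
  have "M 4 0 w = T 4 w * T 0 w + (4 * (T 3 w * T 1 w) + (6 * (T 2 w * T 2 w) + (4 * (T 1 w * T 3 w) + T 0 w * T 4 w)))"
    unfolding T_def by (rule key[where f = "\<lambda>m n. ?P 4 0 m n + (4 * ?P 3 1 m n + (6 * ?P 2 2 m n + (4 * ?P 1 3 m n + ?P 0 4 m n)))"],
      intro has_sum_add has_sum_cmult_right theta_term_product_has_sum[OF K])
      (unfold theta_term_product bilinear_term_factor, algebra)
  then show "M 4 0 w = 2 * (T 0 w * T 4 w) + 8 * (T 1 w * T 3 w) + 6 * (T 2 w)\<^sup>2" by (simp add: power2_eq_square)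
  \<comment> \<open>The coefficients of (x - y)^2 (x + y)^4 are 1, 2, -1, -4, -1, 2, 1.\<close>
  have "M 4 2 w = T 6 w * T 0 w + (2 * (T 5 w * T 1 w) + ((-1) * (T 4 w * T 2 w) + ((-4) * (T 3 w * T 3 w) + ((-1) * (T 2 w * T 4 w) + (2 * (T 1 w * T 5 w) + T 0 w * T 6 w)))))"
    unfolding T_def by (rule key[where f = "\<lambda>m n. ?P 6 0 m n + (2 * ?P 5 1 m n + ((-1) * ?P 4 2 m n + ((-4) * ?P 3 3 m n + ((-1) * ?P 2 4 m n + (2 * ?P 1 5 m n + ?P 0 6 m n)))))"],
      intro has_sum_add has_sum_cmult_right theta_term_product_has_sum[OF K])
      (unfold theta_term_product bilinear_term_factor, algebra)
  then show "M 4 2 w = 2 * (T 0 w * T 6 w) + 4 * (T 1 w * T 5 w) - 2 * (T 2 w * T 4 w) - 4 * (T 3 w)\<^sup>2" by (simp add: power2_eq_square)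
qed

text \<open>The vectors (e k, d k) for k = 0, 2, 4 lie in a plane, so their 2 by 2 minors are the
  coefficients of a linear relation among them. Pairing this relation with (A, -B) gives the claim:
  the pairings are the expressions in T, the minors those in t, where the even moments at w = 0 have
  dropped out.\<close>

lemma theta_moment_identity:
  fixes K w :: real
  assumes K: "K > 0"
  defines "T \<equiv> \<lambda>j. theta_moment j w K" and "t \<equiv> \<lambda>j. theta_moment j 0 K"
  shows "(t 1)\<^sup>2 * (4 * (T 1 * T 3) - 3 * (T 2)\<^sup>2 - T 0 * T 4) + 4 * (t 1 * t 3) * (T 0 * T 2 - (T 1)\<^sup>2)
     - (t 1 * t 5 - (t 3)\<^sup>2) * (T 0)\<^sup>2 = 0" (is "?L = 0")
proof -
  have z: "theta_moment 0 0 K = 0" "theta_moment 2 0 K = 0" "theta_moment 4 0 K = 0" using K by (auto intro: theta_moment_even_zero)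
  define A B where "A = gauss_moment odd_ints 0 w K" and "B = gauss_moment even_ints 0 w K"
  define e where "e = (\<lambda>k. gauss_moment even_ints k 0 K)"
  define d where "d = (\<lambda>k. gauss_moment odd_ints k 0 K)"
  have a: "(T 0)\<^sup>2 = A * e 0 - B * d 0" "2 * (T 0 * T 2) - 2 * (T 1)\<^sup>2 = A * e 2 - B * d 2"
    "2 * (T 0 * T 4) - 8 * (T 1 * T 3) + 6 * (T 2)\<^sup>2 = A * e 4 - B * d 4"
    using bilinear_term_moments(1-3)[OF K, of w] by (simp_all add: A_def B_def e_def d_def T_def)
  have b: "2 * (t 1)\<^sup>2 = d 2 * e 0 - e 2 * d 0" "8 * (t 1 * t 3) = d 4 * e 0 - e 4 * d 0"
    "4 * (t 1 * t 5) - 4 * (t 3)\<^sup>2 = d 4 * e 2 - e 4 * d 2"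
    using bilinear_term_moments(4-6)[OF K, of 0] by (simp_all add: z e_def d_def t_def)
  have "4 * ?L = - (2 * (t 1)\<^sup>2) * (2 * (T 0 * T 4) - 8 * (T 1 * T 3) + 6 * (T 2)\<^sup>2)
      + (8 * (t 1 * t 3)) * (2 * (T 0 * T 2) - 2 * (T 1)\<^sup>2)
      - (4 * (t 1 * t 5) - 4 * (t 3)\<^sup>2) * (T 0)\<^sup>2"
    by (simp add: algebra_simps)
  also have "\<dots> = 0" unfolding a b by (simp add: algebra_simps)
  finally show ?thesis by simp
qed

section \<open>Moments at w = K and as K tends to infinity\<close>

lemma theta_term_reflect: "theta_term j K K (n + 1) = - exp K * (alt_sign n * (of_int n + 3/2) ^ j * exp (- K * (of_int n + 1/2)\<^sup>2))"
proof -
  have s: "of_int (n + 1) + 1/2 = (of_int n + 3/2 :: real)" by simp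
  have e: "2 * (of_int n + 3/2) * K - K * (of_int n + 3/2)\<^sup>2 = K + - K * (of_int n + 1/2 :: real)\<^sup>2"
    by (simp add: power2_eq_square field_simps)
  show ?thesis unfolding theta_term_def s e exp_add by (simp add: alt_sign_def)
qed

text \<open>At w = K the exponent 2 m K - K m^2 equals K - K (m - 1)^2. Shifting the index by one
  therefore expresses the moments through those at w = 0, with (m + 1)^j expanded binomially; the
  shift also flips the sign. These are the boundary values of U and its derivatives, which the
  divergent Lambert series cannot provide.\<close>

lemma theta_moment_reflect:
  assumes K: "K > 0"
  defines "t \<equiv> \<lambda>j. theta_moment j 0 K"
  shows "theta_moment 0 K K = 0" "theta_moment 1 K K = - exp K * t 1" "theta_moment 2 K K = - exp K * (2 * t 1)"
    "theta_moment 4 K K = - exp K * (4 * t 3 + 4 * t 1)"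
proof -
  have bij: "bij_betw (\<lambda>n::int. n + 1) UNIV UNIV"
    by (rule bij_betwI[where g = "\<lambda>n. n - 1"]) auto
  have z: "t 0 = 0" "t 2 = 0" "t 4 = 0" unfolding t_def using K by (auto intro: theta_moment_even_zero)
  have key: "theta_moment j K K = - exp K * S"
    if "(f has_sum S) UNIV" "\<And>n. f n = alt_sign n * (of_int n + 3/2) ^ j * exp (- K * (of_int n + 1/2)\<^sup>2)" for j S f
  proof -
    have "((\<lambda>n. theta_term j K K (n + 1)) has_sum theta_moment j K K) UNIV"
      using theta_term_has_sum[OF K] by (subst has_sum_reindex_bij_betw[OF bij])
    moreover have "((\<lambda>n. - exp K * f n) has_sum (- exp K * S)) UNIV"
      using that(1) by (rule has_sum_cmult_right)
    ultimately show ?thesis unfolding theta_term_reflect that(2) by (rule has_sum_unique)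
  qed
  have tm0: "theta_term i 0 K n = (of_int n + 1/2) ^ i * (alt_sign n * exp (- K * (of_int n + 1/2)\<^sup>2))" for i n
    by (simp add: theta_term_def)
  have s: "of_int n + 3/2 = (of_int n + 1/2 :: real) + 1" for n by simp
  have ht: "(theta_term j 0 K has_sum t j) UNIV" for j unfolding t_def by (rule theta_term_has_sum[OF K])
  note i = has_sum_add has_sum_cmult_right ht
  have "theta_moment 0 K K = - exp K * t 0"
    by (rule key[where f = "theta_term 0 0 K"], rule ht) (simp add: tm0)
  then show "theta_moment 0 K K = 0" by (simp add: z)
  have "theta_moment 1 K K = - exp K * (t 1 + t 0)"
    by (rule key[where f = "\<lambda>n. theta_term 1 0 K n + theta_term 0 0 K n"], intro i) (unfold tm0 s, algebra)
  then show "theta_moment 1 K K = - exp K * t 1" by (simp add: z)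
  have "theta_moment 2 K K = - exp K * (t 2 + (2 * t 1 + t 0))"
    by (rule key[where f = "\<lambda>n. theta_term 2 0 K n + (2 * theta_term 1 0 K n + theta_term 0 0 K n)"], intro i) (unfold tm0 s, algebra)
  then show "theta_moment 2 K K = - exp K * (2 * t 1)" by (simp add: z)
  have "theta_moment 4 K K = - exp K * (t 4 + (4 * t 3 + (6 * t 2 + (4 * t 1 + t 0))))"
    by (rule key[where f = "\<lambda>n. theta_term 4 0 K n + (4 * theta_term 3 0 K n + (6 * theta_term 2 0 K n + (4 * theta_term 1 0 K n + theta_term 0 0 K n)))"], intro i)
      (unfold tm0 s, algebra)
  then show "theta_moment 4 K K = - exp K * (4 * t 3 + 4 * t 1)" by (simp add: z)
qed

text \<open>The limit is carried by n = 0 and n = -1, that is m = 1/2 and m = -1/2, where the weight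
  is exp (- K / 4). All other m have m^2 >= 9/4 and contribute O(exp (- 2 K)) after
  rescaling.\<close>

lemma theta_moment_at_top:
  "((\<lambda>K. exp (K / 4) * theta_moment j w K) \<longlongrightarrow> (1/2) ^ j * exp w - (- 1/2) ^ j * exp (- w)) at_top"
proof -
  define M where "M = (\<lambda>n::int. \<bar>of_int n + 1/2\<bar> ^ j * exp (2 * \<bar>w\<bar> * \<bar>of_int n + 1/2\<bar> - 1 * (of_int n + 1/2)\<^sup>2))"
  have M: "M summable_on UNIV" unfolding M_def by (rule gauss_moment_summable) simp
  define c where "c = (1/2) ^ j * exp w - (- 1/2) ^ j * exp (- w)"
  have bound: "\<bar>exp (K / 4) * theta_moment j w K - c\<bar> \<le> exp (9/4) * (\<Sum>\<^sub>\<infinity>n\<in>UNIV - {0, -1}. M n) * exp (- 2 * K)" if "K \<ge> 1" for K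
  proof -
    define g where "g = (\<lambda>n. exp (K / 4) * theta_term j w K n)"
    have g: "(g has_sum (exp (K / 4) * theta_moment j w K)) UNIV"
      unfolding g_def using that by (intro has_sum_cmult_right theta_term_has_sum) auto
    have "(g has_sum (sum g {0, -1})) {0, -1}" by (intro has_sum_finite) auto
    from has_sum_Diff[OF g this] have 1: "(g has_sum (exp (K / 4) * theta_moment j w K - sum g {0, -1})) (UNIV - {0, -1})" by simp
    have "g 0 = (1/2) ^ j * exp w" "g (-1) = - ((- 1/2) ^ j * exp (- w))"
    proof -
      have "theta_term j w K 0 = (1/2) ^ j * exp (w - K / 4)" "theta_term j w K (-1) = - ((- 1/2) ^ j * exp (- w - K / 4))"
        by (simp_all add: theta_term_def alt_sign_def power2_eq_square)
      then show "g 0 = (1/2) ^ j * exp w" "g (-1) = - ((- 1/2) ^ j * exp (- w))"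
        unfolding g_def by (simp_all add: mult.left_commute flip: exp_add)
    qed
    then have 2: "sum g {0, -1} = c" by (simp add: c_def)
    have le: "norm (g n) \<le> (exp (9/4) * exp (- 2 * K)) * M n" if n: "n \<in> UNIV - {0, -1}" for n
    proof -
      have "n \<ge> 1 \<or> n \<le> -2" using n by auto
      then have "real_of_int n + 1/2 \<ge> 3/2 \<or> real_of_int n + 1/2 \<le> -(3/2)" by auto
      then have "(3/2)\<^sup>2 \<le> (real_of_int n + 1/2)\<^sup>2"
        by (intro abs_le_square_iff[THEN iffD1]) auto
      \<comment> \<open>The majorant \<open>M\<close> is fixed at parameter 1. The remaining K - 1
        is spent at the smallest possible square 9/4, and K / 4 - (K - 1) 9/4 = 9/4 - 2 K.\<close>
      then have "(K - 1) * (9/4) \<le> (K - 1) * (real_of_int n + 1/2)\<^sup>2"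
        using \<open>K \<ge> 1\<close> by (intro mult_left_mono) (auto simp: power2_eq_square)
      then have e: "K / 4 + (X - K * (real_of_int n + 1/2)\<^sup>2) \<le> (9/4 + - 2 * K) + (X - 1 * (real_of_int n + 1/2)\<^sup>2)" for X
        by (simp add: left_diff_distrib)
      have "norm (g n) = exp (K / 4) * \<bar>theta_term j w K n\<bar>" by (simp add: g_def abs_mult)
      also have "\<dots> \<le> exp (K / 4) * (\<bar>of_int n + 1/2\<bar> ^ j * exp (2 * \<bar>w\<bar> * \<bar>of_int n + 1/2\<bar> - K * (of_int n + 1/2)\<^sup>2))"
        by (intro mult_left_mono abs_theta_term_le) auto
      also have "\<dots> = \<bar>of_int n + 1/2\<bar> ^ j * exp (K / 4 + (2 * \<bar>w\<bar> * \<bar>of_int n + 1/2\<bar> - K * (of_int n + 1/2)\<^sup>2))"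
        by (simp add: exp_add)
      also have "\<dots> \<le> \<bar>of_int n + 1/2\<bar> ^ j * exp ((9/4 + - 2 * K) + (2 * \<bar>w\<bar> * \<bar>of_int n + 1/2\<bar> - 1 * (of_int n + 1/2)\<^sup>2))"
        using e by (intro mult_left_mono) (auto simp del: mult_1)
      also have "\<dots> = (exp (9/4) * exp (- 2 * K)) * M n"
        unfolding M_def exp_add by (simp only: mult_ac)
      finally show ?thesis .
    qed
    have 3: "((\<lambda>n. (exp (9/4) * exp (- 2 * K)) * M n) has_sum (exp (9/4) * exp (- 2 * K)) * (\<Sum>\<^sub>\<infinity>n\<in>UNIV - {0, -1}. M n)) (UNIV - {0, -1})"
      by (intro has_sum_cmult_right has_sum_infsum summable_on_subset_banach[OF M]) auto
    have "norm (exp (K / 4) * theta_moment j w K - c) \<le> (exp (9/4) * exp (- 2 * K)) * (\<Sum>\<^sub>\<infinity>n\<in>UNIV - {0, -1}. M n)"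
      by (rule norm_infsum_le[OF 1[unfolded 2] 3 le])
    then show ?thesis by (simp add: mult_ac)
  qed
  have "((\<lambda>K. exp (9/4) * (\<Sum>\<^sub>\<infinity>n\<in>UNIV - {0, -1}. M n) * exp (- 2 * K)) \<longlongrightarrow> 0) at_top"
    proof -
    have "((\<lambda>K. exp (- 2 * K)) \<longlongrightarrow> (0::real)) at_top"
      by (intro filterlim_compose[OF exp_at_bot] filterlim_tendsto_neg_mult_at_bot[OF tendsto_const] filterlim_ident) auto
    from tendsto_mult_left[OF this] show ?thesis by simp
  qed
  then have "((\<lambda>K. exp (K / 4) * theta_moment j w K - c) \<longlongrightarrow> 0) at_top"
    by (rule Lim_null_comparison[rotated]) (use bound in \<open>auto intro: eventually_at_top_linorderI[of 1]\<close>)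
  then show ?thesis unfolding c_def by (simp add: LIM_zero_iff)
qed

section \<open>Jacobi theta functions\<close>

definition jtheta_term :: "complex \<Rightarrow> complex \<Rightarrow> int \<Rightarrow> complex" where
  "jtheta_term z \<tau> n = exp (2 * of_real pi * \<i> * of_int n * z + \<i> * of_real pi * (of_int n)\<^sup>2 * \<tau>)"

lemma norm_jtheta_term: "norm (jtheta_term z \<tau> n) = exp (- (2 * pi * of_int n * Im z) - pi * Im \<tau> * (of_int n)\<^sup>2)"
proof -
  have "\<i> * of_real pi * (of_int n)\<^sup>2 * \<tau> = \<i> * (of_real (pi * (of_int n)\<^sup>2) * \<tau>)" by simp
  moreover have "2 * of_real pi * \<i> * of_int n * z = \<i> * (of_real (2 * pi * of_int n) * z)" by simp
  ultimately show ?thesis by (simp add: jtheta_term_def del: of_real_mult of_real_power)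
qed

lemma norm_jtheta_term_le:
  assumes "\<bar>Im z\<bar> \<le> R"
  shows "norm (jtheta_term z \<tau> n) \<le> \<bar>real_of_int n + 0\<bar> ^ 0 * exp ((2 * pi * R) * \<bar>real_of_int n + 0\<bar> - (pi * Im \<tau>) * (real_of_int n + 0)\<^sup>2)"
proof -
  have "- (2 * pi * of_int n * Im z) \<le> \<bar>2 * pi * of_int n * Im z\<bar>" by simp
  also have "\<dots> = 2 * pi * \<bar>Im z\<bar> * \<bar>of_int n\<bar>" unfolding abs_mult by simp
  also have "\<dots> \<le> 2 * pi * R * \<bar>of_int n\<bar>" using assms by (intro mult_right_mono mult_left_mono) auto
  finally show ?thesis unfolding norm_jtheta_term by simp
qed

lemma jtheta_term_majorant_summable:
  assumes "Im \<tau> > 0"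
  shows "(\<lambda>n. \<bar>real_of_int n + 0\<bar> ^ 0 * exp ((2 * pi * R) * \<bar>real_of_int n + 0\<bar> - (pi * Im \<tau>) * (real_of_int n + 0)\<^sup>2)) summable_on UNIV"
  by (rule gauss_moment_summable) (use assms in simp)

lemma jtheta_term_has_sum:
  assumes "Im \<tau> > 0"
  shows "(jtheta_term z \<tau> has_sum jtheta z \<tau>) UNIV"
proof -
  have "(\<lambda>n. norm (jtheta_term z \<tau> n)) summable_on UNIV"
    by (rule summable_on_comparison_test[OF jtheta_term_majorant_summable[OF assms, of "\<bar>Im z\<bar>"] norm_jtheta_term_le]) auto
  then have "jtheta_term z \<tau> summable_on UNIV" by (rule abs_summable_summable)
  then have "(jtheta_term z \<tau> has_sum infsum (jtheta_term z \<tau>) UNIV) UNIV" by (rule has_sum_infsum)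
  then show ?thesis unfolding jtheta_def jtheta_term_def .
qed

lemma exp_2pi_i_int: "exp (2 * complex_of_real pi * \<i> * of_int n) = 1"
  by (simp add: exp_eq_1)

lemma jtheta_plus_1:
  "jtheta (z + 1) \<tau> = jtheta z \<tau>"
proof -
  have "jtheta_term (z + 1) \<tau> n = jtheta_term z \<tau> n" for n
  proof -
    have "exp (2 * of_real pi * \<i> * of_int n) = 1" by (rule exp_2pi_i_int)
    moreover have "2 * of_real pi * \<i> * of_int n * (z + 1) + \<i> * of_real pi * (of_int n)\<^sup>2 * \<tau> =
      2 * of_real pi * \<i> * of_int n * z + \<i> * of_real pi * (of_int n)\<^sup>2 * \<tau> + 2 * of_real pi * \<i> * of_int n"
      by (simp add: algebra_simps)
    ultimately show ?thesis unfolding jtheta_term_def by (simp add: exp_add)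
  qed
  then show ?thesis unfolding jtheta_def jtheta_term_def by simp
qed

lemma jtheta_plus_tau:
  assumes "Im \<tau> > 0"
  shows "jtheta (z + \<tau>) \<tau> = exp (- \<i> * of_real pi * (\<tau> + 2 * z)) * jtheta z \<tau>"
proof -
  have bij: "bij_betw (\<lambda>n::int. n + 1) UNIV UNIV"
    by (rule bij_betwI[where g = "\<lambda>n. n - 1"]) auto
  have "((\<lambda>n. jtheta_term z \<tau> (n + 1)) has_sum jtheta z \<tau>) UNIV"
    using jtheta_term_has_sum[OF assms] by (subst has_sum_reindex_bij_betw[OF bij])
  then have "((\<lambda>n. exp (- \<i> * of_real pi * (\<tau> + 2 * z)) * jtheta_term z \<tau> (n + 1)) has_sum
      exp (- \<i> * of_real pi * (\<tau> + 2 * z)) * jtheta z \<tau>) UNIV"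
    by (rule has_sum_cmult_right)
  moreover have "exp (- \<i> * of_real pi * (\<tau> + 2 * z)) * jtheta_term z \<tau> (n + 1) = jtheta_term (z + \<tau>) \<tau> n" for n
    unfolding jtheta_term_def exp_add[symmetric] by (rule arg_cong[of _ _ exp]) (simp add: power2_eq_square algebra_simps)
  ultimately show ?thesis using jtheta_term_has_sum[OF assms, of "z + \<tau>"] by (auto intro: has_sum_unique)
qed

lemma jtheta_minus:
  assumes "Im \<tau> > 0"
  shows "jtheta (- z) \<tau> = jtheta z \<tau>"
proof -
  have bij: "bij_betw (\<lambda>n::int. - n) UNIV UNIV"
    by (rule bij_betwI[where g = "\<lambda>n. - n"]) auto
  have "((\<lambda>n. jtheta_term z \<tau> (- n)) has_sum jtheta z \<tau>) UNIV"
    using jtheta_term_has_sum[OF assms] by (subst has_sum_reindex_bij_betw[OF bij])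
  moreover have "jtheta_term z \<tau> (- n) = jtheta_term (- z) \<tau> n" for n unfolding jtheta_term_def by simp
  ultimately show ?thesis using jtheta_term_has_sum[OF assms, of "- z"] by (auto intro: has_sum_unique)
qed

lemma jtheta_holomorphic:
  assumes "Im \<tau> > 0"
  shows "(\<lambda>z. jtheta z \<tau>) holomorphic_on S"
proof -
  have "(\<lambda>z. jtheta z \<tau>) holomorphic_on ball a 1" for a
  proof (rule holomorphic_uniform_limit)
    show "uniform_limit (cball a 1) (\<lambda>X z. \<Sum>n\<in>X. jtheta_term z \<tau> n) (\<lambda>z. jtheta z \<tau>) (finite_subsets_at_top UNIV)"
    proof (rule Weierstrass_m_test_general'[OF _ _ jtheta_term_majorant_summable[OF assms, of "\<bar>Im a\<bar> + 1"]])
      fix n z assume z: "z \<in> cball a 1"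
      have "\<bar>Im z\<bar> \<le> \<bar>Im a\<bar> + \<bar>Im (a - z)\<bar>" by simp
      also have "\<bar>Im (a - z)\<bar> \<le> norm (a - z)" by (rule abs_Im_le_cmod)
      also have "\<dots> \<le> 1" using z by (simp add: dist_norm)
      finally have "\<bar>Im z\<bar> \<le> \<bar>Im a\<bar> + 1" by simp
      then show "norm (jtheta_term z \<tau> n) \<le> \<bar>real_of_int n + 0\<bar> ^ 0 * exp ((2 * pi * (\<bar>Im a\<bar> + 1)) * \<bar>real_of_int n + 0\<bar> - (pi * Im \<tau>) * (real_of_int n + 0)\<^sup>2)"
        by (rule norm_jtheta_term_le)
    qed (rule jtheta_term_has_sum[OF assms])
    show "\<forall>\<^sub>F X in finite_subsets_at_top UNIV. continuous_on (cball a 1) (\<lambda>z. \<Sum>n\<in>X. jtheta_term z \<tau> n) \<and>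
        (\<lambda>z. \<Sum>n\<in>X. jtheta_term z \<tau> n) holomorphic_on ball a 1"
      unfolding jtheta_term_def by (intro always_eventually allI conjI continuous_intros holomorphic_intros)
  qed auto
  then show ?thesis
    by (meson holomorphic_on_imp_differentiable_at holomorphic_on_def field_differentiable_at_within open_ball centre_in_ball zero_less_one)
qed

lemma jtheta11_holomorphic:
  assumes "Im \<tau> > 0"
  shows "(\<lambda>z. jtheta11 z \<tau>) holomorphic_on S"
proof -
  have "((\<lambda>z. jtheta z \<tau>) \<circ> (\<lambda>z. z + (1 + \<tau>) / 2)) holomorphic_on S"
    by (intro holomorphic_on_compose holomorphic_intros jtheta_holomorphic assms)
  then show ?thesis unfolding jtheta11_def o_def by (intro holomorphic_intros)
qed

lemma jtheta11_plus_1: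
  assumes "Im \<tau> > 0"
  shows "jtheta11 (z + 1) \<tau> = - jtheta11 z \<tau>"
proof -
  have "exp (\<i> * of_real pi * (z + 1 + \<tau> / 4)) = - exp (\<i> * of_real pi * (z + \<tau> / 4))"
    by (simp add: exp_add ring_distribs)
  moreover have "jtheta (z + 1 + (1 + \<tau>) / 2) \<tau> = jtheta (z + (1 + \<tau>) / 2) \<tau>"
    using jtheta_plus_1[of "z + (1 + \<tau>) / 2"] by (simp add: add_ac)
  ultimately show ?thesis by (simp add: jtheta11_def)
qed

lemma jtheta11_plus_tau:
  assumes "Im \<tau> > 0"
  shows "jtheta11 (z + \<tau>) \<tau> = - exp (- \<i> * of_real pi * (\<tau> + 2 * z)) * jtheta11 z \<tau>"
proof -
  have 1: "jtheta (z + \<tau> + (1 + \<tau>) / 2) \<tau> = exp (- \<i> * of_real pi * (\<tau> + 2 * (z + (1 + \<tau>) / 2))) * jtheta (z + (1 + \<tau>) / 2) \<tau>"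
    using jtheta_plus_tau[OF assms, of "z + (1 + \<tau>) / 2"] by (simp add: add_ac)
  have "\<i> * of_real pi * (z + \<tau> + \<tau> / 4) + - \<i> * of_real pi * (\<tau> + 2 * (z + (1 + \<tau>) / 2)) =
     (- \<i> * of_real pi * (\<tau> + 2 * z) + \<i> * of_real pi * (z + \<tau> / 4)) - \<i> * of_real pi"
    by (simp add: field_simps)
  then have "exp (\<i> * of_real pi * (z + \<tau> + \<tau> / 4)) * exp (- \<i> * of_real pi * (\<tau> + 2 * (z + (1 + \<tau>) / 2))) =
     - (exp (- \<i> * of_real pi * (\<tau> + 2 * z)) * exp (\<i> * of_real pi * (z + \<tau> / 4)))"
    by (simp add: exp_diff flip: exp_add)
  then show ?thesis unfolding jtheta11_def 1 by (simp add: mult_ac)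
qed

text \<open>The point (1 + \<tau>) / 2 is congruent to its negative modulo the periods. Evenness and
  the multiplier, here exp (- i pi) = -1, show that theta equals its own negative there.\<close>

lemma jtheta11_0:
  assumes "Im \<tau> > 0"
  shows "jtheta11 0 \<tau> = 0"
proof -
  have "jtheta ((1 + \<tau>) / 2) \<tau> = jtheta (- (1 + \<tau>) / 2 + 1 + \<tau>) \<tau>"
    by (rule arg_cong[of _ _ "\<lambda>z. jtheta z \<tau>"]) (simp add: field_simps)
  also have "\<dots> = exp (- \<i> * of_real pi * (\<tau> + 2 * (- (1 + \<tau>) / 2 + 1))) * jtheta (- (1 + \<tau>) / 2) \<tau>"
    by (simp only: jtheta_plus_tau[OF assms] jtheta_plus_1)
  also have "\<tau> + 2 * (- (1 + \<tau>) / 2 + 1) = 1" by (simp add: field_simps)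
  also have "exp (- \<i> * of_real pi * 1) = - 1" by (simp add: exp_minus)
  also have "jtheta (- (1 + \<tau>) / 2) \<tau> = jtheta ((1 + \<tau>) / 2) \<tau>"
    using jtheta_minus[OF assms, of "(1 + \<tau>) / 2"] by (simp add: minus_divide_left)
  finally have "jtheta ((1 + \<tau>) / 2) \<tau> = 0" by simp
  then show ?thesis by (simp add: jtheta11_def)
qed

lemma exp_pi_i_int: "exp (\<i> * complex_of_real pi * of_int n) = of_real (alt_sign n)"
proof (cases "even n")
  case True
  then obtain k where "n = 2 * k" by blast
  moreover have "exp (2 * of_real pi * \<i> * of_int k) = 1" by (rule exp_2pi_i_int)
  ultimately show ?thesis by (simp add: alt_sign_def mult_ac)
next
  case False
  then obtain k where k: "n = 2 * k + 1" by (blast elim: oddE)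
  have "exp (2 * of_real pi * \<i> * of_int k) = 1" by (rule exp_2pi_i_int)
  then show ?thesis unfolding k by (simp add: alt_sign_def ring_distribs exp_add mult_ac)
qed

text \<open>The prefactor in \<open>jtheta11\<close> completes the square, replacing n by n + 1/2;
  the shift by 1/2 in z produces the alternating sign.\<close>

lemma jtheta11_has_sum:
  assumes "Im \<tau> > 0"
  shows "((\<lambda>n. \<i> * of_real (alt_sign n) * exp (2 * of_real pi * \<i> * (of_int n + 1/2) * z + \<i> * of_real pi * (of_int n + 1/2)\<^sup>2 * \<tau>))
    has_sum jtheta11 z \<tau>) UNIV"
proof -
  have "((\<lambda>n. \<i> * exp (\<i> * of_real pi * (z + \<tau> / 4)) * jtheta_term (z + (1 + \<tau>) / 2) \<tau> n) has_sum jtheta11 z \<tau>) UNIV"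
    unfolding jtheta11_def by (intro has_sum_cmult_right jtheta_term_has_sum assms)
  moreover have "\<i> * exp (\<i> * of_real pi * (z + \<tau> / 4)) * jtheta_term (z + (1 + \<tau>) / 2) \<tau> n =
     \<i> * of_real (alt_sign n) * exp (2 * of_real pi * \<i> * (of_int n + 1/2) * z + \<i> * of_real pi * (of_int n + 1/2)\<^sup>2 * \<tau>)" for n
  proof -
    have "\<i> * of_real pi * (z + \<tau> / 4) + (2 * of_real pi * \<i> * of_int n * (z + (1 + \<tau>) / 2) + \<i> * of_real pi * (of_int n)\<^sup>2 * \<tau>) =
      \<i> * of_real pi * of_int n + (2 * of_real pi * \<i> * (of_int n + 1/2) * z + \<i> * of_real pi * (of_int n + 1/2)\<^sup>2 * \<tau>)"
      by (simp add: power2_eq_square field_simps)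
    then show ?thesis unfolding jtheta_term_def exp_pi_i_int[symmetric] mult.assoc by (simp flip: exp_add)
  qed
  ultimately show ?thesis by simp
qed

text \<open>At z = 1/2 the factors i and exp (i pi (n + 1/2)) turn all summands into negative reals,
  so nothing cancels. This is the witness that the theta function is not identically zero, hence
  that its derivative at 0 does not vanish.\<close>

lemma jtheta11_half_nonzero:
  assumes "y > 0"
  shows "jtheta11 (1/2) (\<i> * of_real y) \<noteq> 0"
proof
  assume z: "jtheta11 (1/2) (\<i> * of_real y) = 0"
  let ?f = "\<lambda>n::int. exp (- pi * y * (of_int n + 1/2)\<^sup>2)"
  have "\<i> * of_real (alt_sign n) * exp (2 * of_real pi * \<i> * (of_int n + 1/2) * (1/2) + \<i> * of_real pi * (of_int n + 1/2)\<^sup>2 * (\<i> * of_real y))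
     = - of_real (?f n)" for n
  proof -
    have "exp (\<i> * of_real pi / 2) = \<i>" using cis_conv_exp[of "pi / 2"] by simp
    moreover have "exp (of_int n * (of_real pi * \<i>) + of_real pi * \<i> / 2) = exp (\<i> * of_real pi * of_int n) * exp (\<i> * of_real pi / 2)"
      by (simp add: mult_ac flip: exp_add)
    ultimately have "exp (of_int n * (of_real pi * \<i>) + of_real pi * \<i> / 2) = of_real (alt_sign n) * \<i>"
      by (simp add: exp_pi_i_int)
    moreover have "2 * of_real pi * \<i> * (of_int n + 1/2) * (1/2) + \<i> * of_real pi * (of_int n + 1/2)\<^sup>2 * (\<i> * of_real y) =
      (of_int n * (of_real pi * \<i>) + of_real pi * \<i> / 2) + of_real (- pi * y * (of_int n + 1/2)\<^sup>2)"
      by (simp add: field_simps)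
    ultimately have "exp (2 * of_real pi * \<i> * (of_int n + 1/2) * (1/2) + \<i> * of_real pi * (of_int n + 1/2)\<^sup>2 * (\<i> * of_real y)) =
       of_real (alt_sign n) * \<i> * of_real (?f n)"
      by (simp only: exp_add exp_of_real)
    then show ?thesis by (auto simp: alt_sign_def)
  qed
  then have "((\<lambda>n. - complex_of_real (?f n)) has_sum 0) UNIV"
    using jtheta11_has_sum[of "\<i> * of_real y" "1/2"] assms z by simp
  then have "((\<lambda>n. Re (- complex_of_real (?f n))) has_sum Re 0) UNIV"
    by (rule has_sum_Re)
  then have "((\<lambda>n. - ?f n) has_sum 0) UNIV" by simp
  then have "(?f has_sum 0) UNIV" using has_sum_cmult_right[where f = "\<lambda>n. - ?f n" and c = "-1"] by fastforce
  then have "?f 0 = 0" by (rule nonneg_has_sum_le_0D) auto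
  then show False by simp
qed

section \<open>The Lambert series of a quasi-periodic function\<close>

text \<open>The sum is minus the logarithm of Jacobi's product over m >= 1 of (1 - p^m exp (2 u)) (1
  - p^m exp (- 2 u)) / (1 - p^m)^2 with p = exp (- 2 K). The first zeros of the product lie on |Re
  u| = K, which limits the series to the open strip. Subtracting 2 makes it vanish at u = 0.\<close>

definition lambert_term :: "real \<Rightarrow> complex \<Rightarrow> nat \<Rightarrow> complex" where
  "lambert_term K u n = (exp (2 * of_nat (Suc n) * u) + exp (- 2 * of_nat (Suc n) * u) - 2) /
     of_real (real (Suc n) * (exp (2 * real (Suc n) * K) - 1))"

definition lambert :: "real \<Rightarrow> complex \<Rightarrow> complex" where
  "lambert K u = (\<Sum>n. lambert_term K u n)"

lemma lambert_denominator_ge: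
  assumes "K > (0::real)"
  shows "(1 - exp (- 2 * K)) * exp (2 * real (Suc n) * K) \<le> real (Suc n) * (exp (2 * real (Suc n) * K) - 1)"
proof -
  have "exp (- 2 * K) * exp (2 * real (Suc n) * K) = exp (2 * real n * K)"
    by (simp add: algebra_simps flip: exp_add)
  moreover have "exp (2 * real n * K) \<ge> 1" using assms by simp
  ultimately have "(1 - exp (- 2 * K)) * exp (2 * real (Suc n) * K) \<le> 1 * (exp (2 * real (Suc n) * K) - 1)"
    by (simp add: left_diff_distrib)
  also have "\<dots> \<le> real (Suc n) * (exp (2 * real (Suc n) * K) - 1)"
    using assms by (intro mult_right_mono) auto
  finally show ?thesis .
qed

lemma norm_lambert_term_le:
  assumes K: "K > 0" and R: "\<bar>Re u\<bar> \<le> R"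
  shows "norm (lambert_term K u n) \<le> 4 / (1 - exp (- 2 * K)) * exp (- 2 * (K - R)) ^ Suc n"
proof -
  let ?k = "real (Suc n)"
  have p: "0 < (1 - exp (- 2 * K)) * exp (2 * ?k * K)" using K by simp
  have "norm (exp (2 * of_nat (Suc n) * u) + exp (- 2 * of_nat (Suc n) * u) - 2)
      \<le> norm (exp (2 * of_nat (Suc n) * u) + exp (- 2 * of_nat (Suc n) * u)) + norm (2 :: complex)"
    by (rule norm_triangle_ineq4)
  also have "\<dots> \<le> norm (exp (2 * of_nat (Suc n) * u)) + norm (exp (- 2 * of_nat (Suc n) * u)) + 2"
    by (simp only: norm_numeral add_right_mono norm_triangle_ineq)
  finally have n0: "norm (exp (2 * of_nat (Suc n) * u) + exp (- 2 * of_nat (Suc n) * u) - 2)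
      \<le> norm (exp (2 * of_nat (Suc n) * u)) + norm (exp (- 2 * of_nat (Suc n) * u)) + 2" .
  have n1: "norm (exp (2 * of_nat (Suc n) * u)) \<le> exp (2 * ?k * R)"
    using R by (auto simp: norm_exp_eq_Re intro!: mult_left_mono simp del: of_nat_Suc)
  have n2: "norm (exp (- 2 * of_nat (Suc n) * u)) \<le> exp (2 * ?k * R)"
  proof -
    have "?k * (- Re u) \<le> ?k * R" using R by (intro mult_left_mono) auto
    then show ?thesis by (simp add: norm_exp_eq_Re mult_ac del: of_nat_Suc)
  qed
  have n3: "1 \<le> exp (2 * ?k * R)" using R by simp
  have num: "norm (exp (2 * of_nat (Suc n) * u) + exp (- 2 * of_nat (Suc n) * u) - 2) \<le> 4 * exp (2 * ?k * R)"
    using n0 n1 n2 n3 by linarith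
  have "norm (lambert_term K u n) = norm (exp (2 * of_nat (Suc n) * u) + exp (- 2 * of_nat (Suc n) * u) - 2) / (?k * (exp (2 * ?k * K) - 1))"
  proof -
    have "0 \<le> ?k * (exp (2 * ?k * K) - 1)" using K by simp
    then show ?thesis unfolding lambert_term_def norm_divide norm_of_real by simp
  qed
  also have "\<dots> \<le> (4 * exp (2 * ?k * R)) / ((1 - exp (- 2 * K)) * exp (2 * ?k * K))"
    by (rule frac_le[OF _ num p lambert_denominator_ge[OF K]]) auto
  also have "\<dots> = 4 / (1 - exp (- 2 * K)) * (exp (2 * ?k * R) / exp (2 * ?k * K))" by simp
  also have "exp (2 * ?k * R) / exp (2 * ?k * K) = exp (- 2 * (K - R)) ^ Suc n"
    by (simp add: algebra_simps exp_of_nat_mult flip: exp_diff exp_of_nat_mult exp_add)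
  finally show ?thesis .
qed

lemma lambert_majorant_summable:
  fixes K R :: real
  assumes "R < K"
  shows "summable (\<lambda>n. 4 / (1 - exp (- 2 * K)) * exp (- 2 * (K - R)) ^ Suc n)"
  using assms by (intro summable_mult) (simp only: summable_Suc_iff summable_geometric_iff, simp)

lemma lambert_term_summable:
  assumes "K > 0" "\<bar>Re u\<bar> < K"
  shows "summable (lambert_term K u)"
  by (rule summable_comparison_test'[OF lambert_majorant_summable[OF assms(2)] norm_lambert_term_le]) (use assms in auto)

definition strip :: "real \<Rightarrow> complex set" where "strip K = {u. \<bar>Re u\<bar> < K}"

lemma open_strip: "open (strip K)"
  unfolding strip_def by (intro open_Collect_less continuous_intros)

lemma convex_strip: "convex (strip K)"
proof -
  have "strip K = {u. Re u < K} \<inter> {u. Re u > - K}" by (auto simp: strip_def)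
  then show ?thesis by (simp add: convex_Int convex_halfspace_Re_lt convex_halfspace_Re_gt)
qed

lemma lambert_holomorphic:
  assumes "K > 0"
  shows "lambert K holomorphic_on strip K"
proof (rule holomorphic_uniform_sequence[OF open_strip])
  show "(\<lambda>u. \<Sum>i<n. lambert_term K u i) holomorphic_on strip K" for n
    unfolding lambert_term_def by (intro holomorphic_intros) (use assms in auto)
  fix u assume u: "u \<in> strip K"
  define d where "d = (K - \<bar>Re u\<bar>) / 2"
  have d: "d > 0" "\<bar>Re u\<bar> + d < K" using u by (auto simp: d_def strip_def field_simps)
  have le: "\<bar>Re v\<bar> \<le> \<bar>Re u\<bar> + d" if "v \<in> cball u d" for v
  proof -
    have "\<bar>Re v\<bar> \<le> \<bar>Re u\<bar> + \<bar>Re (u - v)\<bar>" by simp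
    also have "\<bar>Re (u - v)\<bar> \<le> norm (u - v)" by (rule abs_Re_le_cmod)
    also have "\<dots> \<le> d" using that by (simp add: dist_norm)
    finally show ?thesis by simp
  qed
  have "uniform_limit (cball u d) (\<lambda>n v. \<Sum>i<n. lambert_term K v i) (\<lambda>v. \<Sum>i. lambert_term K v i) sequentially"
    by (rule Weierstrass_m_test[OF norm_lambert_term_le[OF assms le] lambert_majorant_summable[OF d(2)]])
  then show "\<exists>d>0. cball u d \<subseteq> strip K \<and> uniform_limit (cball u d) (\<lambda>n u. \<Sum>i<n. lambert_term K u i) (lambert K) sequentially"
    using d le by (intro exI[of _ d]) (force simp: strip_def lambert_def[abs_def])
qed

lemma exp_minus_log_series:
  assumes "norm (q::complex) < 1"
  shows "(\<lambda>n. q ^ Suc n / of_nat (Suc n)) sums (- Ln (1 - q))" "exp (Ln (1 - q)) = 1 - q"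
proof -
  have "(\<lambda>n. - (q ^ n) / of_nat n) sums Ln (1 - q)"
    using Ln_series'[of "- q"] assms by simp
  then have "(\<lambda>n. - (q ^ Suc n) / of_nat (Suc n)) sums Ln (1 - q)"
    by (subst sums_Suc_iff) simp
  from sums_minus[OF this] show "(\<lambda>n. q ^ Suc n / of_nat (Suc n)) sums (- Ln (1 - q))" by simp
  show "exp (Ln (1 - q)) = 1 - q" using assms by (intro exp_Ln) auto
qed

text \<open>In the difference of the terms at u + K and at u the denominator exp (2 k K) - 1
  cancels, leaving two logarithm series with arguments \<open>q1\<close> and \<open>q2\<close>. The
  condition on Re u keeps both points in the strip and makes both arguments smaller than 1 in
  modulus.\<close>

lemma exp_lambert_shift:
  assumes K: "K > 0" and u: "- K < Re u" "Re u < 0"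
  shows "exp (lambert K (u + of_real K)) * (1 - exp (2 * u)) = exp (lambert K u) * (1 - exp (- 2 * u - 2 * of_real K))"
proof -
  define q1 q2 where "q1 = exp (2 * u)" and "q2 = exp (- 2 * u - 2 * of_real K)"
  have q: "norm q1 < 1" "norm q2 < 1" using u by (auto simp: q1_def q2_def norm_exp_eq_Re)
  have d: "lambert_term K (u + of_real K) n - lambert_term K u n = q1 ^ Suc n / of_nat (Suc n) - q2 ^ Suc n / of_nat (Suc n)" for n
  proof -
    define k where "k = Suc n"
    define a b where "a = exp (2 * of_nat k * u)" and "b = complex_of_real (exp (2 * real k * K))"
    have b: "b \<noteq> 1" "b \<noteq> 0" using K by (auto simp: b_def k_def)
    have b': "b = exp (2 * of_nat k * of_real K)" by (simp add: b_def flip: exp_of_real)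
    have e: "exp (2 * of_nat k * (u + of_real K)) = a * b" "exp (- 2 * of_nat k * (u + of_real K)) = inverse (a * b)"
      "exp (- 2 * of_nat k * u) = inverse a"
      unfolding a_def b' by (simp_all add: algebra_simps flip: exp_add exp_minus)
    have qq: "q1 ^ k = a" "q2 ^ k = inverse (a * b)"
      unfolding a_def b' q1_def q2_def by (simp_all add: algebra_simps flip: exp_of_nat_mult exp_add exp_minus)
    have a: "a \<noteq> 0" by (simp add: a_def)
    have "lambert_term K (u + of_real K) n - lambert_term K u n = (a * b + inverse (a * b) - 2) / (of_nat k * (b - 1)) - (a + inverse a - 2) / (of_nat k * (b - 1))"
      unfolding lambert_term_def k_def[symmetric] e a_def[symmetric] by (simp add: b_def)
    also have "\<dots> = a / of_nat k - inverse (a * b) / of_nat k"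
      using a b by (simp add: k_def divide_simps del: of_nat_Suc) (simp add: algebra_simps)
    finally show ?thesis unfolding k_def[symmetric] qq .
  qed
  have "(\<lambda>n. lambert_term K (u + of_real K) n - lambert_term K u n) sums (lambert K (u + of_real K) - lambert K u)"
    unfolding lambert_def by (intro sums_diff summable_sums lambert_term_summable) (use K u in auto)
  moreover have "(\<lambda>n. lambert_term K (u + of_real K) n - lambert_term K u n) sums (- Ln (1 - q1) - - Ln (1 - q2))"
    unfolding d by (intro sums_diff exp_minus_log_series(1) q)
  ultimately have "lambert K (u + of_real K) - lambert K u = - Ln (1 - q1) - - Ln (1 - q2)" by (rule sums_unique2)
  then have "lambert K (u + of_real K) + Ln (1 - q1) = lambert K u + Ln (1 - q2)" by (simp add: algebra_simps)
  then have "exp (lambert K (u + of_real K) + Ln (1 - q1)) = exp (lambert K u + Ln (1 - q2))" by simp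
  then show ?thesis unfolding exp_add exp_minus_log_series(2)[OF q(1)] exp_minus_log_series(2)[OF q(2)] unfolding q1_def q2_def .
qed

lemma lambert_plus_i_pi: "lambert K (u + \<i> * of_real pi) = lambert K u"
proof -
  have "lambert_term K (u + \<i> * of_real pi) n = lambert_term K u n" for n
  proof -
    have "2 * of_nat (Suc n) * (u + \<i> * of_real pi) = 2 * of_nat (Suc n) * u + 2 * of_real pi * \<i> * of_int (int (Suc n))"
      "- 2 * of_nat (Suc n) * (u + \<i> * of_real pi) = - 2 * of_nat (Suc n) * u + 2 * of_real pi * \<i> * of_int (- int (Suc n))"
      by (simp_all add: algebra_simps)
    then show ?thesis unfolding lambert_term_def exp_add by (simp only: exp_2pi_i_int exp_add mult_1_right)
  qed
  then show ?thesis by (simp add: lambert_def)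
qed

section \<open>Uniqueness of quasi-periodic functions\<close>

lemma periodic_int:
  fixes f :: "complex \<Rightarrow> 'a"
  assumes "\<And>u. f (u + a) = f u"
  shows "f (u + of_int n * a) = f u"
proof (induction n rule: int_induct[where k = 0])
  case (step1 i)
  then show ?case using assms[of "u + of_int i * a"] by (simp add: algebra_simps)
next
  case (step2 i)
  have "f (u + of_int (i - 1) * a) = f (u + of_int (i - 1) * a + a)" by (rule assms[symmetric])
  also have "\<dots> = f (u + of_int i * a)" by (simp add: algebra_simps)
  also have "\<dots> = f u" by (rule step2)
  finally show ?case .
qed simp

lemma sinh_eq_0_complexD:
  assumes "sinh (u::complex) = 0"
  obtains n :: int where "u = of_int n * (\<i> * of_real pi)"
proof -
  have "exp u = exp (- u)" using assms by (simp add: sinh_def)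
  then have "exp (u + u) = exp u * exp (- u)" by (simp only: exp_add)
  then have "exp (u + u) = 1" by (simp flip: exp_add)
  then have "Re (u + u) = 0" "\<exists>n::int. Im (u + u) = of_int (2 * n) * pi"
    unfolding exp_eq_1 by auto
  then obtain n :: int where "Re u = 0" "Im u = of_int n * pi" by auto
  then have "u = of_int n * (\<i> * of_real pi)" by (simp add: complex_eq_iff)
  then show ?thesis by (rule that)
qed

text \<open>The singularities are removable: at a simple zero of g, l'Hopital's rule gives the
  quotient of derivatives as the limit, and this is the value assigned there.\<close>

lemma holomorphic_quotient_simple_zeros:
  assumes f: "f holomorphic_on UNIV" and g: "g holomorphic_on UNIV"
    and z: "\<And>u. g u = 0 \<Longrightarrow> f u = 0 \<and> deriv g u \<noteq> 0"
  shows "(\<lambda>u. if g u = 0 then deriv f u / deriv g u else f u / g u) holomorphic_on UNIV" (is "?q holomorphic_on UNIV")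
proof -
  have "\<exists>U. open U \<and> u \<in> U \<and> ?q holomorphic_on U" for u
  proof (cases "g u = 0")
    case False
    have "continuous_on UNIV g" using g by (rule holomorphic_on_imp_continuous_on)
    then have o: "open {v. g v \<noteq> 0}" by (intro open_Collect_neq continuous_on_const)
    have "(\<lambda>v. f v / g v) holomorphic_on {v. g v \<noteq> 0}"
      by (intro holomorphic_intros holomorphic_on_subset[OF f] holomorphic_on_subset[OF g]) auto
    then have "?q holomorphic_on {v. g v \<noteq> 0}"
      by (rule holomorphic_transform) auto
    then show ?thesis using o False by blast
  next
    case True
    have df: "(f has_field_derivative deriv f u) (at u)" and dg: "(g has_field_derivative deriv g u) (at u)"
      using f g by (auto intro!: holomorphic_derivI[of _ UNIV])
    have "g \<noteq> (\<lambda>_. 0)" using z[OF True] by auto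
    then obtain b where b: "g b \<noteq> 0" by auto
    obtain r where r: "r > 0" "\<And>v. v \<in> ball u r - {u} \<Longrightarrow> g v \<noteq> 0"
      using isolated_zeros[OF g, of u b] True b by auto
    have h: "?q holomorphic_on ball u r - {u}"
    proof (rule holomorphic_transform)
      show "(\<lambda>v. f v / g v) holomorphic_on ball u r - {u}"
        by (intro holomorphic_intros holomorphic_on_subset[OF f] holomorphic_on_subset[OF g]) (use r in auto)
    qed (use r in auto)
    have "((\<lambda>v. f v / g v) \<longlongrightarrow> deriv f u / deriv g u) (at u)"
      using z[OF True] True by (intro lhopital_complex_simple[OF df dg]) auto
    moreover have "\<forall>\<^sub>F v in at u. f v / g v = ?q v"
      unfolding eventually_at using r by (intro exI[of _ r]) (auto simp: dist_commute)
    ultimately have "(?q \<longlongrightarrow> ?q u) (at u)"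
      using True by (simp add: tendsto_cong)
    then have "continuous (at u) ?q" by (simp add: continuous_at)
    moreover have "continuous (at v) ?q" if "v \<in> ball u r - {u}" for v
      using h that by (metis continuous_on_eq_continuous_at holomorphic_on_imp_continuous_on open_Diff open_ball closed_singleton)
    ultimately have "continuous_on (ball u r) ?q"
      by (intro continuous_at_imp_continuous_on ballI) blast
    then have "?q holomorphic_on ball u r"
      by (rule no_isolated_singularity[OF _ h]) auto
    then show ?thesis using r by (intro exI[of _ "ball u r"]) auto
  qed
  then show ?thesis
    by (metis UNIV_I field_differentiable_at_within holomorphic_on_def holomorphic_on_imp_differentiable_at)
qed

theorem quasi_periodic_eq:
  assumes K: "K > 0" and f: "f holomorphic_on UNIV" and f0: "f 0 = 0"
    and fi: "\<And>u. f (u + \<i> * of_real pi) = - f u"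
    and fK: "\<And>u. f (u + of_real K) = - exp (2 * u + of_real K) * f u"
  obtains c where "\<And>u. u \<in> strip K \<Longrightarrow> f u = c * sinh u * exp (- lambert K u)"
proof -
  have dsh: "(sinh has_field_derivative cosh u) (at u)" for u :: complex
    by (rule derivative_eq_intros refl | simp)+
  have ds: "deriv sinh u = cosh (u::complex)" for u by (rule DERIV_imp_deriv) (rule dsh)
  have sh: "(sinh :: complex \<Rightarrow> complex) holomorphic_on UNIV"
    unfolding holomorphic_on_def using dsh field_differentiable_at_within field_differentiable_def by blast
  have z: "f u = 0" if s: "sinh u = 0" for u
  proof -
    obtain n :: int where u: "u = of_int n * (\<i> * of_real pi)" by (rule sinh_eq_0_complexD[OF s])
    have "norm (f (0 + of_int n * (\<i> * of_real pi))) = norm (f 0)"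
      by (rule periodic_int[of "\<lambda>u. norm (f u)"]) (simp add: fi)
    then show ?thesis using u f0 by simp
  qed
  have c0: "cosh u \<noteq> 0" if "sinh u = 0" for u :: complex
    using that cosh_square_eq[of u] by auto
  define q where "q = (\<lambda>u. if sinh u = 0 then deriv f u / deriv sinh u else f u / sinh u)"
  have qh: "q holomorphic_on UNIV"
    unfolding q_def by (rule holomorphic_quotient_simple_zeros[OF f sh]) (auto simp: z ds c0)
  have si: "sinh (u + \<i> * of_real pi) = - sinh u" "cosh (u + \<i> * of_real pi) = - cosh u" for u :: complex
  proof -
    have "exp (u + \<i> * of_real pi) = - exp u" "exp (- (u + \<i> * of_real pi)) = - exp (- u)"
      by (simp_all add: exp_add exp_diff exp_minus)
    then show "sinh (u + \<i> * of_real pi) = - sinh u" "cosh (u + \<i> * of_real pi) = - cosh u"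
      by (simp_all add: sinh_def cosh_def scaleR_conv_of_real field_simps)
  qed
  \<comment> \<open>At the zeros of sinh the value of \<open>q\<close> is a quotient of derivatives,
    so periodicity of \<open>q\<close> there rests on the transformation law of the
    derivative.\<close>
  have dfi: "deriv f (u + \<i> * of_real pi) = - deriv f u" for u
  proof -
    have "(f has_field_derivative deriv f (u + \<i> * of_real pi)) (at (u + \<i> * of_real pi))"
      using f by (auto intro!: holomorphic_derivI[of _ UNIV])
    then have "((\<lambda>u. f (u + \<i> * of_real pi)) has_field_derivative deriv f (u + \<i> * of_real pi)) (at u)"
      by (simp add: DERIV_shift)
    then have "((\<lambda>u. - f u) has_field_derivative deriv f (u + \<i> * of_real pi)) (at u)" by (simp add: fi)
    moreover have "((\<lambda>u. - f u) has_field_derivative - deriv f u) (at u)"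
      using f by (auto intro!: DERIV_minus holomorphic_derivI[of _ UNIV])
    ultimately show ?thesis by (rule DERIV_unique)
  qed
  have qi: "q (u + \<i> * of_real pi) = q u" for u
    by (simp add: q_def si ds dfi fi)
  define h where "h = (\<lambda>u. q u * exp (lambert K u))"
  have hh: "h holomorphic_on strip K"
    unfolding h_def by (intro holomorphic_intros holomorphic_on_subset[OF qh] lambert_holomorphic K) auto
  have hi: "h (u + \<i> * of_real pi) = h u" for u by (simp add: h_def qi lambert_plus_i_pi)
  \<comment> \<open>The multiplier of f, the ratio of the sinh factors and the shift of the Lambert
    series cancel exactly. Since sinh vanishes only on Re u = 0, neither u nor u + K is a
    zero.\<close>
  have hK: "h (u + of_real K) = h u" if u: "- K < Re u" "Re u < 0" for u
  proof -
    have s: "sinh v \<noteq> 0" if "Re v \<noteq> 0" for v :: complex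
    proof
      assume "sinh v = 0"
      then obtain n :: int where "v = of_int n * (\<i> * of_real pi)" by (rule sinh_eq_0_complexD)
      then show False using that by simp
    qed
    have s1: "sinh u \<noteq> 0" and s2: "sinh (u + of_real K) \<noteq> 0" using u by (auto intro!: s)
    have e1: "sinh u = - exp (- u) * (1 - exp (2 * u)) / 2"
      by (simp add: sinh_def scaleR_conv_of_real field_simps flip: exp_add)
    have e2: "sinh (u + of_real K) = exp (u + of_real K) * (1 - exp (- 2 * u - 2 * of_real K)) / 2"
      by (simp add: sinh_def scaleR_conv_of_real field_simps flip: exp_add)
    have e3: "exp (2 * u + of_real K) * exp (- u) = exp (u + of_real K)" by (simp flip: exp_add)
    have "exp (2 * u + of_real K) * sinh u * exp (lambert K (u + of_real K))
      = - (exp (2 * u + of_real K) * exp (- u)) / 2 * (exp (lambert K (u + of_real K)) * (1 - exp (2 * u)))"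
      unfolding e1 by simp
    also have "\<dots> = - sinh (u + of_real K) * exp (lambert K u)"
      unfolding exp_lambert_shift[OF K u] e2 e3 by simp
    finally have "- exp (2 * u + of_real K) * exp (lambert K (u + of_real K)) / sinh (u + of_real K) = exp (lambert K u) / sinh u"
      using s1 s2 by (simp add: field_simps)
    then have "f u * (- exp (2 * u + of_real K) * exp (lambert K (u + of_real K)) / sinh (u + of_real K)) = f u * (exp (lambert K u) / sinh u)"
      by simp
    then show ?thesis using s1 s2 by (simp add: h_def q_def fK mult_ac)
  qed
  \<comment> \<open>A compact rectangle meeting every class: one shift by K brings Re u to modulus
    at most K / 2, because the strip has width 2 K, and shifts by i pi bring Im u into [0, pi). The
    supremum of |h| over the open strip is thus attained at a point of it, as the maximum principle
    requires.\<close>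
  define B where "B = cbox (Complex (- K / 2) (- pi)) (Complex (K / 2) pi)"
  have Bs: "B \<subseteq> strip K" using K by (auto simp: B_def strip_def in_cbox_complex_iff)
  have "continuous_on B (\<lambda>u. norm (h u))"
    by (intro continuous_intros holomorphic_on_imp_continuous_on holomorphic_on_subset[OF hh Bs])
  moreover have "compact B" "B \<noteq> {}" using K by (auto simp: B_def in_cbox_complex_iff box_ne_empty Basis_complex_def)
  ultimately obtain b where b: "b \<in> B" "\<And>u. u \<in> B \<Longrightarrow> norm (h u) \<le> norm (h b)"
    using continuous_attains_sup[of B "\<lambda>u. norm (h u)"] by blast
  have le: "norm (h u) \<le> norm (h b)" if u: "u \<in> strip K" for u
  proof -
    obtain v where v: "h v = h u" "\<bar>Re v\<bar> \<le> K / 2"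
    proof -
      consider "\<bar>Re u\<bar> \<le> K / 2" | "Re u > K / 2" | "Re u < - K / 2" by linarith
      then show thesis
      proof cases
        case 1 then show ?thesis using that by blast
      next
        case 2
        then have "h (u - of_real K + of_real K) = h (u - of_real K)" using u by (intro hK) (auto simp: strip_def)
        then show ?thesis using 2 u by (intro that[of "u - of_real K"]) (auto simp: strip_def)
      next
        case 3
        then have "h (u + of_real K) = h u" using u K by (intro hK) (auto simp: strip_def)
        then show ?thesis using 3 u by (intro that[of "u + of_real K"]) (auto simp: strip_def)
      qed
    qed
    define n where "n = - \<lfloor>Im v / pi\<rfloor>"
    have hv: "h (v + of_int n * (\<i> * of_real pi)) = h v" by (rule periodic_int) (rule hi)
    have "of_int \<lfloor>Im v / pi\<rfloor> * pi \<le> (Im v / pi) * pi" "(Im v / pi) * pi < (of_int \<lfloor>Im v / pi\<rfloor> + 1) * pi"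
      by (intro mult_right_mono mult_strict_right_mono; simp)+
    then have "of_int \<lfloor>Im v / pi\<rfloor> * pi \<le> Im v" "Im v < (of_int \<lfloor>Im v / pi\<rfloor> + 1) * pi" by simp_all
    then have "v + of_int n * (\<i> * of_real pi) \<in> B"
      using v(2) by (auto simp: B_def in_cbox_complex_iff n_def algebra_simps)
    then show ?thesis using b(2) hv v(1) by metis
  qed
  have "h constant_on strip K"
    by (rule maximum_modulus_principle[OF hh open_strip convex_connected[OF convex_strip] open_strip subset_refl _ le])
      (use b Bs in auto)
  then obtain c where c: "\<And>u. u \<in> strip K \<Longrightarrow> h u = c" unfolding constant_on_def by blast
  show ?thesis
  proof (rule that)
    fix u assume u: "u \<in> strip K"
    have "f u = q u * sinh u" by (auto simp: q_def z)
    also have "q u = c * exp (- lambert K u)" using c[OF u] by (simp add: h_def exp_minus field_simps)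
    finally show "f u = c * sinh u * exp (- lambert K u)" by simp
  qed
qed

text \<open>Near 0 the right-hand side is c u + o(u), so the constant is the derivative at 0. After
  division by it, any two functions with these transformation laws agree on the strip; applied to
  two theta functions this is the modular transformation with its prefactor divided out. The witness
  \<open>u1\<close> rules out c = 0.\<close>

lemma quasi_periodic_normalized:
  assumes K: "K > 0" and f: "f holomorphic_on UNIV" and f0: "f 0 = 0"
    and fi: "\<And>u. f (u + \<i> * of_real pi) = - f u"
    and fK: "\<And>u. f (u + of_real K) = - exp (2 * u + of_real K) * f u"
    and nz: "u1 \<in> strip K" "f u1 \<noteq> 0"
  shows "deriv f 0 \<noteq> 0" "u \<in> strip K \<Longrightarrow> f u = deriv f 0 * sinh u * exp (- lambert K u)"
proof -
  obtain c where c: "\<And>u. u \<in> strip K \<Longrightarrow> f u = c * sinh u * exp (- lambert K u)"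
    by (rule quasi_periodic_eq[OF K f f0 fi fK]) blast
  have s0: "0 \<in> strip K" using K by (simp add: strip_def)
  have l0: "lambert K 0 = 0" by (simp add: lambert_def lambert_term_def)
  have dl: "(lambert K has_field_derivative deriv (lambert K) 0) (at 0)"
    by (rule holomorphic_derivI[OF lambert_holomorphic[OF K] open_strip s0])
  have "((\<lambda>u. c * sinh u * exp (- lambert K u)) has_field_derivative c) (at 0)"
    by (rule derivative_eq_intros refl dl | simp add: l0)+
  moreover have "\<forall>\<^sub>F u in nhds 0. f u = c * sinh u * exp (- lambert K u)"
    using c open_strip s0 unfolding eventually_nhds by blast
  ultimately have "(f has_field_derivative c) (at 0)"
    by (subst DERIV_cong_ev[OF refl _ refl])
  then have d: "deriv f 0 = c" by (rule DERIV_imp_deriv)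
  show "deriv f 0 \<noteq> 0" using c[OF nz(1)] nz(2) d by auto
  show "u \<in> strip K \<Longrightarrow> f u = deriv f 0 * sinh u * exp (- lambert K u)" using c d by simp
qed

section \<open>The two theta functions on the real axis\<close>

definition lambert_real :: "real \<Rightarrow> real \<Rightarrow> real" where
  "lambert_real K w = (\<Sum>n. (exp (2 * real (Suc n) * w) + exp (- 2 * real (Suc n) * w) - 2) / (real (Suc n) * (exp (2 * real (Suc n) * K) - 1)))"

lemma lambert_term_of_real:
  "lambert_term K (of_real w) n = of_real ((exp (2 * real (Suc n) * w) + exp (- 2 * real (Suc n) * w) - 2) / (real (Suc n) * (exp (2 * real (Suc n) * K) - 1)))"
proof -
  have "exp (2 * of_nat (Suc n) * complex_of_real w) = of_real (exp (2 * real (Suc n) * w))"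
    "exp (- 2 * of_nat (Suc n) * complex_of_real w) = of_real (exp (- 2 * real (Suc n) * w))"
    by (simp_all flip: exp_of_real)
  then show ?thesis unfolding lambert_term_def by simp
qed

lemma lambert_of_real:
  assumes "\<bar>w\<bar> < K"
  shows "lambert K (of_real w) = of_real (lambert_real K w)"
proof -
  have "summable (lambert_term K (of_real w))" using assms by (intro lambert_term_summable) auto
  then have "lambert_term K (of_real w) sums lambert K (of_real w)" unfolding lambert_def by (rule summable_sums)
  then have "(\<lambda>n. Re (lambert_term K (of_real w) n)) sums Re (lambert K (of_real w))" "(\<lambda>n. Im (lambert_term K (of_real w) n)) sums Im (lambert K (of_real w))"
    by (auto dest: sums_Re sums_Im)
  then have "Re (lambert K (of_real w)) = lambert_real K w" "Im (lambert K (of_real w)) = 0"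
    unfolding lambert_term_of_real lambert_real_def by (auto simp: sums_iff)
  then show ?thesis by (simp add: complex_eq_iff)
qed

text \<open>Here \<tau> = i pi / K and u = K z. Without correction, the shift z + \<tau> would carry
  the exponential multiplier and the shift z + 1 none; the Gaussian factor exp (u^2 / K) moves the
  multiplier from the shift of u by i pi to the shift by K.\<close>

lemma calU_eq_lambert:
  assumes w: "0 < w" "w < K"
  shows "calU (2 * w) K = (1 - exp (- 2 * w)) * exp (- lambert_real K w)"
proof -
  have K: "K > 0" using w by simp
  define \<tau> where "\<tau> = \<i> * of_real pi / of_real K"
  have \<tau>: "\<tau> = \<i> * of_real (pi / K)" "Im \<tau> > 0" using K by (auto simp: \<tau>_def)
  define g where "g = (\<lambda>z. jtheta11 z \<tau>)"
  define f where "f = (\<lambda>u. exp (u\<^sup>2 / of_real K) * g (u / of_real K))"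
  have K0: "complex_of_real K \<noteq> 0" using K by simp
  have gh: "g holomorphic_on S" for S unfolding g_def by (rule jtheta11_holomorphic[OF \<tau>(2)])
  have "(g \<circ> (\<lambda>u. u / of_real K)) holomorphic_on UNIV"
    by (intro holomorphic_on_compose holomorphic_intros gh) (use K in auto)
  then have fh: "f holomorphic_on UNIV"
    unfolding f_def o_def by (intro holomorphic_intros) (use K in auto)
  have f0: "f 0 = 0" by (simp add: f_def g_def jtheta11_0[OF \<tau>(2)])
  have fi: "f (u + \<i> * of_real pi) = - f u" for u
  proof -
    have "(u + \<i> * of_real pi) / of_real K = u / of_real K + \<tau>" using K0 by (simp add: \<tau>_def add_divide_distrib)
    then have "g ((u + \<i> * of_real pi) / of_real K) = - exp (- \<i> * of_real pi * (\<tau> + 2 * (u / of_real K))) * g (u / of_real K)"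
      unfolding g_def by (simp only: jtheta11_plus_tau[OF \<tau>(2)])
    moreover have "(u + \<i> * of_real pi)\<^sup>2 / of_real K + - \<i> * of_real pi * (\<tau> + 2 * (u / of_real K)) = u\<^sup>2 / of_real K"
      using K0 by (simp add: \<tau>_def power2_eq_square field_simps)
    then have "exp ((u + \<i> * of_real pi)\<^sup>2 / of_real K) * exp (- \<i> * of_real pi * (\<tau> + 2 * (u / of_real K))) = exp (u\<^sup>2 / of_real K)"
      by (simp only: exp_add[symmetric])
    ultimately show ?thesis unfolding f_def by (simp add: mult.assoc[symmetric])
  qed
  have fK: "f (u + of_real K) = - exp (2 * u + of_real K) * f u" for u
  proof -
    have "(u + of_real K) / of_real K = u / of_real K + 1" using K0 by (simp add: field_simps)
    then have "g ((u + of_real K) / of_real K) = - g (u / of_real K)"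
      unfolding g_def by (simp only: jtheta11_plus_1[OF \<tau>(2)])
    moreover have "(u + of_real K)\<^sup>2 / of_real K = (2 * u + of_real K) + u\<^sup>2 / of_real K"
      using K0 by (simp add: power2_eq_square field_simps)
    ultimately show ?thesis unfolding f_def by (simp add: exp_add)
  qed
  have nz: "f (of_real (K / 2)) \<noteq> 0"
    using jtheta11_half_nonzero[of "pi / K"] K by (simp add: f_def g_def \<tau>(1))
  have s: "of_real (K / 2) \<in> strip K" "of_real w \<in> strip K" using w by (auto simp: strip_def)
  note N = quasi_periodic_normalized[OF K fh f0 fi fK s(1) nz]
  have dg: "(g has_field_derivative deriv g 0) (at 0)"
    by (rule holomorphic_derivI[OF gh[of UNIV]]) auto
  have "((\<lambda>u. g (u / of_real K)) has_field_derivative deriv g 0 * (1 / of_real K)) (at 0)"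
    by (rule DERIV_chain2[of g]) (use dg K in \<open>auto intro!: derivative_eq_intros\<close>)
  moreover have "((\<lambda>u. exp (u\<^sup>2 / complex_of_real K)) has_field_derivative 0) (at 0)"
    using K0 by (auto intro!: derivative_eq_intros)
  ultimately have "(f has_field_derivative deriv g 0 * (1 / of_real K)) (at 0)"
    unfolding f_def by (auto dest: DERIV_mult)
  then have df: "deriv f 0 = deriv g 0 / of_real K" using DERIV_imp_deriv by fastforce
  have "exp (of_real (w\<^sup>2 / K)) * g (of_real (w / K)) = deriv g 0 / of_real K * sinh (of_real w) * exp (- lambert K (of_real w))"
    using N(2)[OF s(2)] unfolding df by (simp add: f_def)
  also have "lambert K (of_real w) = of_real (lambert_real K w)" using w by (intro lambert_of_real) auto
  also have "sinh (complex_of_real w) = of_real (sinh w)"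
    by (simp add: sinh_def scaleR_conv_of_real exp_of_real exp_minus)
  finally have "g (of_real (w / K)) / deriv g 0 = of_real (exp (- (w\<^sup>2 / K)) / K * sinh w * exp (- lambert_real K w))"
    using N(1) K0 unfolding df by (simp add: exp_minus exp_of_real[symmetric] field_simps)
  then have r: "Re (g (of_real (w / K)) / deriv g 0) = exp (- (w\<^sup>2 / K)) / K * sinh w * exp (- lambert_real K w)"
    by (simp only: Re_complex_of_real)
  have wK: "2 * w / (2 * K) = w / K" "2 * w / 2 = w" by auto
  have "calU (2 * w) K = 2 * K * exp (2 * w / 2 * (2 * w / (2 * K) - 1)) * Re (g (of_real (2 * w / (2 * K))) / deriv g 0)"
    unfolding calU_def Let_def \<tau>_def g_def ..
  then have "calU (2 * w) K = 2 * K * exp (w * (w / K - 1)) * (exp (- (w\<^sup>2 / K)) / K * sinh w * exp (- lambert_real K w))"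
    unfolding wK r .
  also have "\<dots> = 2 * (exp (w * (w / K - 1)) * exp (- (w\<^sup>2 / K))) * sinh w * exp (- lambert_real K w)"
    using K by simp
  \<comment> \<open>The elementary prefactor in \<open>calU\<close> undoes the Gaussian factor at u
    = w, up to exp (- w).\<close>
  also have "exp (w * (w / K - 1)) * exp (- (w\<^sup>2 / K)) = exp (- w)"
    by (simp add: power2_eq_square algebra_simps flip: exp_add)
  also have "2 * exp (- w) * sinh w = 1 - exp (- 2 * w)"
    by (simp add: sinh_def algebra_simps flip: exp_add)
  finally show ?thesis .
qed

text \<open>Here \<tau> = i K / pi and u = i pi z, so the two periods have changed roles and the
  transformation laws hold for theta_11 itself. On the real axis it is \<i> times the moment of
  order 0, and its derivative at 0 is 2 \<i> times the moment of order 1.\<close>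

lemma theta_moment_eq_lambert:
  assumes K: "K > 0"
  shows "theta_moment 1 0 K \<noteq> 0" "\<bar>w\<bar> < K \<Longrightarrow> theta_moment 0 w K = 2 * theta_moment 1 0 K * sinh w * exp (- lambert_real K w)"
proof -
  define \<tau> where "\<tau> = \<i> * of_real (K / pi)"
  have \<tau>: "Im \<tau> > 0" using K by (auto simp: \<tau>_def)
  define g where "g = (\<lambda>z. jtheta11 z \<tau>)"
  define f where "f = (\<lambda>u. g (u / (\<i> * of_real pi)))"
  have gh: "g holomorphic_on S" for S unfolding g_def by (rule jtheta11_holomorphic[OF \<tau>])
  have "(g \<circ> (\<lambda>u. u / (\<i> * of_real pi))) holomorphic_on UNIV"
    by (intro holomorphic_on_compose holomorphic_intros gh) auto
  then have fh: "f holomorphic_on UNIV"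
    unfolding f_def o_def .
  have f0: "f 0 = 0" by (simp add: f_def g_def jtheta11_0[OF \<tau>])
  have fi: "f (u + \<i> * of_real pi) = - f u" for u
  proof -
    have "(u + \<i> * of_real pi) / (\<i> * of_real pi) = u / (\<i> * of_real pi) + 1" by (simp add: add_divide_distrib)
    then show ?thesis unfolding f_def g_def by (simp only: jtheta11_plus_1[OF \<tau>])
  qed
  have fK: "f (u + of_real K) = - exp (2 * u + of_real K) * f u" for u
  proof -
    \<comment> \<open>the shift by \<open>K\<close> is the shift of \<open>z\<close> by \<open>- \<tau>\<close>\<close>
    define z where "z = (u + of_real K) / (\<i> * of_real pi)"
    have z: "u / (\<i> * of_real pi) = z + \<tau>" by (simp add: z_def \<tau>_def field_simps)
    have "- \<i> * of_real pi * (\<tau> + 2 * z) = - (2 * u + of_real K)"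
      by (simp add: z_def \<tau>_def field_simps)
    then have "g (z + \<tau>) = - exp (- (2 * u + of_real K)) * g z"
      unfolding g_def by (simp only: jtheta11_plus_tau[OF \<tau>])
    then show ?thesis unfolding f_def z unfolding z_def[symmetric] by (simp add: exp_minus[of "2 * u + of_real K"] del: minus_add_distrib)
  qed
  have nz: "f (\<i> * of_real pi / 2) \<noteq> 0"
    using jtheta11_half_nonzero[of "K / pi"] K by (simp add: f_def g_def \<tau>_def)
  have s: "\<i> * of_real pi / 2 \<in> strip K" using K by (auto simp: strip_def)
  note N = quasi_periodic_normalized[OF K fh f0 fi fK s nz]
  have fr: "f (of_real w) = \<i> * of_real (theta_moment 0 w K)" for w
  proof -
    have "((\<lambda>n. \<i> * of_real (theta_term 0 w K n)) has_sum \<i> * of_real (theta_moment 0 w K)) UNIV"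
      by (intro has_sum_cmult_right has_sum_of_real theta_term_has_sum K)
    moreover have "\<i> * of_real (theta_term 0 w K n) = \<i> * of_real (alt_sign n) * exp (2 * of_real pi * \<i> * (of_int n + 1/2) * (of_real w / (\<i> * of_real pi)) + \<i> * of_real pi * (of_int n + 1/2)\<^sup>2 * \<tau>)" for n
    proof -
      have "2 * of_real pi * \<i> * m * (W / (\<i> * of_real pi)) + \<i> * of_real pi * m\<^sup>2 * \<tau> = 2 * m * W - of_real K * m\<^sup>2" for m W
        by (simp add: \<tau>_def mult_ac)
      from this[of "of_int n + 1/2" "of_real w"]
      have "2 * of_real pi * \<i> * (of_int n + 1/2) * (of_real w / (\<i> * of_real pi)) + \<i> * of_real pi * (of_int n + 1/2)\<^sup>2 * \<tau>
        = of_real (2 * (of_int n + 1/2) * w - K * (of_int n + 1/2)\<^sup>2)"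
        by simp
      then show ?thesis unfolding theta_term_def by (simp only: exp_of_real of_real_mult power_0 mult_1_right mult.assoc)
    qed
    ultimately have "((\<lambda>n. \<i> * of_real (alt_sign n) * exp (2 * of_real pi * \<i> * (of_int n + 1/2) * (of_real w / (\<i> * of_real pi)) + \<i> * of_real pi * (of_int n + 1/2)\<^sup>2 * \<tau>))
        has_sum \<i> * of_real (theta_moment 0 w K)) UNIV" by (simp only:)
    from has_sum_unique[OF jtheta11_has_sum[OF \<tau>] this] show ?thesis unfolding f_def g_def .
  qed
  \<comment> \<open>The complex derivative is computed along the real axis, where f is known as a
    moment.\<close>
  have "(f has_field_derivative deriv f 0) (at 0)"
    by (rule holomorphic_derivI[OF fh]) auto
  then have "((\<lambda>h. f h / h) \<longlongrightarrow> deriv f 0) (at 0)" by (simp add: DERIV_def f0)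
  moreover have "filterlim complex_of_real (at 0) (at 0)"
    unfolding filterlim_at by (auto intro!: tendsto_eq_intros simp: eventually_at_filter)
  ultimately have "((\<lambda>w. f (of_real w) / of_real w) \<longlongrightarrow> deriv f 0) (at (0::real))"
    by (rule filterlim_compose)
  then have l1: "((\<lambda>w. \<i> * of_real (theta_moment 0 w K / w)) \<longlongrightarrow> deriv f 0) (at (0::real))"
    unfolding fr by simp
  have "((\<lambda>w. theta_moment 0 w K / w) \<longlongrightarrow> 2 * theta_moment 1 0 K) (at 0)"
    using theta_moment_deriv_w[OF K, of 0 0] by (simp add: DERIV_def theta_moment_even_zero[OF K])
  then have l2: "((\<lambda>w. \<i> * of_real (theta_moment 0 w K / w)) \<longlongrightarrow> \<i> * of_real (2 * theta_moment 1 0 K)) (at (0::real))"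
    by (intro tendsto_mult_left tendsto_of_real)
  have df: "deriv f 0 = \<i> * of_real (2 * theta_moment 1 0 K)"
    by (rule tendsto_unique[OF _ l1 l2]) simp
  show "theta_moment 1 0 K \<noteq> 0" using N(1) df by auto
  assume w: "\<bar>w\<bar> < K"
  have "of_real w \<in> strip K" using w by (simp add: strip_def)
  from N(2)[OF this] have "\<i> * of_real (theta_moment 0 w K) = \<i> * of_real (2 * theta_moment 1 0 K) * sinh (of_real w) * exp (- lambert K (of_real w))"
    unfolding fr df .
  also have "lambert K (of_real w) = of_real (lambert_real K w)" using w by (intro lambert_of_real) auto
  also have "sinh (complex_of_real w) = of_real (sinh w)"
    by (simp add: sinh_def scaleR_conv_of_real exp_of_real exp_minus)
  also have "\<i> * of_real (2 * theta_moment 1 0 K) * of_real (sinh w) * exp (- complex_of_real (lambert_real K w)) = \<i> * of_real (2 * theta_moment 1 0 K * sinh w * exp (- lambert_real K w))"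
    by (simp flip: exp_of_real)
  finally show "theta_moment 0 w K = 2 * theta_moment 1 0 K * sinh w * exp (- lambert_real K w)"
    by (simp only: mult_cancel_left of_real_eq_iff) simp
qed

text \<open>Both sides are the same multiple of the same Lambert exponential. The right-hand side is
  defined and smooth for all K > 0, which extends U across the endpoint K = w.\<close>

lemma calU_eq_theta_moment:
  assumes w: "0 < w" "w < K"
  shows "calU (2 * w) K = exp (- w) * theta_moment 0 w K / theta_moment 1 0 K"
proof -
  have "K > 0" using w by simp
  note t = theta_moment_eq_lambert[OF this]
  have "theta_moment 0 w K = 2 * theta_moment 1 0 K * sinh w * exp (- lambert_real K w)" using w by (intro t) auto
  then have "exp (- w) * theta_moment 0 w K / theta_moment 1 0 K = 2 * exp (- w) * sinh w * exp (- lambert_real K w)"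
    using t(1) by simp
  also have "2 * exp (- w) * sinh w = 1 - exp (- 2 * w)"
    by (simp add: sinh_def algebra_simps flip: exp_add)
  finally show ?thesis using calU_eq_lambert[OF w] by simp
qed

section \<open>Concavity\<close>

definition lambert_real_term :: "real \<Rightarrow> real \<Rightarrow> nat \<Rightarrow> real" where
  "lambert_real_term w K n = (exp (2 * real (Suc n) * w) + exp (- 2 * real (Suc n) * w) - 2) / (real (Suc n) * (exp (2 * real (Suc n) * K) - 1))"

text \<open>Each of \<open>lambertE_term\<close> and \<open>lambertH_term\<close> is -1/2 times the
  K-derivative of its predecessor, starting from \<open>lambert_real_term\<close>. They are the
  terms of E and H; the index n stands for k = n + 1.\<close>

definition lambertE_term :: "real \<Rightarrow> real \<Rightarrow> nat \<Rightarrow> real" where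
  "lambertE_term w K n = (exp (2 * real (Suc n) * w) + exp (- 2 * real (Suc n) * w) - 2) * exp (2 * real (Suc n) * K) / (exp (2 * real (Suc n) * K) - 1)\<^sup>2"

definition lambertH_term :: "real \<Rightarrow> real \<Rightarrow> nat \<Rightarrow> real" where
  "lambertH_term w K n = real (Suc n) * lambertE_term w K n * ((exp (2 * real (Suc n) * K) + 1) / (exp (2 * real (Suc n) * K) - 1))"

lemma one_minus_product_quotient_mono:
  fixes A B A' B' :: real
  assumes "0 \<le> A'" "A' \<le> A" "A < 1" "0 \<le> B'" "B' \<le> B" "B < 1"
  shows "(1 - A) / (1 - A') * ((1 - B) / (1 - B')) \<le> (1 - A * B) / (1 - A' * B')"
proof -
  \<comment> \<open>\<open>(1 - A B) / ((1 - A) (1 - B)) = 1 / (1 - A) + 1 / (1 - B) - 1\<close> increases in \<open>A\<close> and \<open>B\<close>\<close>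
  have ab: "A * B < 1" "A' * B' < 1"
    using assms mult_strict_mono'[of A 1 B 1] mult_strict_mono'[of A' 1 B' 1] by auto
  have e: "1 - a * b = (1 - a) * (1 - b) * (1 / (1 - a) + 1 / (1 - b) - 1)" if "a < 1" "b < 1" for a b :: real
  proof -
    define X Y where "X = 1 - a" and "Y = 1 - b"
    have "1 - (1 - X) * (1 - Y) = X * Y * (1 / X + 1 / Y - 1)" 
    proof -
      have "X \<noteq> 0" "Y \<noteq> 0" using that by (auto simp: X_def Y_def)
      then show ?thesis by (simp add: field_simps)
    qed
    then show ?thesis by (simp add: X_def Y_def)
  qed
  have m: "1 / (1 - A') \<le> 1 / (1 - A)" "1 / (1 - B') \<le> 1 / (1 - B)" using assms by (auto intro!: frac_le)
  have "(1 - A) * (1 - B) * (1 - A' * B') = (1 - A) * (1 - B) * ((1 - A') * (1 - B')) * (1 / (1 - A') + 1 / (1 - B') - 1)"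
    using e[of A' B'] assms by simp
  also have "\<dots> \<le> (1 - A) * (1 - B) * ((1 - A') * (1 - B')) * (1 / (1 - A) + 1 / (1 - B) - 1)"
    using m assms by (intro mult_left_mono) auto
  also have "\<dots> = (1 - A * B) * ((1 - A') * (1 - B'))" using e[of A B] assms by simp
  finally show ?thesis using assms ab by (simp add: divide_simps mult_ac)
qed

text \<open>With y = exp (2 k w) the numerator y + 1/y - 2 is (y - 1)^2 / y. This exposes a square
  and leaves only powers of numbers in (0, 1), the form in which submultiplicativity and geometric
  bounds become visible.\<close>

lemma lambertE_term_eq:
  assumes "0 < w" "w < K"
  defines "Y \<equiv> exp (- 2 * w)" and "p \<equiv> exp (- 2 * K)" and "v \<equiv> exp (- 2 * (K - w))"
  shows "lambertE_term w K n = v ^ Suc n * ((1 - Y ^ Suc n) / (1 - p ^ Suc n))\<^sup>2"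
    and "lambert_real_term w K n = v ^ Suc n * (1 - Y ^ Suc n)\<^sup>2 / (real (Suc n) * (1 - p ^ Suc n))"
    and "(exp (2 * real (Suc n) * K) + 1) / (exp (2 * real (Suc n) * K) - 1) = (1 + p ^ Suc n) / (1 - p ^ Suc n)"
proof -
  define y where "y = exp (2 * real (Suc n) * w)"
  define x where "x = exp (2 * real (Suc n) * K)"
  have Y: "Y ^ Suc n = inverse y" and p: "p ^ Suc n = inverse x" and v: "v ^ Suc n = y / x"
    unfolding Y_def p_def v_def y_def x_def
    by (simp_all add: exp_of_nat_mult[symmetric] exp_minus[symmetric] exp_diff[symmetric] algebra_simps del: of_nat_Suc power_Suc)
  have y': "exp (- 2 * real (Suc n) * w) = inverse y" unfolding y_def by (simp only: exp_minus[symmetric] mult_minus_left)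
  have x1: "x > 1" "y > 0" using assms by (auto simp: x_def y_def)
  then have x0: "x \<noteq> 0" "y \<noteq> 0" "x - 1 \<noteq> 0" by auto
  have i: "1 - inverse x = (x - 1) / x" "1 - inverse y = (y - 1) / y" "1 + inverse x = (x + 1) / x" using x0 by (auto simp: field_simps)
  have c: "y + inverse y - 2 = (y - 1)\<^sup>2 / y" using x0 by (simp add: field_simps power2_eq_square)
  have "b\<^sup>2 / y * x / a\<^sup>2 = y / x * ((b / y) / (a / x))\<^sup>2" "b\<^sup>2 / y / (real (Suc n) * a) = y / x * (b / y)\<^sup>2 / (real (Suc n) * (a / x))"
    if "a \<noteq> 0" for a b
    using x0 that by (simp_all add: divide_simps del: of_nat_Suc) (simp_all add: power2_eq_square)
  note q = this[OF x0(3)]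
  show "lambertE_term w K n = v ^ Suc n * ((1 - Y ^ Suc n) / (1 - p ^ Suc n))\<^sup>2"
    unfolding lambertE_term_def Y p v y_def[symmetric] x_def[symmetric] y' i c by (rule q)
  show "lambert_real_term w K n = v ^ Suc n * (1 - Y ^ Suc n)\<^sup>2 / (real (Suc n) * (1 - p ^ Suc n))"
    unfolding lambert_real_term_def Y p v y_def[symmetric] x_def[symmetric] y' i c by (rule q)
  show "(exp (2 * real (Suc n) * K) + 1) / (exp (2 * real (Suc n) * K) - 1) = (1 + p ^ Suc n) / (1 - p ^ Suc n)"
    unfolding p x_def[symmetric] i using x0 by simp
qed

lemma lambert_parameters:
  fixes w K :: real
  assumes "0 < w" "w < K"
  defines "Y \<equiv> exp (- 2 * w)" and "p \<equiv> exp (- 2 * K)" and "v \<equiv> exp (- 2 * (K - w))"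
  shows "0 < p" "p < Y" "Y < 1" "0 < v" "v < 1"
  using assms by (auto simp: Y_def p_def v_def)

lemma lambert_powers:
  fixes w K :: real
  assumes "0 < w" "w < K"
  defines "Y \<equiv> exp (- 2 * w)" and "p \<equiv> exp (- 2 * K)"
  shows "0 < (1 - Y ^ Suc n) / (1 - p ^ Suc n)" "(1 - Y ^ Suc n) / (1 - p ^ Suc n) \<le> 1"
    "0 \<le> p ^ Suc n" "p ^ Suc n \<le> Y ^ Suc n" "Y ^ Suc n < 1"
proof -
  have "0 < p" "p < Y" "Y < 1" using assms by (auto simp: Y_def p_def)
  then have "p ^ Suc n \<le> Y ^ Suc n" "Y ^ Suc n < 1" "0 \<le> p ^ Suc n"
    by (auto intro!: power_mono power_Suc_less_one simp del: power_Suc)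
  then show "0 < (1 - Y ^ Suc n) / (1 - p ^ Suc n)" "(1 - Y ^ Suc n) / (1 - p ^ Suc n) \<le> 1"
    "0 \<le> p ^ Suc n" "p ^ Suc n \<le> Y ^ Suc n" "Y ^ Suc n < 1"
    by (auto simp: divide_simps)
qed

lemma lambertE_term_bounds:
  assumes "0 < w" "w < K"
  shows "0 < lambertE_term w K n" "lambertE_term w K n \<le> exp (- 2 * (K - w)) ^ Suc n"
proof -
  note L = lambert_parameters[OF assms] lambert_powers[OF assms, of n] and e = lambertE_term_eq[OF assms, of n]
  show "0 < lambertE_term w K n" unfolding e(1) using L by (intro mult_pos_pos zero_less_power) auto
  have "((1 - exp (- 2 * w) ^ Suc n) / (1 - exp (- 2 * K) ^ Suc n))\<^sup>2 \<le> 1\<^sup>2"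
    using L by (intro power_mono) (simp_all del: power_Suc)
  then have "exp (- 2 * (K - w)) ^ Suc n * ((1 - exp (- 2 * w) ^ Suc n) / (1 - exp (- 2 * K) ^ Suc n))\<^sup>2 \<le> exp (- 2 * (K - w)) ^ Suc n * 1"
    by (intro mult_left_mono) (simp_all del: power_Suc)
  then show "lambertE_term w K n \<le> exp (- 2 * (K - w)) ^ Suc n" unfolding e(1) by simp
qed

text \<open>The factor v^k is multiplicative, and the quotients (1 - Y^k) / (1 - p^k) are
  submultiplicative by \<open>one_minus_product_quotient_mono\<close>, where p < Y because w < K.
  Term n has exponent n + 1, hence the index Suc (i + j).\<close>

lemma lambertE_term_submult:
  assumes "0 < w" "w < K"
  shows "lambertE_term w K i * lambertE_term w K j \<le> lambertE_term w K (Suc (i + j))"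
proof -
  define Y p v where "Y = exp (- 2 * w)" and "p = exp (- 2 * K)" and "v = exp (- 2 * (K - w))"
  note L = lambert_parameters[OF assms, folded Y_def p_def v_def] lambert_powers[OF assms, of i, folded Y_def p_def] lambert_powers[OF assms, of j, folded Y_def p_def] and e = lambertE_term_eq(1)[OF assms, folded Y_def p_def v_def]
  have s: "Suc (Suc (i + j)) = Suc i + Suc j" by simp
  have "(1 - Y ^ Suc i) / (1 - p ^ Suc i) * ((1 - Y ^ Suc j) / (1 - p ^ Suc j)) \<le> (1 - Y ^ Suc (Suc (i + j))) / (1 - p ^ Suc (Suc (i + j)))"
    unfolding s power_add using L by (intro one_minus_product_quotient_mono) (simp_all del: power_Suc)
  then have "((1 - Y ^ Suc i) / (1 - p ^ Suc i) * ((1 - Y ^ Suc j) / (1 - p ^ Suc j)))\<^sup>2 \<le> ((1 - Y ^ Suc (Suc (i + j))) / (1 - p ^ Suc (Suc (i + j))))\<^sup>2"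
    by (rule power_mono) (intro mult_nonneg_nonneg less_imp_le L(6) L(11))
  then have "v ^ Suc (Suc (i + j)) * ((1 - Y ^ Suc i) / (1 - p ^ Suc i) * ((1 - Y ^ Suc j) / (1 - p ^ Suc j)))\<^sup>2
     \<le> v ^ Suc (Suc (i + j)) * ((1 - Y ^ Suc (Suc (i + j))) / (1 - p ^ Suc (Suc (i + j))))\<^sup>2"
    using L by (intro mult_left_mono) (simp_all del: power_Suc)
  moreover have "v ^ Suc (Suc (i + j)) = v ^ Suc i * v ^ Suc j" unfolding s power_add ..
  ultimately show ?thesis unfolding e power_mult_distrib by (simp only: mult_ac)
qed

lemma summable_weighted_geometric:
  assumes "0 \<le> (q::real)" "q < 1"
  shows "summable (\<lambda>n. q ^ Suc n)" "summable (\<lambda>n. real (Suc n) * q ^ Suc n)" "(\<Sum>n. q ^ Suc n) = q / (1 - q)"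
proof -
  show "summable (\<lambda>n. q ^ Suc n)" using assms by (simp add: summable_geometric summable_mult)
  have "summable (\<lambda>n. q * (real (Suc n) * q ^ n))"
    using geometric_deriv_sums[of q] assms by (intro summable_mult) (simp add: sums_iff del: of_nat_Suc)
  then show "summable (\<lambda>n. real (Suc n) * q ^ Suc n)" by (simp add: mult_ac del: of_nat_Suc)
  have "(\<Sum>n. q ^ Suc n) = q * (\<Sum>n. q ^ n)" using assms by (simp add: suminf_mult summable_geometric)
  then show "(\<Sum>n. q ^ Suc n) = q / (1 - q)" using assms by (simp add: suminf_geometric)
qed

lemma lambert_real_term_bound:
  assumes "0 < w" "w < K"
  shows "0 \<le> lambert_real_term w K n" "lambert_real_term w K n \<le> exp (- 2 * (K - w)) ^ Suc n"
proof -
  define Y p v where "Y = exp (- 2 * w)" and "p = exp (- 2 * K)" and "v = exp (- 2 * (K - w))"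
  note L = lambert_parameters[OF assms, folded Y_def p_def v_def] lambert_powers[OF assms, of n, folded Y_def p_def] and e = lambertE_term_eq(2)[OF assms, of n, folded Y_def p_def v_def]
  have eq: "lambert_real_term w K n = v ^ Suc n * ((1 - Y ^ Suc n) / real (Suc n)) * ((1 - Y ^ Suc n) / (1 - p ^ Suc n))"
    unfolding e by (simp add: power2_eq_square del: power_Suc of_nat_Suc)
  have y: "0 \<le> (1 - Y ^ Suc n) / real (Suc n)" "(1 - Y ^ Suc n) / real (Suc n) \<le> 1"
    using L(8-10) by (auto simp: divide_simps simp del: power_Suc)
  have v: "0 \<le> v ^ Suc n" using L(4) by simp
  show "0 \<le> lambert_real_term w K n" unfolding eq by (intro mult_nonneg_nonneg v y(1) less_imp_le[OF L(6)])
  have "v ^ Suc n * ((1 - Y ^ Suc n) / real (Suc n)) * ((1 - Y ^ Suc n) / (1 - p ^ Suc n)) \<le> v ^ Suc n * 1 * 1"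
    by (intro mult_mono mult_nonneg_nonneg v y order_refl less_imp_le[OF L(6)] L(7)) simp_all
  then show "lambert_real_term w K n \<le> exp (- 2 * (K - w)) ^ Suc n" unfolding eq v_def by simp
qed

text \<open>The last factor of the term is (1 + p^k) / (1 - p^k), which is at least 1 and, for K >=
  K1, at most 2 / (1 - exp (- 2 K1)). The lower bound enters the comparison with E^2, the upper one
  termwise differentiation.\<close>

lemma lambertH_term_bound:
  assumes "0 < w" "w < K1" "K1 \<le> K"
  shows "real (Suc n) * lambertE_term w K n \<le> lambertH_term w K n" "\<bar>lambertH_term w K n\<bar> \<le> 2 / (1 - exp (- 2 * K1)) * (real (Suc n) * exp (- 2 * (K1 - w)) ^ Suc n)"
proof -
  have wK: "w < K" using assms by simp
  define p where "p = exp (- 2 * K)"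
  note L = lambert_parameters[OF assms(1) wK, folded p_def] lambert_powers[OF assms(1) wK, of n, folded p_def] and e = lambertE_term_eq(3)[OF assms(1) wK, of n, folded p_def]
  note la = lambertE_term_bounds[OF assms(1) wK, of n]
  have q1: "1 \<le> (1 + p ^ Suc n) / (1 - p ^ Suc n)" using L(8-10) by (auto simp: divide_simps simp del: power_Suc)
  have "p ^ Suc n \<le> p ^ 1" using L(1-3) by (intro power_decreasing) linarith+
  also have "p ^ 1 \<le> exp (- 2 * K1)" using assms by (simp add: p_def)
  finally have pp: "p ^ Suc n \<le> exp (- 2 * K1)" .
  have K1: "exp (- 2 * K1) < 1" using assms by simp
  have q2: "(1 + p ^ Suc n) / (1 - p ^ Suc n) \<le> 2 / (1 - exp (- 2 * K1))"
    using pp K1 L(8-10) by (intro frac_le) (auto simp del: power_Suc)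
  have v: "exp (- 2 * (K - w)) ^ Suc n \<le> exp (- 2 * (K1 - w)) ^ Suc n" using assms by (intro power_mono) auto
  have "real (Suc n) * lambertE_term w K n * 1 \<le> real (Suc n) * lambertE_term w K n * ((1 + p ^ Suc n) / (1 - p ^ Suc n))"
    using la q1 by (intro mult_left_mono) (auto simp del: power_Suc)
  then show 1: "real (Suc n) * lambertE_term w K n \<le> lambertH_term w K n" unfolding lambertH_term_def e by simp
  have "0 \<le> real (Suc n) * lambertE_term w K n" using la by simp
  then have "\<bar>lambertH_term w K n\<bar> = lambertH_term w K n" using 1 by linarith
  also have "\<dots> \<le> (real (Suc n) * exp (- 2 * (K1 - w)) ^ Suc n) * (2 / (1 - exp (- 2 * K1)))"
    unfolding lambertH_term_def e
  proof (intro mult_mono q2 order_refl)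
    show "lambertE_term w K n \<le> exp (- 2 * (K1 - w)) ^ Suc n" using la(2) v by (rule order_trans)
    show "0 \<le> (1 + p ^ Suc n) / (1 - p ^ Suc n)" using q1 by linarith
    show "0 \<le> lambertE_term w K n" using la(1) by simp
  qed (simp_all del: power_Suc)
  finally show "\<bar>lambertH_term w K n\<bar> \<le> 2 / (1 - exp (- 2 * K1)) * (real (Suc n) * exp (- 2 * (K1 - w)) ^ Suc n)" by (simp only: mult_ac)
qed

lemma lambert_real_term_deriv:
  assumes "K > 0"
  shows "((\<lambda>K. lambert_real_term w K n) has_real_derivative - 2 * lambertE_term w K n) (at K)"
proof -
  have "exp (2 * real (Suc n) * K) - 1 \<noteq> 0" using assms by simp
  then show ?thesis unfolding lambert_real_term_def lambertE_term_def
    by (auto intro!: derivative_eq_intros simp del: of_nat_Suc) (simp add: field_simps power2_eq_square del: of_nat_Suc)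
qed

lemma lambertE_term_deriv:
  assumes "K > 0"
  shows "((\<lambda>K. lambertE_term w K n) has_real_derivative - 2 * lambertH_term w K n) (at K)"
proof -
  define c where "c = exp (2 * real (Suc n) * w) + exp (- 2 * real (Suc n) * w) - 2"
  define k where "k = real (Suc n)"
  define x where "x = exp (2 * k * K)"
  have x0: "x - 1 \<noteq> 0" using assms by (simp add: k_def x_def)
  have "((\<lambda>K. c * exp (2 * k * K) / (exp (2 * k * K) - 1)\<^sup>2) has_real_derivative
     (c * (x * (2 * k)) * (x - 1)\<^sup>2 - c * x * (2 * (x - 1) * (x * (2 * k)))) / ((x - 1)\<^sup>2 * (x - 1)\<^sup>2)) (at K)"
    using x0 unfolding x_def by (auto intro!: derivative_eq_intros)
  also have "(c * (x * (2 * k)) * (x - 1)\<^sup>2 - c * x * (2 * (x - 1) * (x * (2 * k)))) / ((x - 1)\<^sup>2 * (x - 1)\<^sup>2)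
     = - 2 * (k * (c * x / (x - 1)\<^sup>2) * ((x + 1) / (x - 1)))"
  proof -
    define z where "z = x - 1"
    have z: "x = z + 1" "z \<noteq> 0" using x0 by (auto simp: z_def)
    show ?thesis unfolding z_def[symmetric] unfolding z(1) using z(2)
      by (simp add: divide_simps) (simp add: power2_eq_square power4_eq_xxxx algebra_simps)
  qed
  finally show ?thesis unfolding lambertH_term_def lambertE_term_def c_def k_def x_def .
qed

definition lambertE :: "real \<Rightarrow> real \<Rightarrow> real" where "lambertE w K = (\<Sum>n. lambertE_term w K n)"
definition lambertH :: "real \<Rightarrow> real \<Rightarrow> real" where "lambertH w K = (\<Sum>n. lambertH_term w K n)"

lemma lambertE_term_summable: "0 < w \<Longrightarrow> w < K \<Longrightarrow> summable (lambertE_term w K)"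
  by (rule summable_comparison_test'[OF summable_weighted_geometric(1)[of "exp (- 2 * (K - w))"], of 0])
    (use lambertE_term_bounds[of w K] in \<open>auto simp: abs_of_pos simp del: power_Suc\<close>)

lemma lambertH_term_summable: "0 < w \<Longrightarrow> w < K \<Longrightarrow> summable (lambertH_term w K)"
  by (rule summable_comparison_test'[OF summable_mult[OF summable_weighted_geometric(2)[of "exp (- 2 * (K - w))"], of "2 / (1 - exp (- 2 * K))"], of 0])
    (use lambertH_term_bound[of w K K] in \<open>auto simp del: power_Suc of_nat_Suc\<close>)

lemma lambert_real_deriv:
  assumes "0 < w" "w < K"
  shows "((\<lambda>K. lambert_real K w) has_real_derivative - 2 * lambertE w K) (at K)"
proof -
  define K1 where "K1 = (w + K) / 2"
  have K1: "w < K1" "K1 < K" using assms by (auto simp: K1_def)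
  have "((\<lambda>K. \<Sum>n. lambert_real_term w K n) has_real_derivative (\<Sum>n. - 2 * lambertE_term w K n)) (at K)"
  proof (rule has_field_derivative_series'(2)[where S = "{K1<..}" and x0 = K])
    show "((\<lambda>K. lambert_real_term w K n) has_real_derivative - 2 * lambertE_term w x n) (at x within {K1<..})" if "x \<in> {K1<..}" for n x
      using lambert_real_term_deriv[of x w n] that K1 assms by (auto intro: has_field_derivative_at_within)
    show "uniformly_convergent_on {K1<..} (\<lambda>n x. \<Sum>i<n. - 2 * lambertE_term w x i)"
    proof (rule Weierstrass_m_test'[OF _ summable_mult[OF summable_weighted_geometric(1)[of "exp (- 2 * (K1 - w))"], of 2]])
      fix n x assume x: "x \<in> {K1<..}"
      then have "w < x" using K1 by simp
      from lambertE_term_bounds[OF assms(1) this, of n] have "norm (- 2 * lambertE_term w x n) \<le> 2 * exp (- 2 * (x - w)) ^ Suc n" by (simp add: abs_mult del: power_Suc)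
      also have "\<dots> \<le> 2 * exp (- 2 * (K1 - w)) ^ Suc n" using x by (intro mult_left_mono power_mono) auto
      finally show "norm (- 2 * lambertE_term w x n) \<le> 2 * exp (- 2 * (K1 - w)) ^ Suc n" .
    qed (use K1 in auto)
    show "summable (lambert_real_term w K)"
      by (rule summable_comparison_test'[OF summable_weighted_geometric(1)[of "exp (- 2 * (K - w))"], of 0])
        (use lambert_real_term_bound[OF assms] assms in \<open>auto simp del: power_Suc\<close>)
  qed (use K1 in \<open>auto simp: interior_open\<close>)
  moreover have "(\<Sum>n. - 2 * lambertE_term w K n) = - 2 * lambertE w K" unfolding lambertE_def by (rule suminf_mult[OF lambertE_term_summable[OF assms]])
  ultimately show ?thesis unfolding lambert_real_def lambert_real_term_def by simp
qed

lemma lambertE_deriv: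
  assumes "0 < w" "w < K"
  shows "((\<lambda>K. lambertE w K) has_real_derivative - 2 * lambertH w K) (at K)"
proof -
  define K1 where "K1 = (w + K) / 2"
  have K1: "w < K1" "K1 < K" using assms by (auto simp: K1_def)
  have "((\<lambda>K. \<Sum>n. lambertE_term w K n) has_real_derivative (\<Sum>n. - 2 * lambertH_term w K n)) (at K)"
  proof (rule has_field_derivative_series'(2)[where S = "{K1<..}" and x0 = K])
    show "((\<lambda>K. lambertE_term w K n) has_real_derivative - 2 * lambertH_term w x n) (at x within {K1<..})" if "x \<in> {K1<..}" for n x
      using lambertE_term_deriv[of x w n] that K1 assms by (auto intro: has_field_derivative_at_within)
    show "uniformly_convergent_on {K1<..} (\<lambda>n x. \<Sum>i<n. - 2 * lambertH_term w x i)"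
    proof (rule Weierstrass_m_test'[OF _ summable_mult[OF summable_mult[OF summable_weighted_geometric(2)[of "exp (- 2 * (K1 - w))"], of "2 / (1 - exp (- 2 * K1))"], of 2]])
      fix n x assume x: "x \<in> {K1<..}"
      then show "norm (- 2 * lambertH_term w x n) \<le> 2 * (2 / (1 - exp (- 2 * K1)) * (real (Suc n) * exp (- 2 * (K1 - w)) ^ Suc n))"
        using lambertH_term_bound(2)[OF assms(1) K1(1), of x n] by (simp add: abs_mult del: power_Suc of_nat_Suc)
    qed (use K1 in auto)
    show "summable (lambertE_term w K)" by (rule lambertE_term_summable[OF assms])
  qed (use K1 in \<open>auto simp: interior_open\<close>)
  moreover have "(\<Sum>n. - 2 * lambertH_term w K n) = - 2 * lambertH w K" unfolding lambertH_def by (rule suminf_mult[OF lambertH_term_summable[OF assms]])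
  ultimately show ?thesis unfolding lambertE_def by simp
qed

lemma lambertE_pos: "0 < w \<Longrightarrow> w < K \<Longrightarrow> 0 < lambertE w K"
  unfolding lambertE_def by (rule suminf_pos[OF lambertE_term_summable lambertE_term_bounds(1)])

lemma lambertE_le:
  assumes "0 < w" "w < K"
  shows "lambertE w K \<le> exp (- 2 * (K - w)) / (1 - exp (- 2 * (K - w)))"
proof -
  have "lambertE w K \<le> (\<Sum>n. exp (- 2 * (K - w)) ^ Suc n)"
    unfolding lambertE_def using assms by (intro suminf_le lambertE_term_bounds lambertE_term_summable summable_weighted_geometric) auto
  then show ?thesis using summable_weighted_geometric(3)[of "exp (- 2 * (K - w))"] assms by simp
qed

text \<open>The n-th Cauchy coefficient of E^2 has n + 1 summands, each at most the term of index n
  + 1. The resulting sum of n times the n-th term falls short of the sum with weights n + 1 by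
  exactly E, and the latter sum is at most H. So E^2 + E <= H, and E > 0 makes the inequality
  strict.\<close>

lemma lambertE_square_less:
  assumes "0 < w" "w < K"
  shows "(lambertE w K)\<^sup>2 < lambertH w K"
proof -
  note sa = lambertE_term_summable[OF assms]
  have na: "summable (\<lambda>n. norm (lambertE_term w K n))" using sa lambertE_term_bounds(1)[OF assms] by (simp add: less_imp_le)
  have sn: "summable (\<lambda>n. real n * lambertE_term w K n)"
  proof (rule summable_comparison_test'[OF lambertH_term_summable[OF assms], of 0])
    fix n
    have "norm (real n * lambertE_term w K n) = real n * lambertE_term w K n" using lambertE_term_bounds(1)[OF assms, of n] by simp
    also have "\<dots> \<le> real (Suc n) * lambertE_term w K n" using lambertE_term_bounds(1)[OF assms, of n] by (intro mult_right_mono) auto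
    also have "\<dots> \<le> lambertH_term w K n" by (rule lambertH_term_bound(1)[OF assms order_refl])
    finally show "norm (real n * lambertE_term w K n) \<le> lambertH_term w K n" .
  qed
  have sn1: "summable (\<lambda>n. real (Suc n) * lambertE_term w K (Suc n))" using sn summable_Suc_iff[of "\<lambda>n. real n * lambertE_term w K n"] by simp
  have c: "(\<lambda>k. \<Sum>i\<le>k. lambertE_term w K i * lambertE_term w K (k - i)) sums (lambertE w K * lambertE w K)"
    unfolding lambertE_def by (rule Cauchy_product_sums[OF na na])
  have "lambertE w K * lambertE w K \<le> (\<Sum>n. real (Suc n) * lambertE_term w K (Suc n))"
    unfolding sums_unique[OF c]
  proof (rule suminf_le[OF _ sums_summable[OF c] sn1])
    fix n
    have "(\<Sum>i\<le>n. lambertE_term w K i * lambertE_term w K (n - i)) \<le> (\<Sum>i\<le>n. lambertE_term w K (Suc n))"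
    proof (rule sum_mono)
      fix i assume "i \<in> {..n}"
      then show "lambertE_term w K i * lambertE_term w K (n - i) \<le> lambertE_term w K (Suc n)" using lambertE_term_submult[OF assms, of i "n - i"] by simp
    qed
    then show "(\<Sum>i\<le>n. lambertE_term w K i * lambertE_term w K (n - i)) \<le> real (Suc n) * lambertE_term w K (Suc n)" by simp
  qed
  also have "\<dots> = (\<Sum>n. real n * lambertE_term w K n)" using suminf_split_head[OF sn] by simp
  finally have "lambertE w K * lambertE w K + lambertE w K \<le> (\<Sum>n. real n * lambertE_term w K n + lambertE_term w K n)"
    unfolding suminf_add[OF sn sa, symmetric] by (simp add: lambertE_def)
  also have "\<dots> \<le> lambertH w K"
    unfolding lambertH_def
  proof (rule suminf_le[OF _ summable_add[OF sn sa] lambertH_term_summable[OF assms]])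
    fix n show "real n * lambertE_term w K n + lambertE_term w K n \<le> lambertH_term w K n"
      using lambertH_term_bound(1)[OF assms order_refl, of n] by (simp add: algebra_simps)
  qed
  finally show ?thesis using lambertE_pos[OF assms] by (simp add: power2_eq_square)
qed

section \<open>The function U and its derivatives\<close>

text \<open>Normalising by t_1 keeps the family closed under d/dK: as t_1' = - t_3, the quotient
  rule only adds a multiple by t_3 / t_1, which is \<open>moment_ratio_zero 3\<close>.\<close>

definition moment_ratio :: "nat \<Rightarrow> real \<Rightarrow> real \<Rightarrow> real" where "moment_ratio j w K = theta_moment j w K / theta_moment 1 0 K"
definition moment_ratio_zero :: "nat \<Rightarrow> real \<Rightarrow> real" where "moment_ratio_zero j K = theta_moment j 0 K / theta_moment 1 0 K"

lemma moment_ratio_deriv: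
  assumes "K > 0"
  shows "((\<lambda>K. moment_ratio j w K) has_real_derivative - moment_ratio (j + 2) w K + moment_ratio_zero 3 K * moment_ratio j w K) (at K)"
proof -
  note t = theta_moment_eq_lambert(1)[OF assms]
  have 3: "(1::nat) + 2 = 3" by simp
  have "((\<lambda>K. theta_moment j w K / theta_moment 1 0 K) has_real_derivative
      (- theta_moment (j + 2) w K * theta_moment 1 0 K - theta_moment j w K * - theta_moment (1 + 2) 0 K) / (theta_moment 1 0 K * theta_moment 1 0 K)) (at K)"
    by (intro DERIV_divide theta_moment_deriv_K assms t)
  then show ?thesis using t unfolding moment_ratio_def moment_ratio_zero_def 3 by (simp add: field_simps)
qed

lemma moment_ratio_zero_deriv:
  assumes "K > 0"
  shows "((\<lambda>K. moment_ratio_zero j K) has_real_derivative - moment_ratio_zero (j + 2) K + moment_ratio_zero 3 K * moment_ratio_zero j K) (at K)"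
  using moment_ratio_deriv[OF assms, of j 0] unfolding moment_ratio_def moment_ratio_zero_def .

text \<open>\<open>calU0\<close> to \<open>calU3\<close> are U and its first three K-derivatives,
  continued to all K > 0. \<open>calU3\<close> is kept as the product rule delivers it; what matters
  later is its continuity.\<close>

definition calU0 :: "real \<Rightarrow> real \<Rightarrow> real" where "calU0 w K = exp (- w) * moment_ratio 0 w K"
definition calU1 :: "real \<Rightarrow> real \<Rightarrow> real" where "calU1 w K = exp (- w) * (moment_ratio_zero 3 K * moment_ratio 0 w K - moment_ratio 2 w K)"
definition calU2 :: "real \<Rightarrow> real \<Rightarrow> real" where
  "calU2 w K = exp (- w) * (moment_ratio 4 w K - 2 * moment_ratio_zero 3 K * moment_ratio 2 w K + (2 * (moment_ratio_zero 3 K)\<^sup>2 - moment_ratio_zero 5 K) * moment_ratio 0 w K)"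
definition calU3 :: "real \<Rightarrow> real \<Rightarrow> real" where
  "calU3 w K = exp (- w) * (- moment_ratio 6 w K + moment_ratio_zero 3 K * moment_ratio 4 w K
     - (2 * (- moment_ratio_zero 5 K + moment_ratio_zero 3 K * moment_ratio_zero 3 K) * moment_ratio 2 w K + 2 * moment_ratio_zero 3 K * (- moment_ratio 4 w K + moment_ratio_zero 3 K * moment_ratio 2 w K))
     + ((4 * moment_ratio_zero 3 K * (- moment_ratio_zero 5 K + moment_ratio_zero 3 K * moment_ratio_zero 3 K) - (- moment_ratio_zero 7 K + moment_ratio_zero 3 K * moment_ratio_zero 5 K)) * moment_ratio 0 w K
       + (2 * (moment_ratio_zero 3 K)\<^sup>2 - moment_ratio_zero 5 K) * (- moment_ratio 2 w K + moment_ratio_zero 3 K * moment_ratio 0 w K)))"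
text \<open>The primitive of \<open>- 2 U'\<^sup>2\<close> in \<open>K\<close> that gives the integral of \<open>calL\<close> in closed form.\<close>

definition calJ :: "real \<Rightarrow> real \<Rightarrow> real" where
  "calJ w K = exp (- 2 * w) * (2 * (moment_ratio 1 w K)\<^sup>2 - moment_ratio 0 w K * moment_ratio 2 w K - moment_ratio_zero 3 K * (moment_ratio 0 w K)\<^sup>2)"

lemma moment_ratio_derivs:
  assumes "K > 0"
  shows "((\<lambda>K. moment_ratio 0 w K) has_real_derivative - moment_ratio 2 w K + moment_ratio_zero 3 K * moment_ratio 0 w K) (at K)"
    "((\<lambda>K. moment_ratio 1 w K) has_real_derivative - moment_ratio 3 w K + moment_ratio_zero 3 K * moment_ratio 1 w K) (at K)"
    "((\<lambda>K. moment_ratio 2 w K) has_real_derivative - moment_ratio 4 w K + moment_ratio_zero 3 K * moment_ratio 2 w K) (at K)"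
    "((\<lambda>K. moment_ratio 4 w K) has_real_derivative - moment_ratio 6 w K + moment_ratio_zero 3 K * moment_ratio 4 w K) (at K)"
    "((\<lambda>K. moment_ratio_zero 3 K) has_real_derivative - moment_ratio_zero 5 K + moment_ratio_zero 3 K * moment_ratio_zero 3 K) (at K)"
    "((\<lambda>K. moment_ratio_zero 5 K) has_real_derivative - moment_ratio_zero 7 K + moment_ratio_zero 3 K * moment_ratio_zero 5 K) (at K)"
  using moment_ratio_deriv[OF assms, of 0 w] moment_ratio_deriv[OF assms, of 1 w] moment_ratio_deriv[OF assms, of 2 w] moment_ratio_deriv[OF assms, of 4 w]
    moment_ratio_zero_deriv[OF assms, of 3] moment_ratio_zero_deriv[OF assms, of 5] by (simp_all add: numeral_eq_Suc)

lemma calU_derivs: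
  assumes "K > 0"
  shows "((\<lambda>K. calU0 w K) has_real_derivative calU1 w K) (at K)"
    "((\<lambda>K. calU1 w K) has_real_derivative calU2 w K) (at K)"
    "((\<lambda>K. calU2 w K) has_real_derivative calU3 w K) (at K)"
  unfolding calU0_def calU1_def calU2_def calU3_def
  by (rule derivative_eq_intros refl moment_ratio_derivs assms | simp add: power2_eq_square algebra_simps)+

text \<open>The derivative differs from - 2 U'^2 by - exp (- 2 w) times \<open>?L\<close>, and
  \<open>?L\<close> is the quartic expression of \<open>theta_moment_identity\<close> divided by
  t_1^4, hence zero.\<close>

lemma calJ_deriv:
  assumes "K > 0"
  shows "((\<lambda>K. calJ w K) has_real_derivative - 2 * (calU1 w K)\<^sup>2) (at K)"
proof -
  let ?T = "\<lambda>j. theta_moment j w K" and ?t = "\<lambda>j. theta_moment j 0 K"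
  note t = theta_moment_eq_lambert(1)[OF assms]
  have id: "(4 * (moment_ratio 1 w K * moment_ratio 3 w K) - 3 * (moment_ratio 2 w K)\<^sup>2 - moment_ratio 0 w K * moment_ratio 4 w K) + 4 * moment_ratio_zero 3 K * (moment_ratio 0 w K * moment_ratio 2 w K - (moment_ratio 1 w K)\<^sup>2)
      - (moment_ratio_zero 5 K - (moment_ratio_zero 3 K)\<^sup>2) * (moment_ratio 0 w K)\<^sup>2 = 0" (is "?L = 0")
  proof -
    have T: "?T j = moment_ratio j w K * ?t 1" and s: "?t j = moment_ratio_zero j K * ?t 1" for j using t by (auto simp: moment_ratio_def moment_ratio_zero_def)
    have "?L * (?t 1)^4 = (?t 1)\<^sup>2 * (4 * (?T 1 * ?T 3) - 3 * (?T 2)\<^sup>2 - ?T 0 * ?T 4) + 4 * (?t 1 * ?t 3) * (?T 0 * ?T 2 - (?T 1)\<^sup>2)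
       - (?t 1 * ?t 5 - (?t 3)\<^sup>2) * (?T 0)\<^sup>2"
      unfolding T s[of 3] s[of 5] by (simp add: power2_eq_square power4_eq_xxxx algebra_simps)
    also have "\<dots> = 0" by (rule theta_moment_identity[OF assms])
    finally show ?thesis using t by simp
  qed
  have "((\<lambda>K. calJ w K) has_real_derivative exp (- 2 * w) * (4 * moment_ratio 1 w K * (- moment_ratio 3 w K + moment_ratio_zero 3 K * moment_ratio 1 w K)
      - ((- moment_ratio 2 w K + moment_ratio_zero 3 K * moment_ratio 0 w K) * moment_ratio 2 w K + moment_ratio 0 w K * (- moment_ratio 4 w K + moment_ratio_zero 3 K * moment_ratio 2 w K))
      - ((- moment_ratio_zero 5 K + moment_ratio_zero 3 K * moment_ratio_zero 3 K) * (moment_ratio 0 w K)\<^sup>2 + moment_ratio_zero 3 K * (2 * moment_ratio 0 w K * (- moment_ratio 2 w K + moment_ratio_zero 3 K * moment_ratio 0 w K))))) (at K)"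
    unfolding calJ_def
    by (rule derivative_eq_intros refl moment_ratio_derivs assms | simp add: power2_eq_square algebra_simps)+
  also have "exp (- 2 * w) * (4 * moment_ratio 1 w K * (- moment_ratio 3 w K + moment_ratio_zero 3 K * moment_ratio 1 w K)
      - ((- moment_ratio 2 w K + moment_ratio_zero 3 K * moment_ratio 0 w K) * moment_ratio 2 w K + moment_ratio 0 w K * (- moment_ratio 4 w K + moment_ratio_zero 3 K * moment_ratio 2 w K))
      - ((- moment_ratio_zero 5 K + moment_ratio_zero 3 K * moment_ratio_zero 3 K) * (moment_ratio 0 w K)\<^sup>2 + moment_ratio_zero 3 K * (2 * moment_ratio 0 w K * (- moment_ratio 2 w K + moment_ratio_zero 3 K * moment_ratio 0 w K))))
     = exp (- 2 * w) * (- 2 * (moment_ratio_zero 3 K * moment_ratio 0 w K - moment_ratio 2 w K)\<^sup>2 - ?L)"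
    by (simp add: power2_eq_square algebra_simps)
  also have "exp (- 2 * w) = (exp (- w))\<^sup>2" by (simp add: power2_eq_square flip: exp_add)
  finally show ?thesis unfolding id calU1_def by (simp add: power_mult_distrib mult_ac)
qed

text \<open>At K = w the moments reduce to those at w = 0. The terms with t_3 / t_1 cancel in U'',
  so all four values are plain numbers.\<close>

lemma calU_endpoint:
  assumes "w > 0"
  shows "calU0 w w = 0" "calU1 w w = 2" "calU2 w w = - 4" "calJ w w = 2"
proof -
  note t = theta_moment_eq_lambert(1)[OF assms] and m = theta_moment_reflect[OF assms]
  have r: "moment_ratio 0 w w = 0" "moment_ratio 1 w w = - exp w" "moment_ratio 2 w w = - exp w * 2" "moment_ratio 4 w w = - exp w * (4 * moment_ratio_zero 3 w + 4)"
    unfolding moment_ratio_def moment_ratio_zero_def m using t by (simp_all add: field_simps)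
  have e: "exp (- w) * exp w = 1" "exp (- 2 * w) * (exp w)\<^sup>2 = 1" by (simp_all add: power2_eq_square flip: exp_add)
  show "calU0 w w = 0" "calU1 w w = 2" unfolding calU0_def calU1_def r using e by simp_all
  have "calU2 w w = - 4 * (exp (- w) * exp w)" unfolding calU2_def r by (simp add: algebra_simps)
  then show "calU2 w w = - 4" using e by simp
  have "calJ w w = 2 * (exp (- 2 * w) * (exp w)\<^sup>2)" unfolding calJ_def r by simp
  then show "calJ w w = 2" using e by simp
qed

lemma moment_ratio_at_top: "((\<lambda>K. moment_ratio j w K) \<longlongrightarrow> (1/2) ^ j * exp w - (- 1/2) ^ j * exp (- w)) at_top"
proof -
  have "((\<lambda>K. (exp (K / 4) * theta_moment j w K) / (exp (K / 4) * theta_moment 1 0 K)) \<longlongrightarrow>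
     ((1/2) ^ j * exp w - (- 1/2) ^ j * exp (- w)) / ((1/2) ^ 1 * exp 0 - (- 1/2) ^ 1 * exp (- 0))) at_top"
    by (intro tendsto_divide theta_moment_at_top) simp
  then show ?thesis by (simp add: moment_ratio_def)
qed

lemma moment_ratio_zero_at_top: "((\<lambda>K. moment_ratio_zero j K) \<longlongrightarrow> (1/2) ^ j - (- 1/2) ^ j) at_top"
  using moment_ratio_at_top[of j 0] by (simp add: moment_ratio_def moment_ratio_zero_def)

lemma calU0_at_top: "((\<lambda>K. calU0 w K) \<longlongrightarrow> 1 - exp (- 2 * w)) at_top"
proof -
  have "((\<lambda>K. calU0 w K) \<longlongrightarrow> exp (- w) * ((1/2) ^ 0 * exp w - (- 1/2) ^ 0 * exp (- w))) at_top"
    unfolding calU0_def by (intro tendsto_intros moment_ratio_at_top)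
  also have "exp (- w) * ((1/2) ^ 0 * exp w - (- 1/2) ^ 0 * exp (- w)) = 1 - exp (- 2 * w)"
    by (simp add: right_diff_distrib flip: exp_add)
  finally show ?thesis .
qed

text \<open>Together with the value 2 at K = w this evaluates the integral of U'^2 over (w,
  \<infinity>): half of 2 - 2 exp (- 2 w), which is 1 - exp (- \<eta>).\<close>

lemma calJ_at_top: "((\<lambda>K. calJ w K) \<longlongrightarrow> 2 * exp (- 2 * w)) at_top"
proof -
  let ?c = "\<lambda>j. (1/2) ^ j * exp w - (- 1/2) ^ j * exp (- w)"
  have "((\<lambda>K. calJ w K) \<longlongrightarrow> exp (- 2 * w) * (2 * (?c 1)\<^sup>2 - ?c 0 * ?c 2 - ((1/2) ^ 3 - (- 1/2) ^ 3) * (?c 0)\<^sup>2)) at_top"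
    unfolding calJ_def by (intro tendsto_intros moment_ratio_at_top moment_ratio_zero_at_top)
  also have "2 * (?c 1)\<^sup>2 - ?c 0 * ?c 2 - ((1/2) ^ 3 - (- 1/2) ^ 3) * (?c 0)\<^sup>2 = 2 * (exp w * exp (- w))"
    by (simp add: power2_eq_square power3_eq_cube field_simps)
  finally show ?thesis by (simp add: mult_ac flip: exp_add)
qed

text \<open>From here on \<open>w = \<eta> / 2\<close>.\<close>

locale half_eta =
  fixes w :: real
  assumes w: "w > 0"
begin

section \<open>Signs and decay of U and its derivatives\<close>

lemma calU_eq_calU0: "w < K \<Longrightarrow> calU (2 * w) K = calU0 w K"
  using calU_eq_theta_moment[of w K] w by (simp add: calU0_def moment_ratio_def)

lemma calU0_eq_lambert: "w < K \<Longrightarrow> calU0 w K = (1 - exp (- 2 * w)) * exp (- lambert_real K w)"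
  using calU_eq_lambert[of w K] calU_eq_calU0[of K] w by simp

lemma eventually_nhds_greater: "w < K \<Longrightarrow> eventually (\<lambda>K. w < K) (nhds K)"
  by (rule eventually_nhds_in_open[of "{w<..}", simplified]) auto

lemma calU_deriv: "w < K \<Longrightarrow> deriv (calU (2 * w)) K = calU1 w K"
proof -
  assume K: "w < K"
  have "\<forall>\<^sub>F K in nhds K. calU (2 * w) K = calU0 w K"
    using eventually_nhds_greater[OF K] by (rule eventually_mono) (rule calU_eq_calU0)
  then have "(calU (2 * w) has_real_derivative calU1 w K) (at K)"
    using calU_derivs(1)[of K w] K w by (subst DERIV_cong_ev[OF refl _ refl]) auto
  then show ?thesis by (rule DERIV_imp_deriv)
qed

text \<open>For K > w the moment form and the Lambert form are the same function, so uniqueness of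
  derivatives identifies their derivatives: an expression known at K = w becomes one whose sign is
  visible.\<close>

lemma calU1_eq: "w < K \<Longrightarrow> calU1 w K = 2 * lambertE w K * calU0 w K"
proof -
  assume K: "w < K"
  have "((\<lambda>K. (1 - exp (- 2 * w)) * exp (- lambert_real K w)) has_real_derivative (1 - exp (- 2 * w)) * (exp (- lambert_real K w) * - (- 2 * lambertE w K))) (at K)"
    by (intro DERIV_cmult DERIV_fun_exp DERIV_minus lambert_real_deriv w K)
  moreover have "\<forall>\<^sub>F K in nhds K. calU0 w K = (1 - exp (- 2 * w)) * exp (- lambert_real K w)"
    using eventually_nhds_greater[OF K] by (rule eventually_mono) (rule calU0_eq_lambert)
  ultimately have "((\<lambda>K. calU0 w K) has_real_derivative (1 - exp (- 2 * w)) * (exp (- lambert_real K w) * - (- 2 * lambertE w K))) (at K)"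
    by (subst DERIV_cong_ev[OF refl _ refl])
  from DERIV_unique[OF this calU_derivs(1)] show ?thesis using K w by (simp add: calU0_eq_lambert mult_ac)
qed

lemma calU2_eq: "w < K \<Longrightarrow> calU2 w K = 4 * ((lambertE w K)\<^sup>2 - lambertH w K) * calU0 w K"
proof -
  assume K: "w < K"
  have "((\<lambda>K. 2 * lambertE w K * calU0 w K) has_real_derivative 2 * (- 2 * lambertH w K) * calU0 w K + calU1 w K * (2 * lambertE w K)) (at K)"
    by (intro DERIV_mult DERIV_cmult lambertE_deriv calU_derivs w K) (use K w in simp)
  moreover have "\<forall>\<^sub>F K in nhds K. calU1 w K = 2 * lambertE w K * calU0 w K"
    using eventually_nhds_greater[OF K] by (rule eventually_mono) (rule calU1_eq)
  ultimately have "((\<lambda>K. calU1 w K) has_real_derivative 2 * (- 2 * lambertH w K) * calU0 w K + calU1 w K * (2 * lambertE w K)) (at K)"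
    by (subst DERIV_cong_ev[OF refl _ refl])
  from DERIV_unique[OF this calU_derivs(2)] show ?thesis using K w by (simp add: calU1_eq power2_eq_square algebra_simps)
qed

lemma lambert_real_nonneg: "w < K \<Longrightarrow> 0 \<le> lambert_real K w"
proof -
  assume K: "w < K"
  have "summable (lambert_real_term w K)"
    by (rule summable_comparison_test'[OF summable_weighted_geometric(1)[of "exp (- 2 * (K - w))"], of 0])
      (use lambert_real_term_bound[OF w K] K in \<open>auto simp del: power_Suc\<close>)
  then have "0 \<le> (\<Sum>n. lambert_real_term w K n)" using lambert_real_term_bound(1)[OF w K] by (intro suminf_nonneg)
  then show ?thesis by (simp add: lambert_real_def lambert_real_term_def)
qed

lemma calU0_bounds: "w < K \<Longrightarrow> 0 < calU0 w K" "w < K \<Longrightarrow> calU0 w K \<le> 1"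
proof -
  assume K: "w < K"
  have "exp (- lambert_real K w) \<le> 1" "1 - exp (- 2 * w) \<le> 1" "0 < 1 - exp (- 2 * w)" using lambert_real_nonneg[OF K] w by auto
  then show "0 < calU0 w K" "calU0 w K \<le> 1" unfolding calU0_eq_lambert[OF K] by (auto intro!: mult_le_one)
qed

lemma calU2_neg: "w < K \<Longrightarrow> calU2 w K < 0"
  using calU0_bounds(1)[of K] lambertE_square_less[OF w, of K] by (simp add: calU2_eq mult_less_0_iff)

text \<open>The constant in U' <= decay exp (- 2 K) for K >= w + 1. From there on the geometric
  denominator 1 - exp (- 2 (K - w)) is at least 1 - exp (- 2).\<close>

definition "decay = 2 * exp (2 * w) / (1 - exp (- 2))"

lemma decay_pos: "decay > 0" by (simp add: decay_def)

lemma calU1_bounds: "w + 1 \<le> K \<Longrightarrow> 0 \<le> calU1 w K" "w + 1 \<le> K \<Longrightarrow> calU1 w K \<le> decay * exp (- 2 * K)"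
proof -
  assume K: "w + 1 \<le> K"
  then have wK: "w < K" by simp
  have e: "exp (- 2 * (K - w)) \<le> exp (-2)" "exp (- 2 :: real) < 1" using K by auto
  show "0 \<le> calU1 w K" using lambertE_pos[OF w wK] calU0_bounds[OF wK] by (simp add: calU1_eq[OF wK])
  have "calU1 w K \<le> 2 * lambertE w K * 1" unfolding calU1_eq[OF wK]
    using lambertE_pos[OF w wK] calU0_bounds[OF wK] by (intro mult_left_mono) auto
  also have "\<dots> \<le> 2 * (exp (- 2 * (K - w)) / (1 - exp (- 2 * (K - w))))" using lambertE_le[OF w wK] by simp
  also have "\<dots> \<le> 2 * (exp (- 2 * (K - w)) / (1 - exp (- 2)))" using e by (intro mult_left_mono frac_le) auto
  also have "exp (- 2 * (K - w)) = exp (2 * w) * exp (- 2 * K)" by (simp add: algebra_simps flip: exp_add)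
  finally show "calU1 w K \<le> decay * exp (- 2 * K)" by (simp add: decay_def)
qed

text \<open>The bound on U' is integrated to infinity: U plus the primitive decay / 2 exp (- 2 K) is
  nonincreasing and tends to 1 - exp (- 2 w).\<close>

lemma calU0_limit_gap: "w + 1 \<le> K \<Longrightarrow> (1 - exp (- 2 * w)) - calU0 w K \<le> decay / 2 * exp (- 2 * K)"
proof -
  assume K: "w + 1 \<le> K"
  define g where "g = (\<lambda>K. calU0 w K + decay / 2 * exp (- 2 * K))"
  have dg: "(g has_real_derivative calU1 w x + decay / 2 * (exp (- 2 * x) * (- 2))) (at x)" if "w + 1 \<le> x" for x
    unfolding g_def by (rule derivative_eq_intros calU_derivs refl | use that w in simp)+
  have le: "g y \<le> g K" if "K \<le> y" for y
  proof (rule DERIV_nonpos_imp_nonincreasing[OF that])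
    fix x assume x: "K \<le> x" "x \<le> y"
    then have "w + 1 \<le> x" using K by simp
    from dg[OF this] calU1_bounds(2)[OF this] show "\<exists>d. (g has_real_derivative d) (at x) \<and> d \<le> 0" by fastforce
  qed
  have "((\<lambda>K. exp (- 2 * K)) \<longlongrightarrow> (0::real)) at_top"
    by (intro filterlim_compose[OF exp_at_bot] filterlim_tendsto_neg_mult_at_bot[OF tendsto_const] filterlim_ident) auto
  then have "(g \<longlongrightarrow> (1 - exp (- 2 * w)) + decay / 2 * 0) at_top"
    unfolding g_def by (intro tendsto_add tendsto_mult tendsto_const calU0_at_top)
  then have "(1 - exp (- 2 * w)) + decay / 2 * 0 \<le> g K"
    by (rule tendsto_upperbound) (auto intro: eventually_at_top_linorderI[of K] le)
  then show ?thesis by (simp add: g_def)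
qed

lemma K_calU1_at_top: "((\<lambda>K. K * calU1 w K) \<longlongrightarrow> 0) at_top" "((\<lambda>K. K * (calU1 w K)\<^sup>2) \<longlongrightarrow> 0) at_top" "((\<lambda>K. calU1 w K) \<longlongrightarrow> 0) at_top"
proof -
  have e: "((\<lambda>K::real. decay * exp (- K)) \<longlongrightarrow> decay * 0) at_top"
    by (intro tendsto_mult tendsto_const filterlim_compose[OF exp_at_bot] filterlim_uminus_at_bot_at_top)
  have b: "norm (K * calU1 w K) \<le> decay * exp (- K)" if K: "w + 1 \<le> K" for K
  proof -
    have "K \<le> exp K" using exp_ge_add_one_self[of K] by linarith
    then have "K * calU1 w K \<le> exp K * (decay * exp (- 2 * K))"
      using calU1_bounds[OF K] K w by (intro mult_mono) auto
    also have "\<dots> = decay * exp (- K)" by (simp flip: exp_add)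
    finally show ?thesis using calU1_bounds(1)[OF K] K w by simp
  qed
  show 1: "((\<lambda>K. K * calU1 w K) \<longlongrightarrow> 0) at_top"
    by (rule Lim_null_comparison[OF _ e[simplified]]) (rule eventually_at_top_linorderI, rule b)
  have "((\<lambda>K. (K * calU1 w K) * inverse K) \<longlongrightarrow> 0 * 0) at_top"
    by (intro tendsto_mult 1 tendsto_inverse_0_at_top filterlim_ident)
  then have "((\<lambda>K. (K * calU1 w K) * inverse K) \<longlongrightarrow> 0) at_top" by simp
  moreover have "\<forall>\<^sub>F K in at_top. (K * calU1 w K) * inverse K = calU1 w K"
    using eventually_gt_at_top[of 0] by (rule eventually_mono) simp
  ultimately show 3: "((\<lambda>K. calU1 w K) \<longlongrightarrow> 0) at_top"
    by (rule Lim_transform_eventually)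
  show "((\<lambda>K. K * (calU1 w K)\<^sup>2) \<longlongrightarrow> 0) at_top"
    using tendsto_mult[OF 1 3] by (simp add: power2_eq_square mult.assoc)
qed

end

section \<open>The rate function\<close>

text \<open>By the fundamental theorem with finitely many exceptional points, f is an integral of
  the continuous function g, hence differentiable at those points too. This settles both joints of F
  without one-sided derivatives.\<close>

lemma has_real_derivative_glue:
  fixes f g :: "real \<Rightarrow> real"
  assumes "continuous_on UNIV f" "continuous_on UNIV g" "finite S"
    and d: "\<And>x. x \<notin> S \<Longrightarrow> (f has_real_derivative g x) (at x)"
  shows "(f has_real_derivative g x) (at x)"
proof -
  define a b where "a = x - 1" and "b = x + 1"
  have eq: "f y = f a + integral {a..y} g" if "y \<in> {a..b}" for y
  proof -
    have "(g has_integral (f y - f a)) {a..y}"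
      using that assms(1) d
      by (intro fundamental_theorem_of_calculus_strong[OF \<open>finite S\<close>])
        (auto simp: has_real_derivative_iff_has_vector_derivative intro: continuous_on_subset)
    then show ?thesis by (simp add: has_integral_iff)
  qed
  have "((\<lambda>y. integral {a..y} g) has_real_derivative g x) (at x within {a..b})"
    by (rule integral_has_real_derivative) (use assms(2) in \<open>auto simp: a_def b_def intro: continuous_on_subset\<close>)
  then have "((\<lambda>y. integral {a..y} g) has_real_derivative g x) (at x)"
    by (subst (asm) at_within_Icc_at) (auto simp: a_def b_def)
  then have "((\<lambda>y. f a + integral {a..y} g) has_real_derivative g x) (at x)"
    by (auto intro!: derivative_eq_intros)
  moreover have "\<forall>\<^sub>F y in nhds x. f y = f a + integral {a..y} g"
  proof -
    have "\<forall>\<^sub>F y in nhds x. y \<in> {a<..<b}" by (rule eventually_nhds_in_open) (auto simp: a_def b_def)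
    then show ?thesis by (rule eventually_mono) (rule eq, simp)
  qed
  ultimately show ?thesis by (subst DERIV_cong_ev[OF refl _ refl])
qed

context half_eta
begin

text \<open>The inverse of \<open>x \<mapsto> calK \<eta> x\<close>.\<close>

definition xval :: "real \<Rightarrow> real" where "xval K = - (calU0 w K - K * calU1 w K) / w"

definition xstar :: real where "xstar = - (1 - exp (- 2 * w)) / w"

lemma xstar_eq: "x_star (2 * w) = xstar"
  using w by (simp add: x_star_def xstar_def field_simps)

text \<open>The two terms in U' cancel, so x decreases in K exactly because U is concave.\<close>

lemma xval_deriv: "K > 0 \<Longrightarrow> (xval has_real_derivative K * calU2 w K / w) (at K)"
  unfolding xval_def[abs_def]
  by (rule derivative_eq_intros calU_derivs refl | use w in \<open>simp add: field_simps\<close>)+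

lemma xval_w: "xval w = 2" using w by (simp add: xval_def calU_endpoint)

lemma xval_at_top: "(xval \<longlongrightarrow> xstar) at_top"
proof -
  have "((\<lambda>K. - (calU0 w K - K * calU1 w K) / w) \<longlongrightarrow> - ((1 - exp (- 2 * w)) - 0) / w) at_top"
    by (intro tendsto_intros calU0_at_top K_calU1_at_top) (use w in simp)
  then show ?thesis by (simp add: xval_def[abs_def] xstar_def)
qed

lemma isCont_xval: "K > 0 \<Longrightarrow> isCont xval K"
  using xval_deriv by (rule DERIV_isCont)

lemma xval_antimono:
  assumes K: "w \<le> K" "K < K'"
  shows "xval K' < xval K"
proof (rule DERIV_neg_imp_decreasing_open[OF K(2)])
  fix x assume x: "K < x" "x < K'"
  then have "x > 0" "calU2 w x < 0" using K w by (auto intro: calU2_neg)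
  then have "x * calU2 w x / w < 0" using w by (simp add: divide_neg_pos mult_pos_neg)
  then show "\<exists>y. (xval has_real_derivative y) (at x) \<and> y < 0"
    using xval_deriv[OF \<open>x > 0\<close>] by blast
next
  show "continuous_on {K..K'} xval"
    using K w by (intro continuous_at_imp_continuous_on ballI isCont_xval) auto
qed

lemma xval_mono_iff: "w \<le> K \<Longrightarrow> w \<le> K' \<Longrightarrow> xval K < xval K' \<longleftrightarrow> K' < K"
  using xval_antimono[of K K'] xval_antimono[of K' K] by (cases K K' rule: linorder_cases) auto

lemma xval_inj: "w \<le> K \<Longrightarrow> w \<le> K' \<Longrightarrow> xval K = xval K' \<longleftrightarrow> K = K'"
  using xval_antimono[of K K'] xval_antimono[of K' K] by (cases K K' rule: linorder_cases) auto

lemma xval_gt: "w \<le> K \<Longrightarrow> xstar < xval K"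
proof -
  assume K: "w \<le> K"
  \<comment> \<open>The limit gives only a weak inequality; comparing at K + 1 and then moving back
    to K makes it strict.\<close>
  have "xstar \<le> xval (K + 1)"
  proof (rule tendsto_upperbound[OF xval_at_top])
    show "\<forall>\<^sub>F x in at_top. xval x \<le> xval (K + 1)"
      using K xval_mono_iff[of "K + 1"] by (intro eventually_at_top_linorderI[of "K + 1"]) (metis add_increasing2 linorder_not_le order_trans zero_le_one)
  qed simp
  also have "\<dots> < xval K" using K by (intro xval_antimono) auto
  finally show ?thesis .
qed

lemma xval_less_2: "w < K \<Longrightarrow> xval K < 2"
  using xval_antimono[of w K] by (simp add: xval_w)

lemma xval_surj: "xstar < x \<Longrightarrow> x < 2 \<Longrightarrow> \<exists>K>w. xval K = x"
proof -
  assume x: "xstar < x" "x < 2"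
  have "\<forall>\<^sub>F K in at_top. xval K < x" using xval_at_top x(1) by (rule order_tendstoD)
  then have "\<forall>\<^sub>F K in at_top. xval K < x \<and> w < K" using eventually_gt_at_top by (rule eventually_conj)
  then obtain K where K: "xval K < x" "w < K" by (metis (no_types, lifting) eventually_happens trivial_limit_at_top_linorder)
  have "\<exists>k\<ge>w. k \<le> K \<and> xval k = x"
    by (rule IVT2) (use K x w in \<open>auto simp: xval_w intro!: isCont_xval\<close>)
  then show ?thesis using x xval_w by (metis order.not_eq_order_implies_strict less_irrefl)
qed

section \<open>The inverse function and its limits at both ends\<close>

definition kinv :: "real \<Rightarrow> real" where "kinv = calK (2 * w)"

text \<open>For k > w the equation defining \<open>calK\<close> reads xval k = x, so injectivity of
  \<open>xval\<close> makes the definite description proper.\<close>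

lemma kinv_xval: "w < K \<Longrightarrow> kinv (xval K) = K"
proof -
  assume K: "w < K"
  have c: "(k > 2 * w / 2 \<and> calU (2 * w) k - k * deriv (calU (2 * w)) k = - (2 * w) * xval K / 2) \<longleftrightarrow> k = K" for k
  proof (cases "w < k")
    case True
    have "calU (2 * w) k - k * deriv (calU (2 * w)) k = - w * xval k"
      using True w by (simp add: calU_eq_calU0 calU_deriv xval_def)
    then show ?thesis using True K w xval_inj[of k K] by auto
  qed (use K in auto)
  show ?thesis unfolding kinv_def calK_def c by simp
qed

lemma kinv_props: "xstar < x \<Longrightarrow> x < 2 \<Longrightarrow> w < kinv x" "xstar < x \<Longrightarrow> x < 2 \<Longrightarrow> xval (kinv x) = x"
  using xval_surj[of x] kinv_xval by auto

lemma kinv_less_iff: "xstar < x \<Longrightarrow> x < 2 \<Longrightarrow> w < K \<Longrightarrow> kinv x < K \<longleftrightarrow> xval K < x"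
  using xval_mono_iff[of K "kinv x"] kinv_props[of x] by simp

lemma kinv_greater_iff: "xstar < x \<Longrightarrow> x < 2 \<Longrightarrow> w < K \<Longrightarrow> K < kinv x \<longleftrightarrow> x < xval K"
  using xval_mono_iff[of "kinv x" K] kinv_props[of x] by simp

lemma kinv_isCont: "xstar < x \<Longrightarrow> x < 2 \<Longrightarrow> isCont kinv x"
proof -
  assume x: "xstar < x" "x < 2"
  note k = kinv_props[OF x]
  have "isCont kinv (xval (kinv x))"
  proof (rule isCont_inverse_function2[where f = xval and g = kinv and x = "kinv x" and a = "(w + kinv x) / 2" and b = "kinv x + 1"])
    show "(w + kinv x) / 2 < kinv x" "kinv x < kinv x + 1" using k by auto
    fix z assume "(w + kinv x) / 2 \<le> z" "z \<le> kinv x + 1"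
    moreover have "w < (w + kinv x) / 2" using k(1) by simp
    ultimately have "w < z" by linarith
    then show "kinv (xval z) = z" "isCont xval z" using w by (auto intro: kinv_xval isCont_xval)
  qed
  then show ?thesis using k by simp
qed

lemma kinv_deriv: "xstar < x \<Longrightarrow> x < 2 \<Longrightarrow> (kinv has_real_derivative w / (kinv x * calU2 w (kinv x))) (at x)"
proof -
  assume x: "xstar < x" "x < 2"
  note k = kinv_props[OF x]
  have "(kinv has_real_derivative inverse (kinv x * calU2 w (kinv x) / w)) (at x)"
  proof (rule DERIV_inverse_function[OF _ _ x])
    show "(xval has_real_derivative kinv x * calU2 w (kinv x) / w) (at (kinv x))" using k w by (intro xval_deriv) auto
    show "kinv x * calU2 w (kinv x) / w \<noteq> 0" using k w calU2_neg[of "kinv x"] by auto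
    show "isCont kinv x" by (rule kinv_isCont[OF x])
  qed (use kinv_props in auto)
  then show ?thesis by simp
qed

lemma kinv_at_right: "filterlim kinv at_top (at_right xstar)"
  unfolding filterlim_at_top
proof
  fix Z
  define K where "K = max Z (w + 1)"
  have K: "w < K" "Z \<le> K" by (auto simp: K_def)
  have "\<forall>\<^sub>F x in at_right xstar. xstar < x \<and> x < xval K"
    using xval_gt[of K] K by (intro eventually_conj eventually_at_right_less) (auto simp: eventually_at_right_field)
  then show "\<forall>\<^sub>F x in at_right xstar. Z \<le> kinv x"
  proof (rule eventually_mono)
    fix x assume x: "xstar < x \<and> x < xval K"
    then have "K < kinv x" using xval_less_2[OF K(1)] K by (subst kinv_greater_iff) auto
    then show "Z \<le> kinv x" using K by simp
  qed
qed

lemma xstar_less_2: "xstar < 2"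
  using xval_gt[of w] xval_w by simp

lemma kinv_at_left: "(kinv \<longlongrightarrow> w) (at_left 2)"
proof (rule order_tendstoI)
  have ev: "\<forall>\<^sub>F x in at_left 2. y < x \<and> x < 2" if "y < 2" for y :: real
    using that by (auto simp: eventually_at_left_field)
  fix a
  show "\<forall>\<^sub>F x in at_left 2. a < kinv x" if "a < w"
    using ev[OF xstar_less_2] by (rule eventually_mono) (use kinv_props that in force)
  show "\<forall>\<^sub>F x in at_left 2. kinv x < a" if "w < a"
    using ev[OF xval_less_2[OF that]]
  proof (rule eventually_mono)
    fix x assume x: "xval a < x \<and> x < 2"
    then show "kinv x < a" using xval_gt[of a] that by (subst kinv_less_iff) auto
  qed
qed

text \<open>As x decreases to \<open>xstar\<close> the parameter K tends to infinity, and as x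
  increases to 2 it tends to w. Matching at the joints thus becomes a limit of \<phi> at infinity
  and its value at w, conditions free of the implicit inverse. The result serves F, F' and F''
  alike.\<close>

lemma continuous_on_piecewise_kinv:
  fixes a b \<phi> :: "real \<Rightarrow> real"
  assumes a: "continuous_on UNIV a" and b: "continuous_on UNIV b"
    and \<phi>: "\<And>K. K > 0 \<Longrightarrow> isCont \<phi> K" "(\<phi> \<longlongrightarrow> a xstar) at_top" "\<phi> w = b 2"
  shows "continuous_on UNIV (\<lambda>x. if x \<le> xstar then a x else if x < 2 then \<phi> (kinv x) else b x)" (is "continuous_on UNIV ?f")
proof -
  have ia: "isCont a x" and ib: "isCont b x" for x using a b by (auto simp: continuous_on_eq_continuous_at)
  have "isCont ?f x" for x
  proof -
    consider "x < xstar" | "x = xstar" | "xstar < x" "x < 2" | "x = 2" | "2 < x" by linarith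
    then show ?thesis
    proof cases
      case 1
      then have "\<forall>\<^sub>F y in nhds x. ?f y = a y"
        using eventually_nhds_in_open[of "{..<xstar}" x] by (auto elim!: eventually_mono)
      from iffD2[OF isCont_cong[OF this] ia] show ?thesis .
    next
      case 5
      then have "\<forall>\<^sub>F y in nhds x. ?f y = b y"
        using eventually_nhds_in_open[of "{2<..}" x] xstar_less_2 by (auto elim!: eventually_mono)
      from iffD2[OF isCont_cong[OF this] ib] show ?thesis .
    next
      case 3
      then have "\<forall>\<^sub>F y in nhds x. ?f y = \<phi> (kinv y)"
        using eventually_nhds_in_open[of "{xstar<..<2}" x] by (auto elim!: eventually_mono)
      moreover have "isCont (\<lambda>x. \<phi> (kinv x)) x"
        using kinv_props(1)[OF 3] w by (intro isCont_o2[OF kinv_isCont[OF 3] \<phi>(1)]) linarith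
      ultimately show ?thesis by (rule iffD2[OF isCont_cong])
    next
      case 2
      have "(a \<longlongrightarrow> a xstar) (at_left xstar)" using ia[of xstar] by (simp add: isCont_def filterlim_at_split)
      moreover have "\<forall>\<^sub>F y in at_left xstar. a y = ?f y" by (auto simp: eventually_at_filter)
      ultimately have l: "(?f \<longlongrightarrow> a xstar) (at_left xstar)" by (rule Lim_transform_eventually)
      have "((\<lambda>x. \<phi> (kinv x)) \<longlongrightarrow> a xstar) (at_right xstar)" by (rule filterlim_compose[OF \<phi>(2) kinv_at_right])
      moreover have "\<forall>\<^sub>F y in at_right xstar. \<phi> (kinv y) = ?f y"
        using xstar_less_2 by (auto simp: eventually_at_right_field)
      ultimately have r: "(?f \<longlongrightarrow> a xstar) (at_right xstar)" by (rule Lim_transform_eventually)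
      show ?thesis unfolding 2 isCont_def filterlim_at_split using l r by simp
    next
      case 4
      have "(b \<longlongrightarrow> b 2) (at_right 2)" using ib[of 2] by (simp add: isCont_def filterlim_at_split)
      moreover have "\<forall>\<^sub>F y in at_right 2. b y = ?f y" using xstar_less_2 by (auto simp: eventually_at_filter)
      ultimately have r: "(?f \<longlongrightarrow> b 2) (at_right 2)" by (rule Lim_transform_eventually)
      have "((\<lambda>x. \<phi> (kinv x)) \<longlongrightarrow> \<phi> w) (at_left 2)"
        using \<phi>(1)[OF w] kinv_at_left by (rule isCont_tendsto_compose)
      moreover have "\<forall>\<^sub>F y in at_left 2. \<phi> (kinv y) = ?f y"
        using xstar_less_2 by (auto simp: eventually_at_left_field)
      ultimately have l: "(?f \<longlongrightarrow> \<phi> w) (at_left 2)" by (rule Lim_transform_eventually)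
      show ?thesis unfolding 4 isCont_def filterlim_at_split using l r \<phi>(3) xstar_less_2 by simp
    qed
  qed
  then show ?thesis by (simp add: continuous_on_eq_continuous_at)
qed

lemma piecewise_deriv:
  fixes a b c a' b' c' :: "real \<Rightarrow> real"
  assumes "\<And>x. (a has_real_derivative a' x) (at x)" "\<And>x. (b has_real_derivative b' x) (at x)"
    and "\<And>x. xstar < x \<Longrightarrow> x < 2 \<Longrightarrow> (c has_real_derivative c' x) (at x)" "x \<notin> {xstar, 2}"
  shows "((\<lambda>x. if x \<le> xstar then a x else if x < 2 then c x else b x) has_real_derivative
     (if x \<le> xstar then a' x else if x < 2 then c' x else b' x)) (at x)" (is "(?f has_real_derivative ?d) (at x)")
proof -
  consider "x < xstar" | "xstar < x" "x < 2" | "2 < x" using assms(4) by (metis insertI1 insert_iff linorder_neqE_linordered_idom)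
  then show ?thesis
  proof cases
    case 1
    then have "\<forall>\<^sub>F y in nhds x. ?f y = a y"
      using eventually_nhds_in_open[of "{..<xstar}" x] by (auto elim!: eventually_mono)
    then show ?thesis using 1 assms(1) by (subst DERIV_cong_ev[OF refl _ refl]) auto
  next
    case 2
    then have "\<forall>\<^sub>F y in nhds x. ?f y = c y"
      using eventually_nhds_in_open[of "{xstar<..<2}" x] by (auto elim!: eventually_mono)
    then show ?thesis using 2 assms(3) by (subst DERIV_cong_ev[OF refl _ refl]) auto
  next
    case 3
    then have "\<forall>\<^sub>F y in nhds x. ?f y = b y"
      using eventually_nhds_in_open[of "{2<..}" x] xstar_less_2 by (auto elim!: eventually_mono)
    then show ?thesis using 3 assms(2) xstar_less_2 by (subst DERIV_cong_ev[OF refl _ refl]) auto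
  qed
qed

text \<open>The middle formula arises by substituting y = xval k in the integral of
  \<open>calL\<close> and integrating k U' U'' by parts. The boundary term gives - K U'^2, and the
  remaining integral of U'^2 is expressed by \<open>calJ\<close>, whose limit at infinity cancels
  exp (- 2 w).\<close>

definition calF0 :: "real \<Rightarrow> real" where
  "calF0 x = (if x \<le> xstar then w * x\<^sup>2 + 1 - exp (- 2 * w)
     else if x < 2 then w * (xval (kinv x))\<^sup>2 + 1 - kinv x * (calU1 w (kinv x))\<^sup>2 - calJ w (kinv x) / 2 else 0)"
definition calF1 :: "real \<Rightarrow> real" where
  "calF1 x = (if x \<le> xstar then 2 * w * x else if x < 2 then 2 * w * xval (kinv x) - 2 * w * calU1 w (kinv x) else 0)"
definition calF2 :: "real \<Rightarrow> real" where
  "calF2 x = (if x \<le> xstar then 2 * w else if x < 2 then 2 * w - 2 * w\<^sup>2 / kinv x else 0)"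

section \<open>Derivatives of the closed form and its identification with F\<close>

lemma isCont_calU: "K > 0 \<Longrightarrow> isCont (calU0 w) K" "K > 0 \<Longrightarrow> isCont (calU1 w) K" "K > 0 \<Longrightarrow> isCont (calU2 w) K"
  "K > 0 \<Longrightarrow> isCont (calJ w) K"
  using calU_derivs[of K w] calJ_deriv[of K w] by (auto intro: DERIV_isCont)

lemma calF0_cont: "continuous_on UNIV calF0"
  unfolding calF0_def[abs_def]
proof (rule continuous_on_piecewise_kinv[where \<phi> = "\<lambda>k. w * (xval k)\<^sup>2 + 1 - k * (calU1 w k)\<^sup>2 - calJ w k / 2"])
  have "((\<lambda>k. w * (xval k)\<^sup>2 + 1 - k * (calU1 w k)\<^sup>2 - calJ w k / 2) \<longlongrightarrow> w * xstar\<^sup>2 + 1 - 0 - 2 * exp (- 2 * w) / 2) at_top"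
    by (intro tendsto_intros xval_at_top K_calU1_at_top calJ_at_top) simp
  then show "((\<lambda>k. w * (xval k)\<^sup>2 + 1 - k * (calU1 w k)\<^sup>2 - calJ w k / 2) \<longlongrightarrow> w * xstar\<^sup>2 + 1 - exp (- 2 * w)) at_top" by simp
  \<comment> \<open>With x = 2, U' = 2 and J = 2 this is 4 w + 1 - 4 w - 1. The value J = 2 enters
    here, so the evaluated integral of U'^2 is what makes F continuous at 2.\<close>
  show "w * (xval w)\<^sup>2 + 1 - w * (calU1 w w)\<^sup>2 - calJ w w / 2 = 0" using w by (simp add: xval_w calU_endpoint)
qed (auto intro!: continuous_intros isCont_calU isCont_xval)

lemma calF1_cont: "continuous_on UNIV calF1"
  unfolding calF1_def[abs_def]
proof (rule continuous_on_piecewise_kinv[where \<phi> = "\<lambda>k. 2 * w * xval k - 2 * w * calU1 w k"])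
  have "((\<lambda>k. 2 * w * xval k - 2 * w * calU1 w k) \<longlongrightarrow> 2 * w * xstar - 2 * w * 0) at_top"
    by (intro tendsto_intros xval_at_top K_calU1_at_top)
  then show "((\<lambda>k. 2 * w * xval k - 2 * w * calU1 w k) \<longlongrightarrow> 2 * w * xstar) at_top" by simp
  show "2 * w * xval w - 2 * w * calU1 w w = 0" using w by (simp add: xval_w calU_endpoint)
qed (auto intro!: continuous_intros isCont_calU isCont_xval)

lemma calF2_cont: "continuous_on UNIV calF2"
  unfolding calF2_def[abs_def]
proof (rule continuous_on_piecewise_kinv[where \<phi> = "\<lambda>k. 2 * w - 2 * w\<^sup>2 / k"])
  have "((\<lambda>k. 2 * w - 2 * w\<^sup>2 / k) \<longlongrightarrow> 2 * w - 0) at_top"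
    by (intro tendsto_diff tendsto_const real_tendsto_divide_at_top[OF tendsto_const] filterlim_ident)
  then show "((\<lambda>k. 2 * w - 2 * w\<^sup>2 / k) \<longlongrightarrow> 2 * w) at_top" by simp
  show "2 * w - 2 * w\<^sup>2 / w = 0" using w by (simp add: power2_eq_square)
qed (auto intro!: continuous_intros)

lemma calF0_deriv: "(calF0 has_real_derivative calF1 x) (at x)"
proof (rule has_real_derivative_glue[OF calF0_cont calF1_cont, of "{xstar, 2}"])
  fix x assume "x \<notin> {xstar, 2}"
  then show "(calF0 has_real_derivative calF1 x) (at x)"
    unfolding calF0_def[abs_def] calF1_def
  proof (rule piecewise_deriv[rotated 3])
    fix x assume x: "xstar < x" "x < 2"
    note k = kinv_props[OF x]
    have k0: "kinv x > 0" using k w by simp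
    have calU2: "calU2 w (kinv x) \<noteq> 0" using calU2_neg[OF k(1)] by simp
    \<comment> \<open>Here - J' / 2 = U'^2 cancels the term - U'^2 coming from - K U'^2; the rest
      has the factor K U'', which the derivative of \<open>kinv\<close> divides out.\<close>
    have "((\<lambda>k. w * (xval k)\<^sup>2 + 1 - k * (calU1 w k)\<^sup>2 - calJ w k / 2) has_real_derivative
       2 * kinv x * calU2 w (kinv x) * (xval (kinv x) - calU1 w (kinv x))) (at (kinv x))"
      by (rule derivative_eq_intros xval_deriv calU_derivs calJ_deriv refl k0 | use w in \<open>simp add: field_simps power2_eq_square\<close>)+
    from DERIV_chain2[OF this kinv_deriv[OF x]]
    show "((\<lambda>x. w * (xval (kinv x))\<^sup>2 + 1 - kinv x * (calU1 w (kinv x))\<^sup>2 - calJ w (kinv x) / 2) has_real_derivative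
       2 * w * xval (kinv x) - 2 * w * calU1 w (kinv x)) (at x)"
      by (rule DERIV_cong) (use k0 calU2 in \<open>simp add: field_simps\<close>)
  qed (auto intro!: derivative_eq_intros)
qed simp

lemma calF1_deriv: "(calF1 has_real_derivative calF2 x) (at x)"
proof (rule has_real_derivative_glue[OF calF1_cont calF2_cont, of "{xstar, 2}"])
  fix x assume "x \<notin> {xstar, 2}"
  then show "(calF1 has_real_derivative calF2 x) (at x)"
    unfolding calF1_def[abs_def] calF2_def
  proof (rule piecewise_deriv[rotated 3])
    fix x assume x: "xstar < x" "x < 2"
    note k = kinv_props[OF x]
    have k0: "kinv x > 0" using k w by simp
    have calU2: "calU2 w (kinv x) \<noteq> 0" using calU2_neg[OF k(1)] by simp
    \<comment> \<open>U'' is a common factor here and in the derivative of \<open>xval\<close>;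
      after the chain rule it disappears, which is why F'' is a rational expression in K.\<close>
    have "((\<lambda>k. 2 * w * xval k - 2 * w * calU1 w k) has_real_derivative 2 * w * (kinv x * calU2 w (kinv x) / w) - 2 * w * calU2 w (kinv x)) (at (kinv x))"
      by (intro DERIV_diff DERIV_cmult xval_deriv calU_derivs k0)
    from DERIV_chain2[OF this kinv_deriv[OF x]]
    show "((\<lambda>x. 2 * w * xval (kinv x) - 2 * w * calU1 w (kinv x)) has_real_derivative 2 * w - 2 * w\<^sup>2 / kinv x) (at x)"
      by (rule DERIV_cong) (use k0 calU2 w in \<open>simp add: field_simps power2_eq_square\<close>)
  qed (auto intro!: derivative_eq_intros)
qed simp

text \<open>The closed form minus its quadratic part, divided by \<eta>, is continuous on the closed
  interval and has derivative \<open>calL\<close> in the interior. The fundamental theorem in this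
  form asks nothing of \<open>calL\<close> at \<open>xstar\<close>, where it is unspecified.\<close>

lemma calF_eq: "calF (2 * w) = calF0"
proof
  fix x
  show "calF (2 * w) x = calF0 x"
  proof (cases "xstar < x \<and> x < 2")
    case False
    then show ?thesis using xstar_less_2 unfolding calF_def xstar_eq calF0_def by auto
  next
    case True
    define P where "P = (\<lambda>y. (calF0 y - w * y\<^sup>2 - (1 - exp (- 2 * w))) / (2 * w))"
    have "(calL (2 * w) has_integral (P x - P xstar)) {xstar..x}"
    proof (rule fundamental_theorem_of_calculus_interior)
      show "continuous_on {xstar..x} P"
        unfolding P_def by (intro continuous_intros continuous_on_subset[OF calF0_cont]) (use w in auto)
      fix y assume y: "y \<in> {xstar<..<x}"
      then have y2: "xstar < y" "y < 2" using True by auto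
      have "calL (2 * w) y = (calF1 y - 2 * w * y) / (2 * w)"
        using y2 w kinv_props[OF y2] unfolding calL_def kinv_def[symmetric] calF1_def by (simp add: calU_deriv)
      moreover have "(P has_real_derivative (calF1 y - 2 * w * y) / (2 * w)) (at y)"
      proof -
        have "((\<lambda>y. calF0 y - w * y\<^sup>2 - (1 - exp (- 2 * w))) has_real_derivative calF1 y - w * (2 * y) - 0) (at y)"
          by (intro DERIV_diff calF0_deriv DERIV_const DERIV_cmult) (auto intro!: derivative_eq_intros)
        from DERIV_cdivide[OF this, of "2 * w"] show ?thesis unfolding P_def by (simp add: mult_ac)
      qed
      ultimately show "(P has_vector_derivative calL (2 * w) y) (at y)"
        by (simp add: has_real_derivative_iff_has_vector_derivative)
    qed (use True in simp)
    moreover have "P xstar = 0" by (simp add: P_def calF0_def)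
    ultimately have "integral {xstar..x} (calL (2 * w)) = P x" by (simp add: has_integral_iff)
    then show ?thesis using True w unfolding calF_def xstar_eq P_def by simp
  qed
qed

end

section \<open>Behaviour at the endpoints\<close>

text \<open>This links the two negative claims: a third derivative at x_star would give Hoelder
  exponent 1 there.\<close>

lemma differentiable_imp_holder_1:
  assumes "f differentiable (at (a::real))"
  shows "holder_continuous_at 1 f a"
proof -
  obtain D where "(f has_real_derivative D) (at a)" using assms by (auto simp: real_differentiable_def)
  then have "((\<lambda>x. (f x - f a) / (x - a)) \<longlongrightarrow> D) (at a)" by (simp add: has_field_derivative_iff)
  then have "((\<lambda>x. \<bar>(f x - f a) / (x - a)\<bar>) \<longlongrightarrow> \<bar>D\<bar>) (at a)" by (rule tendsto_rabs)
  then have "\<forall>\<^sub>F x in at a. \<bar>(f x - f a) / (x - a)\<bar> < \<bar>D\<bar> + 1" by (rule order_tendstoD) simp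
  then obtain d where d: "d > 0" "\<And>x. x \<noteq> a \<Longrightarrow> dist x a < d \<Longrightarrow> \<bar>(f x - f a) / (x - a)\<bar> < \<bar>D\<bar> + 1"
    unfolding eventually_at by auto
  have "\<bar>f x - f a\<bar> \<le> (\<bar>D\<bar> + 1) * \<bar>x - a\<bar> powr 1" if "\<bar>x - a\<bar> < d" for x
  proof (cases "x = a")
    case False
    then show ?thesis using d(2)[OF False] that by (simp add: dist_real_def abs_divide pos_divide_less_eq)
  qed simp
  then show ?thesis unfolding holder_continuous_at_def using d(1) by blast
qed

section \<open>Failure of Hoelder continuity at x_star, and the cubic law at 2\<close>

context half_eta
begin

text \<open>The gap is (1/2 + K) exp (- 2 K) up to a constant. Half of the exponential rate is given
  up to absorb the linear factor, as any exponential bound suffices.\<close>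

lemma xval_gap: "w + 1 \<le> K \<Longrightarrow> xval K - xstar \<le> decay / w * exp (- K)"
proof -
  assume K: "w + 1 \<le> K"
  have "xval K - xstar = ((1 - exp (- 2 * w)) - calU0 w K + K * calU1 w K) / w"
    using w by (simp add: xval_def xstar_def field_simps)
  also have "\<dots> \<le> (decay / 2 * exp (- 2 * K) + K * (decay * exp (- 2 * K))) / w"
    using calU0_limit_gap[OF K] calU1_bounds(2)[OF K] K w by (intro divide_right_mono add_mono mult_left_mono) auto
  also have "\<dots> = decay / w * ((1/2 + K) * exp (- 2 * K))" by (simp add: field_simps)
  also have "\<dots> \<le> decay / w * (exp K * exp (- 2 * K))"
  proof (intro mult_left_mono mult_right_mono)
    show "1/2 + K \<le> exp K" using exp_ge_add_one_self[of K] by linarith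
    show "0 \<le> decay / w" using decay_pos w by simp
  qed simp
  also have "exp K * exp (- 2 * K) = exp (- K)" by (simp flip: exp_add)
  finally show ?thesis .
qed

lemma calF2_not_holder:
  assumes \<alpha>: "\<alpha> > 0"
  shows "\<not> holder_continuous_at \<alpha> calF2 xstar"
proof
  assume "holder_continuous_at \<alpha> calF2 xstar"
  then obtain C d where d: "d > 0" and C: "\<And>x. \<bar>x - xstar\<bar> < d \<Longrightarrow> \<bar>calF2 x - calF2 xstar\<bar> \<le> C * \<bar>x - xstar\<bar> powr \<alpha>"
    unfolding holder_continuous_at_def by blast
  define D where "D = decay / w"
  have D: "D > 0" using decay_pos w by (simp add: D_def)
  have "\<forall>\<^sub>F K in at_top. xval K < xstar + d" using xval_at_top d by (intro order_tendstoD(2)) auto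
  moreover have "\<forall>\<^sub>F K in at_top. w + 1 \<le> K" by (rule eventually_ge_at_top)
  \<comment> \<open>This threshold contradicts the bound on K to which the Hoelder inequality at x =
    xval K leads.\<close>
  moreover have "\<forall>\<^sub>F K in at_top. \<bar>C\<bar> * D powr \<alpha> / (w\<^sup>2 * \<alpha>\<^sup>2) < K" by (rule eventually_gt_at_top)
  ultimately have "\<forall>\<^sub>F K in at_top. xval K < xstar + d \<and> w + 1 \<le> K \<and> \<bar>C\<bar> * D powr \<alpha> / (w\<^sup>2 * \<alpha>\<^sup>2) < K"
    by (intro eventually_conj)
  then obtain K where K: "xval K < xstar + d" "w + 1 \<le> K" "\<bar>C\<bar> * D powr \<alpha> / (w\<^sup>2 * \<alpha>\<^sup>2) < K"
    using eventually_happens trivial_limit_at_top_linorder by blast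
  have wK: "w < K" "K > 0" using K w by auto
  have xval: "xstar < xval K" "xval K < 2" using xval_gt[of K] xval_less_2[of K] wK by auto
  have "2 * w\<^sup>2 / K = \<bar>calF2 (xval K) - calF2 xstar\<bar>" using xval wK w by (simp add: calF2_def kinv_xval)
  also have "\<dots> \<le> C * \<bar>xval K - xstar\<bar> powr \<alpha>" using xval K by (intro C) auto
  also have "\<dots> \<le> \<bar>C\<bar> * (D * exp (- K)) powr \<alpha>"
    using xval_gap[OF K(2)] xval \<alpha> by (intro mult_mono powr_mono2) (auto simp: D_def)
  also have "(D * exp (- K)) powr \<alpha> = D powr \<alpha> * exp (- (\<alpha> * K))"
    using D by (simp add: powr_def ln_mult algebra_simps flip: exp_add)
  also have "\<bar>C\<bar> * (D powr \<alpha> * exp (- (\<alpha> * K))) \<le> \<bar>C\<bar> * (D powr \<alpha> * (2 / (\<alpha> * K)\<^sup>2))"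
  proof -
    have "0 \<le> \<alpha> * K" using \<alpha> wK by simp
    \<comment> \<open>The quadratic Taylor term is enough, since only a multiple of 1 / K has to be
      beaten.\<close>
    then have "(\<alpha> * K)\<^sup>2 / 2 \<le> exp (\<alpha> * K)" using exp_lower_Taylor_quadratic[of "\<alpha> * K"] by linarith
    then have "exp (- (\<alpha> * K)) \<le> 2 / (\<alpha> * K)\<^sup>2" using \<alpha> wK by (simp add: exp_minus divide_simps mult.commute)
    then show ?thesis by (intro mult_left_mono) auto
  qed
  also have "\<bar>C\<bar> * (D powr \<alpha> * (2 / (\<alpha> * K)\<^sup>2)) = 2 * (\<bar>C\<bar> * D powr \<alpha> / (\<alpha>\<^sup>2 * K\<^sup>2))"
    by (simp add: power_mult_distrib)
  finally have "w\<^sup>2 / K \<le> \<bar>C\<bar> * D powr \<alpha> / (\<alpha>\<^sup>2 * K\<^sup>2)" by simp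
  then have "w\<^sup>2 * \<alpha>\<^sup>2 * K \<le> \<bar>C\<bar> * D powr \<alpha>" using wK \<alpha> by (simp add: divide_simps power2_eq_square mult_ac)
  then show False using K(3) w \<alpha> by (simp add: divide_simps mult_ac)
qed

text \<open>\<open>F'' - (2 - x) / 2\<close> as a function of \<open>K\<close>; two derivatives in \<open>K\<close> at \<open>w\<close> replace a third derivative of \<open>F\<close> at 2.\<close>

definition taylor_gap :: "real \<Rightarrow> real" where "taylor_gap K = 2 * w - 2 * w\<^sup>2 / K - (2 - xval K) / 2"
definition taylor_gap1 :: "real \<Rightarrow> real" where "taylor_gap1 K = 2 * w\<^sup>2 / K\<^sup>2 + K * calU2 w K / w / 2"
definition taylor_gap2 :: "real \<Rightarrow> real" where "taylor_gap2 K = - 4 * w\<^sup>2 / K ^ 3 + (calU2 w K + K * calU3 w K) / w / 2"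

lemma taylor_gap_deriv: "K > 0 \<Longrightarrow> (taylor_gap has_real_derivative taylor_gap1 K) (at K)"
  unfolding taylor_gap_def[abs_def] taylor_gap1_def
  by (rule derivative_eq_intros xval_deriv refl | simp add: field_simps power2_eq_square)+

lemma taylor_gap1_deriv: "K > 0 \<Longrightarrow> (taylor_gap1 has_real_derivative taylor_gap2 K) (at K)"
  unfolding taylor_gap1_def[abs_def] taylor_gap2_def
  by (rule derivative_eq_intros calU_derivs refl | use w in \<open>simp add: field_simps power2_eq_square power3_eq_cube\<close>)+

lemma isCont_calU3: "K > 0 \<Longrightarrow> isCont (calU3 w) K"
proof -
  assume K: "K > 0"
  have "isCont (moment_ratio j w) K" "isCont (moment_ratio_zero j) K" for j using moment_ratio_deriv[OF K] moment_ratio_zero_deriv[OF K] DERIV_isCont by blast+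
  then show ?thesis unfolding calU3_def[abs_def] by (intro continuous_intros)
qed

text \<open>The gap vanishes at w because x = 2 there, and so does its derivative because U''(w) =
  -4 makes K U'' / (2 w) cancel 2 w^2 / K^2. A bounded second derivative and two mean value steps do
  the rest. The second cancellation is what fixes the coefficient 1/12.\<close>

lemma taylor_gap_bound: "\<exists>C. \<forall>K. w \<le> K \<longrightarrow> K \<le> w + 1 \<longrightarrow> \<bar>taylor_gap K\<bar> \<le> C * (K - w)\<^sup>2"
proof -
  have "continuous_on {w..w + 1} taylor_gap2"
    unfolding taylor_gap2_def[abs_def] using w
    by (intro continuous_at_imp_continuous_on ballI continuous_intros isCont_calU isCont_calU3) auto
  then have "compact (taylor_gap2 ` {w..w + 1})" by (intro compact_continuous_image) auto
  then have "bounded (taylor_gap2 ` {w..w + 1})" by (rule compact_imp_bounded)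
  then obtain C where "\<forall>x\<in>{w..w + 1}. \<bar>taylor_gap2 x\<bar> \<le> C" unfolding bounded_real by auto
  then have C: "\<And>K. w \<le> K \<Longrightarrow> K \<le> w + 1 \<Longrightarrow> \<bar>taylor_gap2 K\<bar> \<le> C" by simp
  have g0: "taylor_gap w = 0" "taylor_gap1 w = 0"
    using w by (simp_all add: taylor_gap_def taylor_gap1_def xval_w calU_endpoint power2_eq_square)
  have 1: "\<bar>taylor_gap1 K\<bar> \<le> C * (K - w)" if K: "w \<le> K" "K \<le> w + 1" for K
  proof (cases "w = K")
    case True
    show ?thesis unfolding True[symmetric] by (simp add: g0)
  next
    case False
    then have lt: "w < K" using K by simp
    obtain z where z: "w < z" "z < K" "taylor_gap1 K - taylor_gap1 w = (K - w) * taylor_gap2 z"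
      using MVT2[OF lt, of taylor_gap1 taylor_gap2] taylor_gap1_deriv w by auto
    have "\<bar>taylor_gap1 K\<bar> = (K - w) * \<bar>taylor_gap2 z\<bar>" using z(3) lt by (simp add: g0 abs_mult)
    also have "\<dots> \<le> (K - w) * C" using z K by (intro mult_left_mono C) auto
    finally show ?thesis by (simp add: mult.commute)
  qed
  have "\<bar>taylor_gap K\<bar> \<le> C * (K - w)\<^sup>2" if K: "w \<le> K" "K \<le> w + 1" for K
  proof (cases "w = K")
    case True
    show ?thesis unfolding True[symmetric] by (simp add: g0)
  next
    case False
    then have lt: "w < K" using K by simp
    obtain z where z: "w < z" "z < K" "taylor_gap K - taylor_gap w = (K - w) * taylor_gap1 z"
      using MVT2[OF lt, of taylor_gap taylor_gap1] taylor_gap_deriv w by auto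
    have C0: "0 \<le> C" using C[of w] by linarith
    have "\<bar>taylor_gap K\<bar> = (K - w) * \<bar>taylor_gap1 z\<bar>" using z(3) lt by (simp add: g0 abs_mult)
    also have "\<dots> \<le> (K - w) * (C * (z - w))" using z K by (intro mult_left_mono 1) auto
    also have "\<dots> \<le> (K - w) * (C * (K - w))" using z lt C0 by (intro mult_left_mono) auto
    finally show ?thesis by (simp add: power2_eq_square mult_ac)
  qed
  then show ?thesis by blast
qed

text \<open>This converts powers of K - w into powers of 2 - x. The slope of \<open>xval\<close> at
  w is U''(w) = -4, so near w it stays below -1, which gives the inequality with constant 1.\<close>

lemma xval_gap_2: "\<exists>d>0. \<forall>K. w \<le> K \<longrightarrow> K \<le> w + d \<longrightarrow> K - w \<le> 2 - xval K"
proof -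
  have "isCont (\<lambda>K. K * calU2 w K / w) w" using w by (intro continuous_intros isCont_calU) auto
  then have "((\<lambda>K. K * calU2 w K / w) \<longlongrightarrow> w * calU2 w w / w) (at w)" by (simp add: isCont_def)
  moreover have "w * calU2 w w / w < - 1" using w by (simp add: calU_endpoint)
  ultimately have "\<forall>\<^sub>F K in at w. K * calU2 w K / w < - 1" by (rule order_tendstoD)
  then obtain d where d: "d > 0" "\<And>K. K \<noteq> w \<Longrightarrow> dist K w < d \<Longrightarrow> K * calU2 w K / w < - 1"
    unfolding eventually_at by auto
  have "K - w \<le> 2 - xval K" if K: "w \<le> K" "K \<le> w + d / 2" for K
  proof (cases "w = K")
    case True
    then show ?thesis using xval_w by simp
  next
    case False
    then have lt: "w < K" using K by simp
    obtain z where z: "w < z" "z < K" "xval K - xval w = (K - w) * (z * calU2 w z / w)"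
      using MVT2[OF lt, of xval "\<lambda>K. K * calU2 w K / w"] xval_deriv w by auto
    have "z * calU2 w z / w < - 1" using z K d(1) by (intro d(2)) (auto simp: dist_real_def)
    then have "(K - w) * (z * calU2 w z / w) \<le> (K - w) * (- 1)" using lt by (intro mult_left_mono) auto
    then show ?thesis using z(3) xval_w by simp
  qed
  then show ?thesis using d(1) by (intro exI[of _ "d / 2"]) auto
qed

lemma calF0_asymptotics: "(\<lambda>x. calF0 x - 1 / 12 * (2 - x) ^ 3) \<in> O[at_left 2](\<lambda>x. (2 - x) ^ 4)"
proof -
  obtain C where C: "\<And>K. w \<le> K \<Longrightarrow> K \<le> w + 1 \<Longrightarrow> \<bar>taylor_gap K\<bar> \<le> C * (K - w)\<^sup>2" using taylor_gap_bound by blast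
  obtain d where d: "d > 0" "\<And>K. w \<le> K \<Longrightarrow> K \<le> w + d \<Longrightarrow> K - w \<le> 2 - xval K" using xval_gap_2 by blast
  have C0: "0 \<le> C" using C[of "w + 1"] by simp
  \<comment> \<open>Both estimates hold for K up to w + e; since \<open>kinv\<close> is decreasing,
    this is the range x > \<open>x0\<close>.\<close>
  define e where "e = min 1 d"
  define x0 where "x0 = xval (w + e)"
  have e: "0 < e" "e \<le> 1" "e \<le> d" using d by (auto simp: e_def)
  have x0: "xstar < x0" "x0 < 2" unfolding x0_def using e w by (auto intro!: xval_gt xval_less_2)
  \<comment> \<open>\<open>M\<close> is F'' minus its leading term. \<open>R1\<close> and
    \<open>R\<close> are its successive antiderivatives vanishing at 2, because F' and F vanish
    there; each mean value step on [x, 2] gains a factor 2 - x.\<close>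
  define M where "M = (\<lambda>x. calF2 x - (2 - x) / 2)"
  define R1 where "R1 = (\<lambda>x. calF1 x + (2 - x)\<^sup>2 / 4)"
  define R where "R = (\<lambda>x. calF0 x - 1 / 12 * (2 - x) ^ 3)"
  have M: "\<bar>M x\<bar> \<le> C * (2 - x)\<^sup>2" if x: "x0 < x" "x < 2" for x
  proof -
    have xx: "xstar < x" "x < 2" using x x0 by auto
    note k = kinv_props[OF xx]
    have "kinv x < w + e" using xx e x by (subst kinv_less_iff) (auto simp: x0_def)
    then have ke: "w \<le> kinv x" "kinv x \<le> w + 1" "kinv x \<le> w + d" using k e by auto
    have "M x = taylor_gap (kinv x)" using xx k by (simp add: M_def calF2_def taylor_gap_def)
    then have "\<bar>M x\<bar> \<le> C * (kinv x - w)\<^sup>2" using C[OF ke(1,2)] by simp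
    also have "\<dots> \<le> C * (2 - x)\<^sup>2" using d(2)[OF ke(1,3)] k ke C0 by (intro mult_left_mono power_mono) auto
    finally show ?thesis .
  qed
  have dR1: "(R1 has_real_derivative M x) (at x)" for x
  proof -
    have "((\<lambda>x. (2 - x)\<^sup>2 / 4) has_real_derivative - ((2 - x) / 2)) (at x)"
      by (auto intro!: derivative_eq_intros simp: field_simps)
    from DERIV_add[OF calF1_deriv this] show ?thesis by (simp add: R1_def M_def)
  qed
  have dR: "(R has_real_derivative R1 x) (at x)" for x
  proof -
    have "((\<lambda>x. 1 / 12 * (2 - x) ^ 3) has_real_derivative - ((2 - x)\<^sup>2 / 4)) (at x)"
      by (auto intro!: derivative_eq_intros)
    from DERIV_diff[OF calF0_deriv this] show ?thesis by (simp add: R_def R1_def)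
  qed
  have R1: "\<bar>R1 x\<bar> \<le> C * (2 - x) ^ 3" if x: "x0 < x" "x < 2" for x
  proof -
    obtain z where z: "x < z" "z < 2" "R1 2 - R1 x = (2 - x) * M z"
      using MVT2[OF x(2), of R1 M] dR1 by auto
    have "R1 2 = 0" using xstar_less_2 by (simp add: R1_def calF1_def)
    then have "\<bar>R1 x\<bar> = (2 - x) * \<bar>M z\<bar>" using z(3) x by (metis abs_minus_cancel abs_mult abs_of_pos diff_0 diff_gt_0_iff_gt)
    also have "\<dots> \<le> (2 - x) * (C * (2 - z)\<^sup>2)" using z x by (intro mult_left_mono M) auto
    also have "\<dots> \<le> (2 - x) * (C * (2 - x)\<^sup>2)" using z x C0 by (intro mult_left_mono power_mono) auto
    finally show ?thesis by (simp add: power2_eq_square power3_eq_cube mult_ac)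
  qed
  have "\<bar>R x\<bar> \<le> C * (2 - x) ^ 4" if x: "x0 < x" "x < 2" for x
  proof -
    obtain z where z: "x < z" "z < 2" "R 2 - R x = (2 - x) * R1 z"
      using MVT2[OF x(2), of R R1] dR by auto
    have "R 2 = 0" using xstar_less_2 by (simp add: R_def calF0_def)
    then have "\<bar>R x\<bar> = (2 - x) * \<bar>R1 z\<bar>" using z(3) x by (metis abs_minus_cancel abs_mult abs_of_pos diff_0 diff_gt_0_iff_gt)
    also have "\<dots> \<le> (2 - x) * (C * (2 - z) ^ 3)" using z x by (intro mult_left_mono R1) auto
    also have "\<dots> \<le> (2 - x) * (C * (2 - x) ^ 3)" using z x C0 by (intro mult_left_mono power_mono) auto
    also have "\<dots> = C * (2 - x) ^ 4" by (simp add: power3_eq_cube power4_eq_xxxx mult_ac)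
    finally show ?thesis .
  qed
  then have "\<forall>\<^sub>F x in at_left 2. norm (R x) \<le> C * norm ((2 - x) ^ 4)"
    unfolding eventually_at_left_field using x0 by (intro exI[of _ x0]) auto
  then show ?thesis unfolding R_def by (rule bigoI)
qed

section \<open>Smoothness class and final assembly\<close>

lemma deriv_calF: "deriv (calF (2 * w)) = calF1" "deriv calF1 = calF2"
  using calF0_deriv calF1_deriv by (auto simp: calF_eq fun_eq_iff intro!: DERIV_imp_deriv)

lemma C_2_calF: "C_k 2 (calF (2 * w))"
proof -
  have "calF0 differentiable (at x)" "calF1 differentiable (at x)" for x
    using calF0_deriv calF1_deriv real_differentiable_def by blast+
  then show ?thesis
    unfolding C_k_def using calF2_cont by (simp add: numeral_2_eq_2 less_Suc_eq deriv_calF) (simp add: calF_eq)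
qed

lemma not_C_3_calF: "\<not> C_k 3 (calF (2 * w))"
proof
  assume "C_k 3 (calF (2 * w))"
  then have "(deriv ^^ 2) (calF (2 * w)) differentiable (at xstar)" unfolding C_k_def by simp
  then have "calF2 differentiable (at xstar)" by (simp add: numeral_2_eq_2 deriv_calF)
  then show False using differentiable_imp_holder_1 calF2_not_holder[of 1] by simp
qed

end

theorem theorem1p6:
  fixes \<eta> :: real
  assumes "\<eta> > 0"
  shows "C_k 2 (calF \<eta>) \<and> \<not> C_k 3 (calF \<eta>) \<and>
    (\<lambda>x. calF \<eta> x - 1 / 12 * (2 - x) ^ 3) \<in> O[at_left 2](\<lambda>x. (2 - x) ^ 4) \<and>
    (\<forall>\<alpha>>0. \<not> holder_continuous_at \<alpha> (deriv (deriv (calF \<eta>))) (x_star \<eta>))"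
proof -
  interpret half_eta "\<eta> / 2" by unfold_locales (use assms in simp)
  have \<eta>: "2 * (\<eta> / 2) = \<eta>" by simp
  note deriv_calF = deriv_calF[unfolded \<eta>]
  show ?thesis
    using C_2_calF not_C_3_calF calF0_asymptotics calF2_not_holder
    unfolding \<eta> calF_eq[unfolded \<eta>, symmetric] deriv_calF xstar_eq[unfolded \<eta>, symmetric] by blast
qed

end
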